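(* Given $s>-\frac34$, there exist $b'\in(-\frac12,0)$ and $\epsilon_s>0$ such that for any $b\in(\frac12,b'+1]$ with $b'+1-b\le\epsilon_s$ the following bilinear estimates hold for all $u\in X^{1}_{s,b}$ and $v\in X^{-1}_{s,b}$: $$\|(vv)_x\|_{X_{s,b'}^{1}}\le c_{(s,b,b')}\,\|v\|_{X_{s,b}^{-1}}^2,$$ $$\|(uu)_x\|_{X_{s,b'}^{-1}}\le c_{(s,b,b')}\,\|u\|_{X_{s,b}^{1}}^2,$$ $$\|(uv)_x\|_{X_{s,b'}^{1}}\le c_{(s,b,b')}\,\|u\|_{X_{s,b}^{1}}\,\|v\|_{X_{s,b}^{-1}},$$ $$\|(uv)_x\|_{X_{s,b'}^{-1}}\le c_{(s,b,b')}\,\|u\|_{X_{s,b}^{1}}\,\|v\|_{X_{s,b}^{-1}},$$ where $c_{(s,b,b')}$ is a positive constant depending only on $s$, $b$ and $b'$.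
   Context: For $a\neq0$ and $s,b\in\mathbb{R}$, $X_{s,b}^a$ denotes the completion of the Schwartz space $\mathcal S(\mathbb{R}^2)$ (functions $F=F(x,t)$) with respect to the norm $$\|F\|_{X_{s,b}^a}=\Big(\int_{\mathbb{R}}\int_{\mathbb{R}}\langle\tau+a\xi^3\rangle^{2b}\langle\xi\rangle^{2s}|\widehat F(\xi,\tau)|^2\,d\xi\,d\tau\Big)^{1/2},$$ where $\langle\xi\rangle=1+|\xi|$ and $\widehat F(\xi,\tau)=(2\pi)^{-1}\int_{\mathbb{R}^2}e^{-i(x\xi+t\tau)}F(x,t)\,dx\,dt$. *)

theory Defs
  imports "HOL-Analysis.Analysis"
begin

text \<open>Points of the plane are pairs \<open>(x, t)\<close>, and \<open>(\<xi>, \<tau>)\<close> on the Fourier side.\<close>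

text \<open>In the next definition \<open>D m n\<close> is necessarily the mixed partial derivative of order
  \<open>m\<close> in \<open>x\<close> and \<open>n\<close> in \<open>t\<close>; the existence of the whole family is smoothness of \<open>F\<close>.\<close>

definition schwartz :: "(real \<times> real \<Rightarrow> complex) \<Rightarrow> bool" where
  "schwartz F \<longleftrightarrow>
    (\<exists>D :: nat \<Rightarrow> nat \<Rightarrow> real \<times> real \<Rightarrow> complex.
       D 0 0 = F \<and>
       (\<forall>m n z. (D m n has_derivative
          (\<lambda>h. fst h *\<^sub>R D (Suc m) n z + snd h *\<^sub>R D m (Suc n) z)) (at z)) \<and>
       (\<forall>m n j k. \<exists>C. \<forall>x t. \<bar>x\<bar> ^ j * \<bar>t\<bar> ^ k * cmod (D m n (x, t)) \<le> C))"

definition dx :: "(real \<times> real \<Rightarrow> complex) \<Rightarrow> real \<times> real \<Rightarrow> complex" where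
  "dx F = (\<lambda>(x, t). vector_derivative (\<lambda>y. F (y, t)) (at x))"

definition fourier :: "(real \<times> real \<Rightarrow> complex) \<Rightarrow> real \<times> real \<Rightarrow> complex" where
  "fourier F = (\<lambda>(\<xi>, \<tau>).
     1 / (2 * complex_of_real pi) *
     integral\<^sup>L lborel (\<lambda>(x, t). exp (- \<i> * complex_of_real (x * \<xi> + t * \<tau>)) * F (x, t)))"

definition japanese :: "real \<Rightarrow> real" where
  "japanese x = 1 + \<bar>x\<bar>"

text \<open>The norm on the Schwartz space. It is only applied to Schwartz functions, for which the
  integrand is integrable.\<close>

definition pre_norm :: "real \<Rightarrow> real \<Rightarrow> real \<Rightarrow> (real \<times> real \<Rightarrow> complex) \<Rightarrow> real" where
  "pre_norm a s b F =
     sqrt (integral\<^sup>L lborel (\<lambda>(\<xi>, \<tau>).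
       japanese (\<tau> + a * \<xi> ^ 3) powr (2 * b) * japanese \<xi> powr (2 * s) *
       (cmod (fourier F (\<xi>, \<tau>)))\<^sup>2))"

text \<open>The completion is the set of Cauchy sequences of Schwartz functions modulo sequences
  tending to zero; an element of \<open>X_space a s b\<close> is an equivalence class of sequences, and its
  norm is the common limit of the norms along its representatives.\<close>

definition X_cauchy :: "real \<Rightarrow> real \<Rightarrow> real \<Rightarrow> (nat \<Rightarrow> real \<times> real \<Rightarrow> complex) set" where
  "X_cauchy a s b =
     {u. (\<forall>n. schwartz (u n)) \<and>
         (\<forall>e>0. \<exists>N. \<forall>m\<ge>N. \<forall>n\<ge>N. pre_norm a s b (\<lambda>z. u m z - u n z) < e)}"

definition X_rel :: "real \<Rightarrow> real \<Rightarrow> real \<Rightarrow> (nat \<Rightarrow> real \<times> real \<Rightarrow> complex) rel" where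
  "X_rel a s b =
     {(u, v). u \<in> X_cauchy a s b \<and> v \<in> X_cauchy a s b \<and>
              (\<lambda>n. pre_norm a s b (\<lambda>z. u n z - v n z)) \<longlonglongrightarrow> 0}"

definition X_space :: "real \<Rightarrow> real \<Rightarrow> real \<Rightarrow> (nat \<Rightarrow> real \<times> real \<Rightarrow> complex) set set" where
  "X_space a s b = X_cauchy a s b // X_rel a s b"

definition X_norm :: "real \<Rightarrow> real \<Rightarrow> real \<Rightarrow> (nat \<Rightarrow> real \<times> real \<Rightarrow> complex) set \<Rightarrow> real" where
  "X_norm a s b U = (THE r. \<forall>u\<in>U. (\<lambda>n. pre_norm a s b (u n)) \<longlonglongrightarrow> r)"

text \<open>\<open>is_dx_product a s b U V W\<close> says that \<open>W\<close> is the element \<open>(UV)\<^sub>x\<close> of \<open>X_space a s b\<close>.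
  For negative \<open>s\<close> there is no pointwise product on the completions, so \<open>(UV)\<^sub>x\<close> is the
  extension by continuity of the map taking Schwartz functions \<open>f\<close>, \<open>g\<close> to \<open>(fg)\<^sub>x\<close>: along
  all representatives \<open>u\<close> of \<open>U\<close> and \<open>v\<close> of \<open>V\<close>, the functions \<open>(u\<^sub>n v\<^sub>n)\<^sub>x\<close> form a Cauchy
  sequence in the target norm that represents \<open>W\<close>. Since distinct classes are disjoint,
  nonempty \<open>U\<close> and \<open>V\<close> admit at most one such \<open>W\<close>.\<close>

definition is_dx_product :: "real \<Rightarrow> real \<Rightarrow> real \<Rightarrow>
    (nat \<Rightarrow> real \<times> real \<Rightarrow> complex) set \<Rightarrow> (nat \<Rightarrow> real \<times> real \<Rightarrow> complex) set \<Rightarrow>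
    (nat \<Rightarrow> real \<times> real \<Rightarrow> complex) set \<Rightarrow> bool" where
  "is_dx_product a s b U V W \<longleftrightarrow>
     W \<in> X_space a s b \<and>
     (\<forall>u\<in>U. \<forall>v\<in>V. (\<lambda>n. dx (\<lambda>z. u n z * v n z)) \<in> W)"

end

theory Submission
  imports Defs "HOL-Probability.Characteristic_Functions"
begin

text \<open>On the Fourier side the estimates are bounds for trilinear forms with a multiplier. Since the
  dispersion relations of the three factors do not all have the same sign, the modulations add up to
  \<open>x\<^sup>3 - y\<^sup>3 - z\<^sup>3\<close> with \<open>x + y + z = 0\<close>, which is comparable to \<open>\<bar>x\<bar> (y\<^sup>2 + z\<^sup>2)\<close>; hence the largest
  modulation dominates this quantity. Applying Cauchy--Schwarz with the point of largest modulation
  held fixed leaves the integral of a bracket along the resonance function of the two free points.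
  If they have frequencies \<open>y\<close> and \<open>z\<close>, that function is the quadratic \<open>t + x\<^sup>3/4 + 3 x (\<eta> - x/2)\<^sup>2\<close>,
  whose critical point is what forces \<open>s > - 3/4\<close>; otherwise it is strictly monotone with derivative
  at least \<open>y\<^sup>2 + z\<^sup>2\<close> up to a constant, and there is room to spare. For \<open>\<bar>x\<bar> \<le> 1\<close> and output of frequency \<open>y\<close> or \<open>z\<close>, one
  fixes the output point instead. Since \<open>\<langle>y + z\<rangle> \<le> \<langle>y\<rangle> \<langle>z\<rangle>\<close>, the multiplier
  decreases in \<open>s\<close>, so only \<open>s\<close> near \<open>- 3/4\<close> matters.\<close>

section \<open>One-dimensional integrals of brackets\<close>

text \<open>Let \<rho> = \<open>-s\<close> and \<beta> = \<open>-2 * b'\<close>. With the point at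
  frequency \<open>x\<close> fixed, the weight left is
  \<open>|x|^(2-2\<rho>) <x>^(-2\<rho>) <t - x^3>^(2\<rho>-\<beta>)\<close>, and the quadratic
  integral returns \<open>|x|^(-1/2) <t + x^3/4>^(-1/2)\<close>. The worst case is the critical
  value \<open>t = -x^3/4\<close>, where \<open><t - x^3>\<close> has size \<open>|x|^3\<close>: the
  powers of a large \<open>x\<close> add up to \<open>3/2 + 2\<rho> - 3\<beta>\<close>. Requiring
  this to be at most 0 with \<beta> < 1, that is \<open>b' > -1/2\<close>, is possible exactly for
  \<rho> < 3/4. The output bracket has only the power -\<beta> with \<beta> \<le> 1, the input
  brackets have -a with \<open>a = 2 * b > 1\<close>. When an input has the largest modulation, the
  two powers can be exchanged at no cost, so the fixed point always has the weak power and both free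
  points the integrable one. Duality is replaced by testing the trilinear form on the weighted
  output itself. That the transform of a product is a convolution comes from Fourier inversion,
  which is proved by Gaussian damping.\<close>

lemma japanese_ge_1: "japanese x \<ge> 1"
  by (simp add: japanese_def)

lemma japanese_pos [simp]: "japanese x > 0"
  by (simp add: japanese_def)

lemma japanese_nonneg: "japanese x \<ge> 0"
  by (simp add: japanese_def)

lemma japanese_nonzero [simp]: "japanese x \<noteq> 0"
  using japanese_pos[of x] by linarith

lemma japanese_minus [simp]: "japanese (- x) = japanese x"
  by (simp add: japanese_def)

lemma japanese_measurable [measurable]: "japanese \<in> borel_measurable borel"
  unfolding japanese_def [abs_def] by measurable

lemma japanese_add_le: "japanese (x + y) \<le> japanese x * japanese y"
  unfolding japanese_def using abs_triangle_ineq[of x y] mult_nonneg_nonneg[of "\<bar>x\<bar>" "\<bar>y\<bar>"]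
  by (simp add: algebra_simps del: mult_nonneg_nonneg)

text \<open>Odd reflection of the primitive on the half line, normalised to vanish at 0 so that the
  two branches match there. For \<open>a > 1\<close> it is bounded by
  \<open>1 / (a - 1)\<close>.\<close>

lemma japanese_primitive_deriv:
  fixes a :: real
  assumes "a \<noteq> 1"
  shows "((\<lambda>x. sgn x * (1 - (1 + \<bar>x\<bar>) powr (1 - a)) / (a - 1)) has_real_derivative
           japanese x powr (- a)) (at x)"
proof -
  let ?f = "\<lambda>h::real. (1 - (1 + h) powr (1 - a)) / (a - 1)"
  let ?P = "\<lambda>x::real. sgn x * (1 - (1 + \<bar>x\<bar>) powr (1 - a)) / (a - 1)"
  have f': "(?f has_real_derivative (1 + h) powr (- a)) (at h)" if "h > - 1" for h
    using that assms by (auto intro!: derivative_eq_intros simp: divide_simps) (simp add: algebra_simps)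
  consider "x > 0" | "x < 0" | "x = 0" by linarith
  then show ?thesis
  proof cases
    case 1
    have "(?P has_real_derivative (1 + x) powr (- a)) (at x)"
      by (rule has_field_derivative_transform_within_open[OF f'[of x], of "{0<..}"]) (use 1 in auto)
    with 1 show ?thesis by (simp add: japanese_def)
  next
    case 2
    have "((\<lambda>x. - ?f (- x)) has_real_derivative (1 - x) powr (- a)) (at x)"
      using 2 assms by (auto intro!: derivative_eq_intros simp: divide_simps) (simp add: algebra_simps)
    then have "(?P has_real_derivative (1 - x) powr (- a)) (at x)"
      by (rule has_field_derivative_transform_within_open[of _ _ _ "{..<0}"])
        (use 2 in \<open>auto simp: divide_simps\<close>)
    with 2 show ?thesis by (simp add: japanese_def)
  next
    case 3
    \<comment> \<open>\<open>?P\<close> is odd, so its difference quotient at 0 is that of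
      \<open>?f\<close> at |h|.\<close>
    have "((\<lambda>h. ?f h / h) \<longlongrightarrow> 1) (at 0)"
      using f'[of 0] by (simp add: DERIV_def)
    moreover have "filterlim (abs :: real \<Rightarrow> real) (at 0) (at 0)"
      by (auto simp: filterlim_at eventually_at_filter intro!: tendsto_eq_intros)
    ultimately have "((\<lambda>h::real. ?f \<bar>h\<bar> / \<bar>h\<bar>) \<longlongrightarrow> 1) (at 0)"
      by (rule filterlim_compose)
    then have "((\<lambda>h::real. ?P h / h) \<longlongrightarrow> 1) (at 0)"
      by (rule Lim_transform_eventually)
        (auto simp: eventually_at_filter sgn_if divide_simps intro!: always_eventually)
    with 3 show ?thesis by (simp add: DERIV_def japanese_def)
  qed
qed

text \<open>The fundamental theorem is applied to the bounded primitive composed with \<phi>. Twice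
  the supremum \<open>1 / (a - 1)\<close> of the primitive bounds the integral over every [-n, n],
  whatever \<phi> is.\<close>

lemma nn_integral_japanese_subst:
  fixes \<phi> \<phi>' :: "real \<Rightarrow> real"
  assumes a: "a > 1"
    and \<phi>: "\<And>x. (\<phi> has_real_derivative \<phi>' x) (at x)"
    and nonneg: "\<And>x. \<phi>' x \<ge> 0"
    and [measurable]: "\<phi>' \<in> borel_measurable borel"
  shows "(\<integral>\<^sup>+x. ennreal (\<phi>' x * japanese (\<phi> x) powr (- a)) \<partial>lborel) \<le> ennreal (2 / (a - 1))"
proof -
  let ?P = "\<lambda>x::real. sgn x * (1 - (1 + \<bar>x\<bar>) powr (1 - a)) / (a - 1)"
  let ?f = "\<lambda>x. \<phi>' x * japanese (\<phi> x) powr (- a)"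
  have [measurable]: "\<phi> \<in> borel_measurable borel"
    using \<phi> by (intro borel_measurable_continuous_onI) (metis DERIV_continuous_on UNIV_I has_field_derivative_at_within)
  have P: "\<bar>?P x\<bar> \<le> 1 / (a - 1)" for x
  proof -
    have "0 < (1 + \<bar>x\<bar>) powr (1 - a)" "(1 + \<bar>x\<bar>) powr (1 - a) \<le> 1"
      using a powr_mono2'[of "1-a" 1 "1 + \<bar>x\<bar>"] by auto
    then show ?thesis
      using a by (auto simp: abs_mult divide_simps sgn_if)
  qed
  have "(\<integral>\<^sup>+x. ennreal (?f x) * indicator {- real n..real n} x \<partial>lborel) \<le> ennreal (2 / (a - 1))" for n
  proof -
    have "(\<integral>\<^sup>+x. ennreal (?f x) * indicator {- real n..real n} x \<partial>lborel)
        = ennreal (?P (\<phi> (real n)) - ?P (\<phi> (- real n)))"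
    proof (rule nn_integral_FTC_Icc)
      show "((\<lambda>x. ?P (\<phi> x)) has_real_derivative ?f x) (at x)" for x
        using DERIV_chain2[OF japanese_primitive_deriv \<phi>, of a x] a by (simp add: mult.commute)
    qed (use nonneg in auto)
    also have "\<dots> \<le> ennreal (2 / (a - 1))"
    proof (rule ennreal_leI)
      show "?P (\<phi> (real n)) - ?P (\<phi> (- real n)) \<le> 2 / (a - 1)"
        using P[of "\<phi> (real n)"] P[of "\<phi> (- real n)"] add_divide_distrib[of 1 1 "a - 1"]
        unfolding abs_le_iff by (simp only: one_add_one) linarith
    qed
    finally show ?thesis .
  qed
  note * = this
  have "(\<integral>\<^sup>+x. ennreal (?f x) \<partial>lborel)
      = (\<integral>\<^sup>+x. (SUP n. ennreal (?f x) * indicator {- real n..real n} x) \<partial>lborel)"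
  proof (rule nn_integral_cong)
    fix x :: real
    obtain n where n: "\<bar>x\<bar> \<le> real n" using real_arch_simple by blast
    have "ennreal (?f x) = ennreal (?f x) * indicator {- real n..real n} x"
      using n by (auto simp: indicator_def)
    also have "\<dots> \<le> (SUP n. ennreal (?f x) * indicator {- real n..real n} x)"
      by (rule SUP_upper) simp
    finally show "ennreal (?f x) = (SUP n. ennreal (?f x) * indicator {- real n..real n} x)"
      by (intro antisym SUP_least) (auto simp: indicator_def)
  qed
  also have "\<dots> = (SUP n. \<integral>\<^sup>+x. ennreal (?f x) * indicator {- real n..real n} x \<partial>lborel)"
    by (rule nn_integral_monotone_convergence_SUP)
      (auto simp: incseq_def le_fun_def indicator_def)
  also have "\<dots> \<le> ennreal (2 / (a - 1))"
    using * by (intro SUP_least)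
  finally show ?thesis .
qed

lemma nn_integral_japanese:
  assumes a: "a > 1"
  shows "(\<integral>\<^sup>+x. ennreal (japanese x powr (- a)) \<partial>lborel) \<le> ennreal (2 / (a - 1))"
  using nn_integral_japanese_subst[OF a, of "\<lambda>x. x" "\<lambda>_. 1"] by simp

text \<open>Since \<open>c = x + (c - x)\<close>, the larger of the brackets of \<open>x\<close> and
  \<open>c - x\<close> is at least half that of \<open>c\<close>. Its power is pulled out, and the
  other power is at most the sum of the two integrable ones.\<close>

lemma nn_integral_japanese_conv:
  assumes a: "a > 1"
  shows "(\<integral>\<^sup>+x. ennreal (japanese x powr (- a) * japanese (c - x) powr (- a)) \<partial>lborel)
     \<le> ennreal (2 powr a * (4 / (a - 1)) * japanese c powr (- a))"
proof -
  have pt: "japanese x powr (- a) * japanese (c - x) powr (- a)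
     \<le> 2 powr a * japanese c powr (- a) * (japanese x powr (- a) + japanese (c - x) powr (- a))" for x
  proof -
    have *: "p powr (- a) * q powr (- a) \<le> 2 powr a * r powr (- a) * (p powr (- a) + q powr (- a))"
      if "r \<le> p + q" "q \<le> p" "0 < q" "0 < r" for p q r :: real
    proof -
      have "p powr (- a) \<le> (r / 2) powr (- a)"
        using that a by (intro powr_mono2') auto
      also have "\<dots> = 2 powr a * r powr (- a)"
        using that by (simp add: powr_divide powr_minus divide_simps)
      finally have "p powr (- a) * q powr (- a) \<le> 2 powr a * r powr (- a) * q powr (- a)"
        by (intro mult_right_mono) auto
      also have "\<dots> \<le> 2 powr a * r powr (- a) * (p powr (- a) + q powr (- a))"
        by (intro mult_left_mono) auto
      finally show ?thesis .
    qed
    have s: "japanese c \<le> japanese x + japanese (c - x)"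
      unfolding japanese_def by linarith
    show ?thesis
    proof (cases "japanese (c - x) \<le> japanese x")
      case True
      then show ?thesis using *[OF s True] by simp
    next
      case False
      then show ?thesis using *[of "japanese c" "japanese (c - x)" "japanese x"] s
        by (simp add: algebra_simps)
    qed
  qed
  have i2: "(\<integral>\<^sup>+x. ennreal (japanese (c - x) powr (- a)) \<partial>lborel) \<le> ennreal (2 / (a - 1))"
    using nn_integral_japanese_subst[OF a, of "\<lambda>x. x - c" "\<lambda>_. 1"] japanese_minus[of "x - c" for x]
    by (simp add: DERIV_cong[OF DERIV_diff[OF DERIV_ident DERIV_const]])
  have "(\<integral>\<^sup>+x. ennreal (japanese x powr (- a) * japanese (c - x) powr (- a)) \<partial>lborel)
    \<le> (\<integral>\<^sup>+x. ennreal (2 powr a * japanese c powr (- a)) *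
          (ennreal (japanese x powr (- a)) + ennreal (japanese (c - x) powr (- a))) \<partial>lborel)"
    using pt by (intro nn_integral_mono) (simp flip: ennreal_mult ennreal_plus)
  also have "\<dots> = ennreal (2 powr a * japanese c powr (- a)) *
     ((\<integral>\<^sup>+x. ennreal (japanese x powr (- a)) \<partial>lborel) + (\<integral>\<^sup>+x. ennreal (japanese (c - x) powr (- a)) \<partial>lborel))"
    by (simp add: nn_integral_cmult nn_integral_add)
  also have "\<dots> \<le> ennreal (2 powr a * japanese c powr (- a)) * (ennreal (2 / (a - 1)) + ennreal (2 / (a - 1)))"
    by (intro mult_left_mono add_mono nn_integral_japanese a i2) auto
  also have "\<dots> = ennreal (2 powr a * (4 / (a - 1)) * japanese c powr (- a))"
    using a by (simp flip: ennreal_mult ennreal_plus)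
  finally show ?thesis .
qed

text \<open>For \<open>c \<ge> 0\<close> write \<open>|c - y^2| = d * (|y| + r)\<close> with
  \<open>d = ||y| - r|\<close>; the second factor dominates both \<open>d\<close> and
  \<open>r\<close>, so the distance to the roots counts with slope about the root of
  \<open>japanese c\<close>. For \<open>c < 0\<close> there is no root, and the inequality of
  arithmetic and geometric means suffices.\<close>

lemma japanese_quadratic_lower:
  fixes c y :: real
  defines "r \<equiv> sqrt (max c 0)"
  shows "japanese (sqrt (japanese c) * (\<bar>y\<bar> - r)) \<le> 3 * japanese (c - y\<^sup>2)"
proof -
  define l where "l = sqrt (japanese c)"
  have l0: "l \<ge> 0" by (simp add: l_def japanese_def)
  have l2: "l\<^sup>2 = 1 + \<bar>c\<bar>" by (simp add: l_def japanese_def)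
  show ?thesis
  proof (cases "c \<ge> 0")
    case True
    then have r: "r \<ge> 0" "r\<^sup>2 = c" by (auto simp: r_def)
    define d where "d = \<bar>\<bar>y\<bar> - r\<bar>"
    have d0: "d \<ge> 0" by (simp add: d_def)
    have "\<bar>c - y\<^sup>2\<bar> = d * (\<bar>y\<bar> + r)"
    proof -
      have "c - y\<^sup>2 = - ((\<bar>y\<bar> - r) * (\<bar>y\<bar> + r))" using r by (simp add: power2_eq_square algebra_simps)
      then show ?thesis using r by (simp add: abs_mult d_def)
    qed
    moreover have "d * (\<bar>y\<bar> + r) \<ge> d * d" using r d0 by (intro mult_left_mono) (auto simp: d_def)
    moreover have "d * (\<bar>y\<bar> + r) \<ge> d * r" using r d0 by (intro mult_left_mono) auto
    moreover have "l \<le> 1 + r"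
      by (rule power2_le_imp_le) (use l2 r True in \<open>auto simp: power2_eq_square algebra_simps\<close>)
    then have "l * d \<le> d + d * r" using d0 mult_right_mono[of l "1 + r" d] by (simp add: algebra_simps)
    moreover have "2 * d \<le> 1 + d * d" using zero_le_square[of "d - 1"] by (simp add: algebra_simps)
    moreover define e where "e = d * (\<bar>y\<bar> + r)"
    ultimately have "\<bar>c - y\<^sup>2\<bar> = e" "d * d \<le> e" "d * r \<le> e" "l * d \<le> d + d * r" "2 * d \<le> 1 + d * d"
      by simp_all
    moreover from this(2,3,4,5) have "1 + l * d \<le> 3 * (1 + e)" using zero_le_square[of d] by argo
    ultimately have "1 + l * d \<le> 3 * (1 + \<bar>c - y\<^sup>2\<bar>)" by simp
    then show ?thesis using l0 by (simp add: japanese_def abs_mult d_def l_def)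
  next
    case False
    then have r: "r = 0" by (simp add: r_def)
    have "2 * (l * \<bar>y\<bar>) \<le> l\<^sup>2 + y\<^sup>2" using zero_le_power2[of "l - \<bar>y\<bar>"] by (simp add: power2_eq_square algebra_simps)
    then have "1 + l * \<bar>y\<bar> \<le> 3 * (1 + \<bar>c - y\<^sup>2\<bar>)" using False l2 by (simp add: abs_if split: if_splits)
    then show ?thesis using l0 r by (simp add: japanese_def abs_mult l_def)
  qed
qed

text \<open>\<open>japanese_quadratic_lower\<close> replaces the quadratic by two lines of slope
  \<open>m\<close>, one for each sign of \<open>y\<close>, and each line contributes a multiple of
  \<open>1 / m\<close>.\<close>

lemma nn_integral_japanese_quadratic:
  fixes a c k :: real
  assumes a: "a > 1" and k: "k \<noteq> 0"
  shows "(\<integral>\<^sup>+y. ennreal (japanese (c + k * y\<^sup>2) powr (- a)) \<partial>lborel)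
     \<le> ennreal (3 powr a * (4 / (a - 1)) * \<bar>k\<bar> powr (- (1/2)) * japanese c powr (- (1/2)))"
proof -
  \<comment> \<open>With this sign, \<open>c + k * y^2\<close> equals \<open>c' - |k| * y^2\<close>
    up to sign, whatever the sign of \<open>k\<close>.\<close>
  define c' where "c' = (if k > 0 then - c else c)"
  define m where "m = sqrt (japanese c) * sqrt \<bar>k\<bar>"
  define r where "r = sqrt (japanese c) * sqrt (max c' 0)"
  have m: "m > 0" using k by (simp add: m_def)
  have pt: "japanese (c + k * y\<^sup>2) powr (- a)
      \<le> 3 powr a * (japanese (m * y - r) powr (- a) + japanese (m * y + r) powr (- a))" for y
  proof -
    have "japanese (c + k * y\<^sup>2) = japanese (c' - (sqrt \<bar>k\<bar> * y)\<^sup>2)"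
      using k by (simp add: japanese_def c'_def power_mult_distrib abs_if)
    moreover have "japanese c' = japanese c" by (simp add: c'_def)
    ultimately have *: "japanese (m * \<bar>y\<bar> - r) \<le> 3 * japanese (c + k * y\<^sup>2)"
      using japanese_quadratic_lower[of c' "sqrt \<bar>k\<bar> * y"]
      by (simp add: m_def r_def abs_mult algebra_simps)
    have "japanese (c + k * y\<^sup>2) powr (- a) = 3 powr a * (3 * japanese (c + k * y\<^sup>2)) powr (- a)"
      by (simp add: powr_mult powr_minus)
    also have "\<dots> \<le> 3 powr a * japanese (m * \<bar>y\<bar> - r) powr (- a)"
      using * a by (intro mult_left_mono powr_mono2') auto
    also have "\<dots> \<le> 3 powr a * (japanese (m * y - r) powr (- a) + japanese (m * y + r) powr (- a))"
    proof (intro mult_left_mono)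
      have "m * \<bar>y\<bar> - r = m * y - r \<or> m * \<bar>y\<bar> - r = - (m * y + r)" by (auto simp: abs_if)
      then have "japanese (m * \<bar>y\<bar> - r) = japanese (m * y - r) \<or> japanese (m * \<bar>y\<bar> - r) = japanese (m * y + r)"
        by (metis japanese_minus)
      then show "japanese (m * \<bar>y\<bar> - r) powr - a \<le> japanese (m * y - r) powr - a + japanese (m * y + r) powr - a"
        by auto
    qed auto
    finally show ?thesis .
  qed
  have i: "(\<integral>\<^sup>+y. ennreal (japanese (m * y + t) powr (- a)) \<partial>lborel) \<le> ennreal (2 / (a - 1) / m)" for t
  proof -
    have "ennreal m * (\<integral>\<^sup>+y. ennreal (japanese (m * y + t) powr (- a)) \<partial>lborel)
        = (\<integral>\<^sup>+y. ennreal (m * japanese (m * y + t) powr (- a)) \<partial>lborel)"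
      using m by (subst nn_integral_cmult[symmetric]) (auto simp: ennreal_mult)
    also have "\<dots> \<le> ennreal (2 / (a - 1))"
      using m by (intro nn_integral_japanese_subst a) (auto intro!: derivative_eq_intros)
    finally have "ennreal (1/m) * (ennreal m * (\<integral>\<^sup>+y. ennreal (japanese (m * y + t) powr (- a)) \<partial>lborel))
       \<le> ennreal (1/m) * ennreal (2 / (a - 1))" by (rule mult_left_mono) simp
    then show ?thesis using m a by (simp add: mult.assoc[symmetric] mult.commute flip: ennreal_mult)
  qed
  have "(\<integral>\<^sup>+y. ennreal (japanese (c + k * y\<^sup>2) powr (- a)) \<partial>lborel)
     \<le> (\<integral>\<^sup>+y. ennreal (3 powr a) * (ennreal (japanese (m * y + - r) powr (- a)) + ennreal (japanese (m * y + r) powr (- a))) \<partial>lborel)"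
    using pt by (intro nn_integral_mono) (simp flip: ennreal_mult ennreal_plus)
  also have "\<dots> = ennreal (3 powr a) * ((\<integral>\<^sup>+y. ennreal (japanese (m * y + - r) powr (- a)) \<partial>lborel)
      + (\<integral>\<^sup>+y. ennreal (japanese (m * y + r) powr (- a)) \<partial>lborel))"
    by (subst nn_integral_cmult) (auto simp: nn_integral_add)
  also have "\<dots> \<le> ennreal (3 powr a) * (ennreal (2 / (a - 1) / m) + ennreal (2 / (a - 1) / m))"
    by (intro mult_left_mono add_mono i) auto
  also have "\<dots> = ennreal (3 powr a * (4 / (a - 1)) * (1 / m))"
    using a m by (simp flip: ennreal_mult ennreal_plus)
  also have "1 / m = \<bar>k\<bar> powr (- (1/2)) * japanese c powr (- (1/2))"
    by (simp add: m_def powr_minus powr_half_sqrt less_imp_le divide_simps)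
  finally show ?thesis by (simp add: mult.assoc)
qed

section \<open>Pointwise bounds for the multiplier\<close>

text \<open>Throughout, the two inputs and the reflected output have frequencies \<open>x + y + z = 0\<close>, where \<open>x\<close>
  is the one whose dispersion relation has the opposite sign to the other two, and \<open>A\<close>, \<open>B\<close>, \<open>D\<close> are
  the brackets of the modulations belonging to \<open>x\<close>, \<open>y\<close>, \<open>z\<close>. The modulations sum to
  \<open>x\<^sup>3 - y\<^sup>3 - z\<^sup>3 = x (2 y\<^sup>2 + y z + 2 z\<^sup>2)\<close>.\<close>

lemma resonance:
  fixes x y z m :: real
  assumes sum: "x + y + z = 0" and res: "\<bar>x ^ 3 - y ^ 3 - z ^ 3\<bar> \<le> 3 * m" and m: "m \<ge> 1"
  shows "\<bar>x\<bar> * (1 + y\<^sup>2 + z\<^sup>2) \<le> 7 * m"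
proof -
  have x: "x = - (y + z)" using sum by simp
  have "x ^ 3 - y ^ 3 - z ^ 3 = x * (2 * y\<^sup>2 + y * z + 2 * z\<^sup>2)"
    unfolding x by (simp add: power2_eq_square power3_eq_cube algebra_simps)
  moreover have q: "2 * y\<^sup>2 + y * z + 2 * z\<^sup>2 \<ge> (3/2) * (y\<^sup>2 + z\<^sup>2)"
    using zero_le_power2[of "y + z"] by (simp add: power2_eq_square algebra_simps)
  moreover from q have "\<bar>2 * y\<^sup>2 + y * z + 2 * z\<^sup>2\<bar> = 2 * y\<^sup>2 + y * z + 2 * z\<^sup>2"
    by (intro abs_of_nonneg order_trans[OF _ q]) simp
  ultimately have "\<bar>x\<bar> * ((3/2) * (y\<^sup>2 + z\<^sup>2)) \<le> 3 * m"
    using res mult_left_mono[OF q, of "\<bar>x\<bar>"] by (simp add: abs_mult)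
  then have 1: "\<bar>x\<bar> * (y\<^sup>2 + z\<^sup>2) \<le> 2 * m" by (simp add: algebra_simps)
  have "x\<^sup>2 \<le> 2 * (y\<^sup>2 + z\<^sup>2)"
    unfolding x using zero_le_power2[of "y - z"] by (simp add: power2_eq_square algebra_simps)
  then have 2: "\<bar>x\<bar> * x\<^sup>2 \<le> 2 * (\<bar>x\<bar> * (y\<^sup>2 + z\<^sup>2))"
    using mult_left_mono[of "x\<^sup>2" "2 * (y\<^sup>2 + z\<^sup>2)" "\<bar>x\<bar>"] by (simp add: algebra_simps)
  have 3: "\<bar>x\<bar> \<le> 1 + \<bar>x\<bar> * x\<^sup>2"
  proof (cases "\<bar>x\<bar> \<le> 1")
    case True
    have "0 \<le> \<bar>x\<bar> * x\<^sup>2" by simp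
    with True show ?thesis by linarith
  next
    case False
    then have "1 \<le> x\<^sup>2" by (metis abs_ge_zero abs_square_le_1 linorder_linear power2_abs)
    then show ?thesis using mult_left_mono[of 1 "x\<^sup>2" "\<bar>x\<bar>"] by simp
  qed
  have "\<bar>x\<bar> * (1 + y\<^sup>2 + z\<^sup>2) = \<bar>x\<bar> + \<bar>x\<bar> * (y\<^sup>2 + z\<^sup>2)" by (simp add: algebra_simps)
  with 1 2 3 m show ?thesis by linarith
qed

section \<open>Frequency weights for the two kinds of output\<close>

lemma japanese_powr_2: "japanese y powr 2 = (japanese y)\<^sup>2"
  by (simp add: japanese_nonneg)

lemma japanese_sq_le: "(japanese y)\<^sup>2 \<le> 2 * (1 + y\<^sup>2)"
  using zero_le_power2[of "1 - \<bar>y\<bar>"] by (simp add: japanese_def power2_eq_square algebra_simps)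

lemma japanese_powr_le:
  assumes "1 + y\<^sup>2 \<le> M" "r \<ge> 0"
  shows "japanese y powr (2 * r) \<le> (2 * M) powr r"
proof -
  have "japanese y powr (2 * r) = ((japanese y)\<^sup>2) powr r"
    using powr_powr[of "japanese y" 2 r] by (simp add: japanese_powr_2)
  also have "\<dots> \<le> (2 * M) powr r"
    using japanese_sq_le[of y] assms by (intro powr_mono2) auto
  finally show ?thesis .
qed

lemma sq_sum_bound:
  fixes x y z :: real
  assumes "x + y + z = 0"
  shows "1 + x\<^sup>2 \<le> 2 * (1 + y\<^sup>2 + z\<^sup>2)"
proof -
  have x: "x = - (y + z)" using assms by simp
  show ?thesis unfolding x using zero_le_power2[of "y - z"]
    by (simp add: power2_eq_square algebra_simps)
qed

lemma weight_odd_output: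
  fixes x y z :: real
  assumes "0 \<le> \<rho>" "\<rho> \<le> 1"
  shows "x\<^sup>2 * japanese x powr (- 2 * \<rho>) * (japanese y powr (2 * \<rho>) * japanese z powr (2 * \<rho>))
    \<le> 32 * (x\<^sup>2 * japanese x powr (- 2 * \<rho>) * (1 + y\<^sup>2 + z\<^sup>2) powr (2 * \<rho>))"
proof -
  let ?N = "1 + y\<^sup>2 + z\<^sup>2"
  have "japanese y powr (2 * \<rho>) * japanese z powr (2 * \<rho>) \<le> (2 * ?N) powr \<rho> * (2 * ?N) powr \<rho>"
    using assms by (intro mult_mono japanese_powr_le) auto
  also have "\<dots> = (2 * ?N) powr (2 * \<rho>)"
    by (simp flip: powr_add)
  also have "\<dots> = 2 powr (2 * \<rho>) * ?N powr (2 * \<rho>)"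
    by (rule powr_mult)
  also have "\<dots> \<le> 2 powr 2 * ?N powr (2 * \<rho>)"
    using assms by (intro mult_right_mono powr_mono) auto
  \<comment> \<open>The bound so far is 4; 32 is the constant of
    \<open>weight_even_output_large\<close>, so that both outputs meet the same hypothesis of
    \<open>weight_majorant\<close>.\<close>
  also have "\<dots> \<le> 32 * ?N powr (2 * \<rho>)"
    by (intro mult_right_mono) (auto simp: powr_numeral)
  finally have "x\<^sup>2 * japanese x powr (- 2 * \<rho>) * (japanese y powr (2 * \<rho>) * japanese z powr (2 * \<rho>))
     \<le> x\<^sup>2 * japanese x powr (- 2 * \<rho>) * (32 * ?N powr (2 * \<rho>))"
    by (intro mult_left_mono) auto
  then show ?thesis by (simp add: mult_ac)
qed

text \<open>The exponents \<open>2 - 2\<rho>\<close> and \<open>2\<rho>\<close> add up to 2, so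
  however they are split the cost is one power of \<open>1 + y^2 + z^2\<close>.\<close>

lemma weight_even_pair:
  fixes y z :: real
  assumes "0 \<le> \<rho>" "\<rho> \<le> 1"
  shows "y\<^sup>2 * japanese y powr (- 2 * \<rho>) * japanese z powr (2 * \<rho>) \<le> 2 * (1 + y\<^sup>2 + z\<^sup>2)"
proof -
  let ?N = "1 + y\<^sup>2 + z\<^sup>2"
  have N: "?N > 0" by (simp add: add_pos_nonneg)
  have "y\<^sup>2 * japanese y powr (- 2 * \<rho>) \<le> japanese y powr 2 * japanese y powr (- 2 * \<rho>)"
    by (intro mult_right_mono) (auto simp: powr_numeral japanese_def abs_le_square_iff[symmetric])
  also have "\<dots> = japanese y powr (2 * (1 - \<rho>))"
    by (simp add: algebra_simps flip: powr_add)
  also have "\<dots> \<le> (2 * ?N) powr (1 - \<rho>)"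
    using assms by (intro japanese_powr_le) auto
  finally have "y\<^sup>2 * japanese y powr (- 2 * \<rho>) * japanese z powr (2 * \<rho>) \<le>
      (2 * ?N) powr (1 - \<rho>) * (2 * ?N) powr \<rho>"
    using assms by (intro mult_mono japanese_powr_le) auto
  also have "\<dots> = 2 * ?N" using N by (simp flip: powr_add)
  finally show ?thesis .
qed

lemma weight_even_output_small:
  fixes x y z :: real
  assumes "0 \<le> \<rho>" "\<rho> \<le> 1" "\<bar>x\<bar> \<le> 1"
  shows "y\<^sup>2 * japanese y powr (- 2 * \<rho>) * (japanese x powr (2 * \<rho>) * japanese z powr (2 * \<rho>))
    \<le> 8 * (1 + y\<^sup>2 + z\<^sup>2)"
proof -
  have "japanese x powr (2 * \<rho>) \<le> 2 powr (2 * \<rho>)"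
    using assms by (intro powr_mono2) (auto simp: japanese_def)
  also have "\<dots> \<le> 2 powr 2" using assms by (intro powr_mono) auto
  finally have "japanese x powr (2 * \<rho>) \<le> 4" by (simp add: powr_numeral)
  then have "japanese x powr (2 * \<rho>) * (y\<^sup>2 * japanese y powr (- 2 * \<rho>) * japanese z powr (2 * \<rho>))
     \<le> 4 * (2 * (1 + y\<^sup>2 + z\<^sup>2))"
    using assms by (intro mult_mono weight_even_pair) auto
  then show ?thesis by (simp add: mult_ac)
qed

text \<open>Brings an output at \<open>y\<close> to the form found for an output at
  \<open>x\<close>. Split \<open><x>^(2\<rho>)\<close> into \<open><x>^(4\<rho>-2)\<close>, a
  nonnegative power paid for with \<open>4 N^(2\<rho>-1)\<close>, and
  \<open><x>^(2-2\<rho>)\<close>, which for \<open>|x| \<ge> 1\<close> is at most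
  \<open>4 x^2 <x>^(-2\<rho>)\<close>. The other factors give \<open>2 N\<close>, hence
  \<open>4 * 4 * 2 = 32\<close>.\<close>

lemma weight_even_output_large:
  fixes x y z :: real
  assumes "x + y + z = 0" "1/2 \<le> \<rho>" "\<rho> \<le> 1" "\<bar>x\<bar> \<ge> 1"
  shows "y\<^sup>2 * japanese y powr (- 2 * \<rho>) * (japanese x powr (2 * \<rho>) * japanese z powr (2 * \<rho>))
    \<le> 32 * (x\<^sup>2 * japanese x powr (- 2 * \<rho>) * (1 + y\<^sup>2 + z\<^sup>2) powr (2 * \<rho>))"
proof -
  let ?N = "1 + y\<^sup>2 + z\<^sup>2"
  have N: "?N > 0" by (simp add: add_pos_nonneg)
  have J2: "(japanese x)\<^sup>2 \<le> 4 * x\<^sup>2"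
  proof -
    have "(japanese x)\<^sup>2 \<le> (2 * \<bar>x\<bar>)\<^sup>2"
      using assms by (intro power_mono) (auto simp: japanese_def)
    then show ?thesis by (simp add: power_mult_distrib)
  qed
  have "japanese x powr (2 * \<rho>) = japanese x powr (2 * (2 * \<rho> - 1)) * (japanese x powr 2 * japanese x powr (- 2 * \<rho>))"
    by (simp flip: powr_add)
  also have "\<dots> \<le> (2 * (2 * ?N)) powr (2 * \<rho> - 1) * ((4 * x\<^sup>2) * japanese x powr (- 2 * \<rho>))"
    using assms J2 sq_sum_bound[of x y z] by (intro mult_mono japanese_powr_le) (auto simp: japanese_powr_2)
  also have "(2 * (2 * ?N)) powr (2 * \<rho> - 1) = 4 powr (2 * \<rho> - 1) * ?N powr (2 * \<rho> - 1)"
    using N by (simp flip: powr_mult)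
  also have "\<dots> \<le> 4 powr 1 * ?N powr (2 * \<rho> - 1)"
    using assms by (intro mult_right_mono powr_mono) auto
  finally have "japanese x powr (2 * \<rho>) \<le> 4 * ?N powr (2 * \<rho> - 1) * (4 * x\<^sup>2 * japanese x powr (- 2 * \<rho>))"
    by (simp add: mult_right_mono)
  then have "japanese x powr (2 * \<rho>) * (y\<^sup>2 * japanese y powr (- 2 * \<rho>) * japanese z powr (2 * \<rho>))
     \<le> (4 * ?N powr (2 * \<rho> - 1) * (4 * x\<^sup>2 * japanese x powr (- 2 * \<rho>))) * (2 * ?N)"
    using assms by (intro mult_mono weight_even_pair) auto
  also have "\<dots> = 32 * (x\<^sup>2 * japanese x powr (- 2 * \<rho>) * (?N powr (2 * \<rho> - 1) * ?N powr 1))"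
    using N by simp
  also have "?N powr (2 * \<rho> - 1) * ?N powr 1 = ?N powr (2 * \<rho>)"
    by (subst powr_add[symmetric]) simp
  finally show ?thesis by (simp add: mult_ac)
qed

text \<open>The odd majorant is integrated with the point at frequency \<open>x\<close> fixed, the even majorant with
  one of the points at frequency \<open>y\<close> or \<open>z\<close> fixed; the brackets occurring with power \<open>- a\<close> are those of
  the two free points.\<close>

definition odd_majorant :: "real \<Rightarrow> real \<Rightarrow> real \<Rightarrow> real \<Rightarrow> real \<Rightarrow> real \<Rightarrow> real \<Rightarrow> real" where
  "odd_majorant \<rho> \<beta> a x A B D =
     \<bar>x\<bar> powr (2 - 2 * \<rho>) * japanese x powr (- 2 * \<rho>) * A powr (2 * \<rho> - \<beta>) * (B powr (- a) * D powr (- a))"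

definition even_majorant :: "real \<Rightarrow> real \<Rightarrow> real \<Rightarrow> real \<Rightarrow> real \<Rightarrow> real" where
  "even_majorant a y z A D = (1 + y\<^sup>2 + z\<^sup>2) * (A powr (- a) * D powr (- a))"

lemma odd_majorant_nonneg: "odd_majorant \<rho> \<beta> a x A B D \<ge> 0"
  by (simp add: odd_majorant_def)

lemma even_majorant_nonneg: "even_majorant a y z A D \<ge> 0"
  by (simp add: even_majorant_def)

text \<open>For the case that the point at \<open>x\<close> has the largest modulation: the
  resonance exchanges the whole power \<open>N^(2\<rho>)\<close> for \<open>A^(2\<rho>)\<close> and
  uses up \<open>|x|^(2\<rho>)\<close> of the two derivatives. The constant 49 bounds
  \<open>7^(2\<rho>)\<close>.\<close>

lemma weight_le_odd:
  fixes x :: real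
  assumes "0 \<le> \<rho>" "\<rho> \<le> 1" "N > 0" "\<bar>x\<bar> * N \<le> 7 * A"
  shows "x\<^sup>2 * japanese x powr (- 2 * \<rho>) * N powr (2 * \<rho>)
     \<le> 49 * (\<bar>x\<bar> powr (2 - 2 * \<rho>) * japanese x powr (- 2 * \<rho>) * A powr (2 * \<rho>))"
proof (cases "x = 0")
  case False
  then have A: "A > 0" using assms(3,4) mult_pos_pos[of "\<bar>x\<bar>" N] by linarith
  have "x\<^sup>2 = \<bar>x\<bar> powr (2 - 2 * \<rho>) * \<bar>x\<bar> powr (2 * \<rho>)"
    using False by (simp add: powr_numeral flip: powr_add)
  then have "x\<^sup>2 * japanese x powr (- 2 * \<rho>) * N powr (2 * \<rho>)
     = \<bar>x\<bar> powr (2 - 2 * \<rho>) * japanese x powr (- 2 * \<rho>) * (\<bar>x\<bar> * N) powr (2 * \<rho>)"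
    using assms by (simp add: powr_mult)
  also have "\<dots> \<le> \<bar>x\<bar> powr (2 - 2 * \<rho>) * japanese x powr (- 2 * \<rho>) * (7 powr 2 * A powr (2 * \<rho>))"
  proof (intro mult_left_mono)
    have "(\<bar>x\<bar> * N) powr (2 * \<rho>) \<le> (7 * A) powr (2 * \<rho>)"
      using assms by (intro powr_mono2) auto
    also have "\<dots> = 7 powr (2 * \<rho>) * A powr (2 * \<rho>)" using A by (simp add: powr_mult)
    also have "\<dots> \<le> 7 powr 2 * A powr (2 * \<rho>)"
      using assms by (intro mult_right_mono powr_mono) auto
    finally show "(\<bar>x\<bar> * N) powr (2 * \<rho>) \<le> 7 powr 2 * A powr (2 * \<rho>)" .
  qed auto
  finally show ?thesis by (simp add: powr_numeral mult_ac)
qed auto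

text \<open>The modulation weight will cancel only the power \<beta> of \<open>B\<close>, so only
  \<open>(|x| N)^\<beta>\<close> is exchanged. What is left of \<open>N\<close> has exponent
  \<open>2\<rho> - \<beta> \<le> 1\<close>, and what is left in \<open>x\<close> is bounded because
  \<open>2 \<le> \<beta> + 2\<rho>\<close>.\<close>

lemma weight_le_even:
  fixes x :: real
  assumes "0 \<le> \<rho>" "0 \<le> \<beta>" "\<beta> \<le> 1" "2 \<le> \<beta> + 2 * \<rho>" "2 * \<rho> - \<beta> \<le> 1" "N \<ge> 1" "\<bar>x\<bar> * N \<le> 7 * B"
  shows "x\<^sup>2 * japanese x powr (- 2 * \<rho>) * N powr (2 * \<rho>) \<le> 49 * (B powr \<beta> * N)"
proof (cases "x = 0")
  case False
  then have B: "B > 0" using assms(6,7) mult_pos_pos[of "\<bar>x\<bar>" N] by linarith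
  have "x\<^sup>2 = \<bar>x\<bar> powr (2 - \<beta>) * \<bar>x\<bar> powr \<beta>"
    using False by (simp add: powr_numeral flip: powr_add)
  moreover have "N powr (2 * \<rho>) = N powr \<beta> * N powr (2 * \<rho> - \<beta>)"
    by (simp flip: powr_add)
  ultimately have "x\<^sup>2 * japanese x powr (- 2 * \<rho>) * N powr (2 * \<rho>)
     = (\<bar>x\<bar> powr (2 - \<beta>) * japanese x powr (- 2 * \<rho>)) * (\<bar>x\<bar> * N) powr \<beta> * N powr (2 * \<rho> - \<beta>)"
    using assms by (simp add: powr_mult)
  also have "\<dots> \<le> 1 * (7 powr 2 * B powr \<beta>) * N powr 1"
  proof (intro mult_mono)
    have "(\<bar>x\<bar> * N) powr \<beta> \<le> (7 * B) powr \<beta>"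
      using assms by (intro powr_mono2) auto
    also have "\<dots> = 7 powr \<beta> * B powr \<beta>" using B by (simp add: powr_mult)
    also have "\<dots> \<le> 7 powr 2 * B powr \<beta>"
      using assms by (intro mult_right_mono powr_mono) auto
    finally show "(\<bar>x\<bar> * N) powr \<beta> \<le> 7 powr 2 * B powr \<beta>" .
    have "\<bar>x\<bar> powr (2 - \<beta>) * japanese x powr (- 2 * \<rho>) \<le> japanese x powr (2 - \<beta>) * japanese x powr (- 2 * \<rho>)"
      using assms by (intro mult_right_mono powr_mono2) (auto simp: japanese_def)
    also have "\<dots> = japanese x powr (2 - \<beta> - 2 * \<rho>)" by (simp flip: powr_add)
    also have "\<dots> \<le> japanese x powr 0"
      using assms japanese_ge_1[of x] by (intro powr_mono) auto
    finally show "\<bar>x\<bar> powr (2 - \<beta>) * japanese x powr (- 2 * \<rho>) \<le> 1" using japanese_pos[of x] by simp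
    show "N powr (2 * \<rho> - \<beta>) \<le> N powr 1" using assms by (intro powr_mono) auto
  qed auto
  finally show ?thesis using assms by (simp add: powr_numeral mult_ac)
qed (use assms in auto)

text \<open>\<open>W\<close> is the frequency part and \<open>S\<close> the modulation part of a
  squared kernel. Keeping both abstract lets the two kinds of output share the case distinction on
  the largest modulation. The constant is \<open>1568 = 32 * 49\<close>.\<close>

lemma weight_majorant:
  fixes x y z :: real
  assumes \<rho>: "0 \<le> \<rho>" "\<rho> \<le> 1" and \<beta>: "0 \<le> \<beta>" "\<beta> \<le> 1" "2 \<le> \<beta> + 2 * \<rho>" "2 * \<rho> - \<beta> \<le> 1"
    and sum: "x + y + z = 0" and res: "\<bar>x ^ 3 - y ^ 3 - z ^ 3\<bar> \<le> A + B + D"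
    and ABD: "A \<ge> 1" "B \<ge> 1" "D \<ge> 1"
    and W: "W \<le> 32 * (x\<^sup>2 * japanese x powr (- 2 * \<rho>) * (1 + y\<^sup>2 + z\<^sup>2) powr (2 * \<rho>))"
    and S: "S \<ge> 0"
      "B \<le> A \<Longrightarrow> D \<le> A \<Longrightarrow> S \<le> A powr (- \<beta>) * (B powr (- a) * D powr (- a))"
      "A \<le> B \<Longrightarrow> D \<le> B \<Longrightarrow> S \<le> B powr (- \<beta>) * (A powr (- a) * D powr (- a))"
      "A \<le> D \<Longrightarrow> B \<le> D \<Longrightarrow> S \<le> D powr (- \<beta>) * (A powr (- a) * B powr (- a))"
  shows "W * S \<le> 1568 * (odd_majorant \<rho> \<beta> a x A B D + even_majorant a y z A D + even_majorant a y z A B)"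
proof -
  let ?N = "1 + y\<^sup>2 + z\<^sup>2"
  let ?V = "x\<^sup>2 * japanese x powr (- 2 * \<rho>) * ?N powr (2 * \<rho>)"
  have nn: "0 \<le> odd_majorant \<rho> \<beta> a x A B D" "0 \<le> even_majorant a y z A D" "0 \<le> even_majorant a y z A B"
    by (rule odd_majorant_nonneg even_majorant_nonneg)+
  have N: "?N \<ge> 1" "?N > 0" by (simp_all add: add_pos_nonneg)
  have WS: "W * S \<le> 32 * (?V * S)" using mult_right_mono[OF W S(1)] by simp
  consider "B \<le> A" "D \<le> A" | "A \<le> B" "D \<le> B" | "A \<le> D" "B \<le> D" by linarith
  then have "?V * S \<le> 49 * (odd_majorant \<rho> \<beta> a x A B D + even_majorant a y z A D + even_majorant a y z A B)"
  proof cases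
    case 1
    have m: "\<bar>x\<bar> * ?N \<le> 7 * A" by (rule resonance) (use 1 sum res ABD in auto)
    have "?V * S \<le> 49 * (\<bar>x\<bar> powr (2 - 2 * \<rho>) * japanese x powr (- 2 * \<rho>) * A powr (2 * \<rho>))
        * (A powr (- \<beta>) * (B powr (- a) * D powr (- a)))"

      by (rule mult_mono[OF weight_le_odd S(2)]) (use \<rho> 1 S N m in auto)
    also have "\<dots> = 49 * (\<bar>x\<bar> powr (2 - 2 * \<rho>) * japanese x powr (- 2 * \<rho>) * (A powr (2 * \<rho>)
        * A powr (- \<beta>)) * (B powr (- a) * D powr (- a)))" by simp
    also have "\<dots> = 49 * odd_majorant \<rho> \<beta> a x A B D"
      by (simp add: odd_majorant_def flip: powr_add)
    finally show ?thesis using nn by simp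
  next
    case 2
    have m: "\<bar>x\<bar> * ?N \<le> 7 * B" by (rule resonance) (use 2 sum res ABD in auto)
    have "?V * S \<le> 49 * (B powr \<beta> * ?N) * (B powr (- \<beta>) * (A powr (- a) * D powr (- a)))"

      by (rule mult_mono[OF weight_le_even S(3)]) (use \<rho> \<beta> 2 S N m in auto)
    also have "\<dots> = 49 * even_majorant a y z A D"
      using ABD by (simp add: even_majorant_def powr_minus)
    finally show ?thesis using nn by simp
  next
    case 3
    have m: "\<bar>x\<bar> * ?N \<le> 7 * D" by (rule resonance) (use 3 sum res ABD in auto)
    have "?V * S \<le> 49 * (D powr \<beta> * ?N) * (D powr (- \<beta>) * (A powr (- a) * B powr (- a)))"

      by (rule mult_mono[OF weight_le_even S(4)]) (use \<rho> \<beta> 3 S N m in auto)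
    also have "\<dots> = 49 * even_majorant a y z A B"
      using ABD by (simp add: even_majorant_def powr_minus)
    finally show ?thesis using nn by simp
  qed
  with WS show ?thesis by linarith
qed

text \<open>The quotient of the two sides is \<open>(B / A)^(a - \<beta>) \<le> 1\<close>. The weak
  power -\<beta> of the output may thus be moved to the largest modulation.\<close>

lemma powr_swap:
  fixes A B :: real
  assumes "1 \<le> B" "B \<le> A" "\<beta> \<le> a"
  shows "B powr (- \<beta>) * A powr (- a) \<le> A powr (- \<beta>) * B powr (- a)"
proof -
  have "B powr (- \<beta>) * A powr (- a) = (B powr (a - \<beta>) * B powr (- a)) * A powr (- a)"
    by (simp flip: powr_add)
  also have "\<dots> \<le> (A powr (a - \<beta>) * B powr (- a)) * A powr (- a)"
    using assms by (intro mult_right_mono powr_mono2) auto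
  also have "\<dots> = (A powr (a - \<beta>) * A powr (- a)) * B powr (- a)" by simp
  also have "\<dots> = A powr (- \<beta>) * B powr (- a)" by (simp flip: powr_add)
  finally show ?thesis .
qed

lemma powr_swap3:
  fixes A B D :: real
  assumes "1 \<le> B" "B \<le> A" "\<beta> \<le> a"
  shows "B powr (- \<beta>) * (A powr (- a) * D powr (- a)) \<le> A powr (- \<beta>) * (B powr (- a) * D powr (- a))"
  using mult_right_mono[OF powr_swap[OF assms], of "D powr (- a)"] by (simp add: mult_ac)

lemma kernel_majorant_odd_output:
  fixes x y z :: real
  assumes \<rho>: "0 \<le> \<rho>" "\<rho> \<le> 1" and \<beta>: "0 \<le> \<beta>" "\<beta> \<le> 1" "2 \<le> \<beta> + 2 * \<rho>" "2 * \<rho> - \<beta> \<le> 1" "\<beta> \<le> a"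
    and sum: "x + y + z = 0" and res: "\<bar>x ^ 3 - y ^ 3 - z ^ 3\<bar> \<le> A + B + D"
    and ABD: "A \<ge> 1" "B \<ge> 1" "D \<ge> 1"
  shows "x\<^sup>2 * japanese x powr (- 2 * \<rho>) * (japanese y powr (2 * \<rho>) * japanese z powr (2 * \<rho>))
      * (A powr (- \<beta>) * (B powr (- a) * D powr (- a)))
     \<le> 1568 * (odd_majorant \<rho> \<beta> a x A B D + even_majorant a y z A D + even_majorant a y z A B)"
proof (rule weight_majorant[OF \<rho> \<beta>(1-4) sum res ABD weight_odd_output[OF \<rho>]])
  show "A powr - \<beta> * (B powr - a * D powr - a) \<le> B powr - \<beta> * (A powr - a * D powr - a)" if "A \<le> B"
    using that ABD \<beta> by (intro powr_swap3) auto
  show "A powr - \<beta> * (B powr - a * D powr - a) \<le> D powr - \<beta> * (A powr - a * B powr - a)" if "A \<le> D"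
    using powr_swap3[of A D \<beta> a B] that ABD \<beta> by (simp add: mult_ac)
qed auto

lemma kernel_majorant_even_output:
  fixes x y z :: real
  assumes \<rho>: "1/2 \<le> \<rho>" "\<rho> \<le> 1" and \<beta>: "0 \<le> \<beta>" "\<beta> \<le> 1" "2 \<le> \<beta> + 2 * \<rho>" "2 * \<rho> - \<beta> \<le> 1" "\<beta> \<le> a"
    and sum: "x + y + z = 0" and res: "\<bar>x ^ 3 - y ^ 3 - z ^ 3\<bar> \<le> A + B + D"
    and ABD: "A \<ge> 1" "B \<ge> 1" "D \<ge> 1"
  shows "y\<^sup>2 * japanese y powr (- 2 * \<rho>) * (japanese x powr (2 * \<rho>) * japanese z powr (2 * \<rho>))
      * (B powr (- \<beta>) * (A powr (- a) * D powr (- a)))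
     \<le> 1568 * (odd_majorant \<rho> \<beta> a x A B D + even_majorant a y z A D + even_majorant a y z A B)"
proof (cases "\<bar>x\<bar> \<ge> 1")
  case True
  have \<rho>0: "0 \<le> \<rho>" using \<rho> by simp
  show ?thesis
  proof (rule weight_majorant[OF \<rho>0 \<rho>(2) \<beta>(1-4) sum res ABD weight_even_output_large[OF sum \<rho> True]])
    show "B powr - \<beta> * (A powr - a * D powr - a) \<le> A powr - \<beta> * (B powr - a * D powr - a)" if "B \<le> A"
      using that ABD \<beta> by (intro powr_swap3) auto
    show "B powr - \<beta> * (A powr - a * D powr - a) \<le> D powr - \<beta> * (A powr - a * B powr - a)" if "B \<le> D"
      using powr_swap3[of B D \<beta> a A] that ABD \<beta> by (simp add: mult_ac)
  qed auto
next
  \<comment> \<open>For |x| < 1 the resonance may vanish, so nothing is exchanged: the output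
    bracket is bounded by 1, and the even majorant with the output point fixed already
    suffices.\<close>
  case False
  have "y\<^sup>2 * japanese y powr (- 2 * \<rho>) * (japanese x powr (2 * \<rho>) * japanese z powr (2 * \<rho>))
      * (B powr (- \<beta>) * (A powr (- a) * D powr (- a)))
     \<le> 8 * (1 + y\<^sup>2 + z\<^sup>2) * (1 * (A powr (- a) * D powr (- a)))"
    using False \<rho> ABD \<beta> powr_mono[of "- \<beta>" 0 B]
    by (intro mult_mono weight_even_output_small) auto
  also have "\<dots> = 8 * even_majorant a y z A D" by (simp add: even_majorant_def)
  also have "\<dots> \<le> 1568 * (odd_majorant \<rho> \<beta> a x A B D + even_majorant a y z A D + even_majorant a y z A B)"
    using odd_majorant_nonneg[of \<rho> \<beta> a x A B D] even_majorant_nonneg[of a y z A D]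
      even_majorant_nonneg[of a y z A B] by simp
  finally show ?thesis .
qed

section \<open>Integrals over slices of the resonant set\<close>

lemma lborel_pair_eq: "(lborel :: (real \<times> real) measure) = lborel \<Otimes>\<^sub>M lborel"
  by (rule lborel_prod[symmetric])

lemma nn_integral_lborel_shift:
  fixes f :: "'a::euclidean_space \<Rightarrow> ennreal"
  assumes [measurable]: "f \<in> borel_measurable borel"
  shows "(\<integral>\<^sup>+x. f (x + c) \<partial>lborel) = (\<integral>\<^sup>+x. f x \<partial>lborel)"
proof -
  have "(\<integral>\<^sup>+x. f x \<partial>lborel) = (\<integral>\<^sup>+x. f x \<partial>distr lborel borel ((+) c))"
    by (simp add: lborel_distr_plus)
  also have "\<dots> = (\<integral>\<^sup>+x. f (x + c) \<partial>lborel)"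
    by (subst nn_integral_distr) (simp_all add: add.commute)
  finally show ?thesis by simp
qed

lemma nn_integral_lborel_reflect:
  fixes f :: "'a::euclidean_space \<Rightarrow> ennreal"
  assumes [measurable]: "f \<in> borel_measurable borel"
  shows "(\<integral>\<^sup>+x. f (c - x) \<partial>lborel) = (\<integral>\<^sup>+x. f x \<partial>lborel)"
proof -
  have "(\<integral>\<^sup>+x. f x \<partial>lborel)
      = (\<integral>\<^sup>+x. f x \<partial>density (distr lborel borel (\<lambda>x. c + (- 1) *\<^sub>R x)) (\<lambda>_. ennreal (\<bar>- 1\<bar> ^ DIM('a))))"
    by (subst lborel_affine[of "- 1" c, symmetric]) auto
  also have "\<dots> = (\<integral>\<^sup>+x. f (c - x) \<partial>lborel)"
    by (simp add: nn_integral_density nn_integral_distr)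
  finally show ?thesis by simp
qed

text \<open>Integrating over \<tau> first merges the two modulation brackets into one bracket of
  \<open>p - q\<close>, which depends on the frequency alone.\<close>

lemma nn_integral_modulation_conv:
  fixes g p q :: "real \<Rightarrow> real"
  assumes a: "a > 1" and [measurable]: "g \<in> borel_measurable borel" "p \<in> borel_measurable borel" "q \<in> borel_measurable borel"
    and g: "\<And>x. g x \<ge> 0"
  shows "(\<integral>\<^sup>+(\<xi>, \<tau>). ennreal (g \<xi> * (japanese (\<tau> + p \<xi>) powr (- a) * japanese (\<tau> + q \<xi>) powr (- a))) \<partial>lborel)
    \<le> ennreal (2 powr a * (4 / (a - 1))) * (\<integral>\<^sup>+\<xi>. ennreal (g \<xi> * japanese (p \<xi> - q \<xi>) powr (- a)) \<partial>lborel)"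
proof -
  let ?C = "2 powr a * (4 / (a - 1))"
  have C: "?C \<ge> 0" using a by simp
  have inner: "(\<integral>\<^sup>+\<tau>. ennreal (g \<xi> * (japanese (\<tau> + p \<xi>) powr (- a) * japanese (\<tau> + q \<xi>) powr (- a))) \<partial>lborel)
     \<le> ennreal ?C * ennreal (g \<xi> * japanese (p \<xi> - q \<xi>) powr (- a))" for \<xi>
  proof -
    have "(\<integral>\<^sup>+\<tau>. ennreal (g \<xi> * (japanese (\<tau> + p \<xi>) powr (- a) * japanese (\<tau> + q \<xi>) powr (- a))) \<partial>lborel)
      = ennreal (g \<xi>) * (\<integral>\<^sup>+\<tau>. ennreal (japanese (\<tau> + p \<xi>) powr (- a) * japanese (\<tau> + q \<xi>) powr (- a)) \<partial>lborel)"
      using g by (subst nn_integral_cmult[symmetric]) (auto simp: ennreal_mult)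
    also have "(\<integral>\<^sup>+\<tau>. ennreal (japanese (\<tau> + p \<xi>) powr (- a) * japanese (\<tau> + q \<xi>) powr (- a)) \<partial>lborel)
      = (\<integral>\<^sup>+\<tau>. ennreal (japanese (\<tau> + p \<xi>) powr (- a) * japanese (\<tau> + p \<xi> + (q \<xi> - p \<xi>)) powr (- a)) \<partial>lborel)"
      by simp
    also have "\<dots> = (\<integral>\<^sup>+\<tau>. ennreal (japanese \<tau> powr (- a) * japanese (\<tau> + (q \<xi> - p \<xi>)) powr (- a)) \<partial>lborel)"
      by (rule nn_integral_lborel_shift) measurable
    also have "\<dots> = (\<integral>\<^sup>+\<tau>. ennreal (japanese \<tau> powr (- a) * japanese ((p \<xi> - q \<xi>) - \<tau>) powr (- a)) \<partial>lborel)"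
      using japanese_minus[of "\<tau> + (q \<xi> - p \<xi>)" for \<tau>] by (simp add: algebra_simps)
    also have "\<dots> \<le> ennreal (?C * japanese (p \<xi> - q \<xi>) powr (- a))"
      by (rule nn_integral_japanese_conv[OF a])
    finally have "(\<integral>\<^sup>+\<tau>. ennreal (g \<xi> * (japanese (\<tau> + p \<xi>) powr (- a) * japanese (\<tau> + q \<xi>) powr (- a))) \<partial>lborel)
       \<le> ennreal (g \<xi>) * ennreal (?C * japanese (p \<xi> - q \<xi>) powr (- a))" by (simp add: mult_left_mono)
    also have "\<dots> = ennreal ?C * ennreal (g \<xi> * japanese (p \<xi> - q \<xi>) powr (- a))"
      unfolding ennreal_mult[OF C powr_ge_zero] ennreal_mult[OF g powr_ge_zero] by (simp only: mult_ac)
    finally show ?thesis .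
  qed
  have "(\<integral>\<^sup>+(\<xi>, \<tau>). ennreal (g \<xi> * (japanese (\<tau> + p \<xi>) powr (- a) * japanese (\<tau> + q \<xi>) powr (- a))) \<partial>lborel)
    = (\<integral>\<^sup>+\<xi>. \<integral>\<^sup>+\<tau>. ennreal (g \<xi> * (japanese (\<tau> + p \<xi>) powr (- a) * japanese (\<tau> + q \<xi>) powr (- a))) \<partial>lborel \<partial>lborel)"
    unfolding lborel_pair_eq by (subst lborel.nn_integral_fst[symmetric]) (simp_all add: case_prod_beta)
  also have "\<dots> \<le> (\<integral>\<^sup>+\<xi>. ennreal ?C * ennreal (g \<xi> * japanese (p \<xi> - q \<xi>) powr (- a)) \<partial>lborel)"
    by (intro nn_integral_mono inner)
  also have "\<dots> = ennreal ?C * (\<integral>\<^sup>+\<xi>. ennreal (g \<xi> * japanese (p \<xi> - q \<xi>) powr (- a)) \<partial>lborel)"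
    by (rule nn_integral_cmult) measurable
  finally show ?thesis .
qed

text \<open>The weight is 1 plus the derivative of \<open>\<eta>^3 + (\<eta> - w)^3\<close>, and the
  derivative part is a monotone substitution. Outside [-1, 1] the derivative is at least 1 and
  absorbs the constant; inside, the bracket power is at most 1 and the interval has length
  2.\<close>

lemma nn_integral_cubic:
  fixes a t w :: real
  assumes a: "a > 1"
  shows "(\<integral>\<^sup>+\<eta>. ennreal ((1 + 3 * \<eta>\<^sup>2 + 3 * (\<eta> - w)\<^sup>2) * japanese (t + (\<eta> ^ 3 + (\<eta> - w) ^ 3)) powr (- a)) \<partial>lborel)
    \<le> ennreal (2 * (2 + 2 / (a - 1)))"
proof -
  let ?d = "\<lambda>\<eta>. 3 * \<eta>\<^sup>2 + 3 * (\<eta> - w)\<^sup>2"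
  let ?J = "\<lambda>\<eta>. japanese (t + (\<eta> ^ 3 + (\<eta> - w) ^ 3)) powr (- a)"
  have pt: "(1 + 3 * \<eta>\<^sup>2 + 3 * (\<eta> - w)\<^sup>2) * ?J \<eta> \<le> 2 * (indicator {-1..1} \<eta> + ?d \<eta> * ?J \<eta>)" for \<eta>
  proof -
    have J: "0 \<le> ?J \<eta>" "?J \<eta> \<le> 1"
      using a japanese_ge_1[of "t + (\<eta> ^ 3 + (\<eta> - w) ^ 3)"] powr_mono[of "-a" 0] by force+
    have d: "0 \<le> ?d \<eta>" by simp
    have dJ: "0 \<le> ?d \<eta> * ?J \<eta>" using J d by (intro mult_nonneg_nonneg)
    show ?thesis
    proof (cases "\<bar>\<eta>\<bar> \<le> 1")
      case True
      then have "indicator {-1..1} \<eta> = (1::real)" by (auto simp: indicator_def)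
      moreover have "(1 + 3 * \<eta>\<^sup>2 + 3 * (\<eta> - w)\<^sup>2) * ?J \<eta> = ?J \<eta> + ?d \<eta> * ?J \<eta>" by (simp add: algebra_simps)
      ultimately show ?thesis using J dJ unfolding distrib_left[of 2] by (simp only:)
    next
      case False
      then have "1 \<le> \<eta>\<^sup>2" by (metis abs_ge_zero abs_square_le_1 linorder_linear power2_abs)
      then have "1 \<le> ?d \<eta>" using zero_le_power2[of "\<eta> - w"] by linarith
      then have "(1 + 3 * \<eta>\<^sup>2 + 3 * (\<eta> - w)\<^sup>2) * ?J \<eta> \<le> (2 * ?d \<eta>) * ?J \<eta>"
        using J by (intro mult_right_mono) auto
      moreover have "0 \<le> (indicator {-1..1} \<eta> :: real)" by simp
      moreover have "2 * (indicator {-1..1} \<eta> + ?d \<eta> * ?J \<eta>) = 2 * indicator {-1..1} \<eta> + 2 * ?d \<eta> * ?J \<eta>"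
        by (simp only: distrib_left[of 2 "indicator {-1..1} \<eta>"] mult.assoc)
      ultimately show ?thesis by linarith
    qed
  qed
  have "(\<integral>\<^sup>+\<eta>. ennreal ((1 + 3 * \<eta>\<^sup>2 + 3 * (\<eta> - w)\<^sup>2) * ?J \<eta>) \<partial>lborel)
     \<le> (\<integral>\<^sup>+\<eta>. ennreal 2 * (indicator {-1..1} \<eta> + ennreal (?d \<eta> * ?J \<eta>)) \<partial>lborel)"
  proof (rule nn_integral_mono)
    fix \<eta>
    have "ennreal 2 * (indicator {-1..1} \<eta> + ennreal (?d \<eta> * ?J \<eta>)) = ennreal (2 * (indicator {-1..1} \<eta> + ?d \<eta> * ?J \<eta>))"
      by (simp only: ennreal_mult' ennreal_plus ennreal_indicator mult_nonneg_nonneg add_nonneg_nonneg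
          zero_le_numeral zero_le_power2 powr_ge_zero indicator_pos_le)
    then show "ennreal ((1 + 3 * \<eta>\<^sup>2 + 3 * (\<eta> - w)\<^sup>2) * ?J \<eta>)
      \<le> ennreal 2 * (indicator {-1..1} \<eta> + ennreal (?d \<eta> * ?J \<eta>))"
      using pt[of \<eta>] by (simp only: ennreal_leI)
  qed
  also have "\<dots> = ennreal 2 * (emeasure lborel {-1..1::real} + (\<integral>\<^sup>+\<eta>. ennreal (?d \<eta> * ?J \<eta>) \<partial>lborel))"
    by (subst nn_integral_cmult) (auto simp: nn_integral_add)
  also have "\<dots> \<le> ennreal 2 * (ennreal 2 + ennreal (2 / (a - 1)))"
    by (intro mult_left_mono add_mono nn_integral_japanese_subst a)
      (auto intro!: derivative_eq_intros)
  also have "\<dots> = ennreal (2 * (2 + 2 / (a - 1)))"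
    using a by (simp flip: ennreal_mult ennreal_plus del: ennreal_numeral)
  finally show ?thesis .
qed

text \<open>The decisive power count. The bracket of \<open>t - x^3\<close> is at most that of the
  critical value \<open>t + x^3/4\<close> times \<open>2 <x>^3\<close>. The first factor has
  exponent at most 1/2 and is cancelled by the quadratic integral; the powers of \<open><x>\<close>
  add up to \<open>3/2 + 2\<rho> - 3\<beta> \<le> 0\<close>. By \<open>\<rho> \<le> 3/4\<close> the
  exponent \<open>3/2 - 2\<rho>\<close> left on |x| is nonnegative, so small \<open>x\<close> are
  harmless.\<close>

lemma odd_prefactor_bound:
  fixes x t \<rho> \<beta> :: real
  assumes \<rho>: "\<rho> \<le> 3/4" and \<beta>: "0 \<le> 2 * \<rho> - \<beta>" "2 * \<rho> - \<beta> \<le> 1/2" "3/2 + 2 * \<rho> \<le> 3 * \<beta>"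
    and x: "x \<noteq> 0"
  shows "\<bar>x\<bar> powr (2 - 2 * \<rho>) * japanese x powr (- 2 * \<rho>) * japanese (t - x ^ 3) powr (2 * \<rho> - \<beta>)
     * (\<bar>3 * x\<bar> powr (- (1/2)) * japanese (t + x ^ 3 / 4) powr (- (1/2))) \<le> 2"
proof -
  let ?g = "2 * \<rho> - \<beta>"
  have c3: "japanese (5/4 * x ^ 3) \<le> 2 * japanese x ^ 3"
  proof -
    have "1 + 3 * \<bar>x\<bar> + 3 * \<bar>x\<bar>\<^sup>2 + \<bar>x\<bar> ^ 3 = japanese x ^ 3"
      by (simp add: japanese_def power2_eq_square power3_eq_cube algebra_simps)
    then have "1 + \<bar>x\<bar> ^ 3 \<le> japanese x ^ 3" using zero_le_power2[of "\<bar>x\<bar>"] by linarith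
    moreover have "0 \<le> \<bar>x\<bar> ^ 3" by simp
    moreover have "japanese (5/4 * x ^ 3) = 1 + 5/4 * \<bar>x\<bar> ^ 3" by (simp add: japanese_def abs_mult power_abs)
    ultimately show ?thesis by linarith
  qed
  have "japanese (t - x ^ 3) \<le> japanese (t + x ^ 3 / 4) * japanese (5/4 * x ^ 3)"
    using japanese_add_le[of "t + x ^ 3 / 4" "- (5/4 * x ^ 3)"] by (simp del: mult_minus_left)
  also have "\<dots> \<le> japanese (t + x ^ 3 / 4) * (2 * japanese x ^ 3)"
    using c3 by (intro mult_left_mono less_imp_le[OF japanese_pos])
  finally have "japanese (t - x ^ 3) powr ?g \<le> (japanese (t + x ^ 3 / 4) * (2 * japanese x ^ 3)) powr ?g"
    using \<beta> by (intro powr_mono2) (auto simp: japanese_nonneg)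
  also have "\<dots> = japanese (t + x ^ 3 / 4) powr ?g * (2 powr ?g * japanese x powr (3 * ?g))"
    using powr_powr[of "japanese x" 3 ?g] by (simp add: powr_mult japanese_nonneg)
  also have "\<dots> \<le> japanese (t + x ^ 3 / 4) powr (1/2) * (2 powr 1 * japanese x powr (3 * ?g))"
    using \<beta> japanese_ge_1 by (intro mult_mono powr_mono) auto
  finally have A: "japanese (t - x ^ 3) powr ?g \<le> japanese (t + x ^ 3 / 4) powr (1/2) * (2 * japanese x powr (3 * ?g))"
    by simp
  have B: "\<bar>x\<bar> powr (2 - 2 * \<rho>) * \<bar>3 * x\<bar> powr (- (1/2)) \<le> japanese x powr (3/2 - 2 * \<rho>)"
  proof -
    have "\<bar>3 * x\<bar> powr (- (1/2)) \<le> \<bar>x\<bar> powr (- (1/2))"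
      using x by (intro powr_mono2') auto
    then have "\<bar>x\<bar> powr (2 - 2 * \<rho>) * \<bar>3 * x\<bar> powr (- (1/2)) \<le> \<bar>x\<bar> powr (2 - 2 * \<rho>) * \<bar>x\<bar> powr (- (1/2))"
      by (intro mult_left_mono) auto
    also have "\<dots> = \<bar>x\<bar> powr (3/2 - 2 * \<rho>)" by (simp flip: powr_add)
    also have "\<dots> \<le> japanese x powr (3/2 - 2 * \<rho>)"
      using \<rho> by (intro powr_mono2) (auto simp: japanese_def)
    finally show ?thesis .
  qed
  have "\<bar>x\<bar> powr (2 - 2 * \<rho>) * japanese x powr (- 2 * \<rho>) * japanese (t - x ^ 3) powr ?g
     * (\<bar>3 * x\<bar> powr (- (1/2)) * japanese (t + x ^ 3 / 4) powr (- (1/2)))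
    = (\<bar>x\<bar> powr (2 - 2 * \<rho>) * \<bar>3 * x\<bar> powr (- (1/2))) * japanese x powr (- 2 * \<rho>)
       * (japanese (t - x ^ 3) powr ?g * japanese (t + x ^ 3 / 4) powr (- (1/2)))"
    by (simp add: mult_ac)
  also have "\<dots> \<le> japanese x powr (3/2 - 2 * \<rho>) * japanese x powr (- 2 * \<rho>)
       * ((japanese (t + x ^ 3 / 4) powr (1/2) * (2 * japanese x powr (3 * ?g))) * japanese (t + x ^ 3 / 4) powr (- (1/2)))"
    using A B by (intro mult_mono) auto
  also have "\<dots> = 2 * (japanese x powr (3/2 - 2 * \<rho>) * japanese x powr (- 2 * \<rho>) * japanese x powr (3 * ?g))
       * (japanese (t + x ^ 3 / 4) powr (1/2) * japanese (t + x ^ 3 / 4) powr (- (1/2)))"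
    by (simp add: mult_ac)
  also have "\<dots> = 2 * japanese x powr (3/2 + 2 * \<rho> - 3 * \<beta>)"
    using japanese_pos[of "t + x ^ 3 / 4"] by (simp add: algebra_simps flip: powr_add)
  also have "\<dots> \<le> 2 * japanese x powr 0"
    using \<beta> japanese_ge_1[of x] by (intro mult_left_mono powr_mono) auto
  finally show ?thesis using japanese_pos[of x] by simp
qed

lemma nn_integral_odd:
  fixes x t \<rho> \<beta> a :: real
  assumes a: "a > 1" and \<rho>: "\<rho> \<le> 3/4" and \<beta>: "0 \<le> 2 * \<rho> - \<beta>" "2 * \<rho> - \<beta> \<le> 1/2" "3/2 + 2 * \<rho> \<le> 3 * \<beta>"
  shows "(\<integral>\<^sup>+\<eta>. ennreal (\<bar>x\<bar> powr (2 - 2 * \<rho>) * japanese x powr (- 2 * \<rho>) * japanese (t - x ^ 3) powr (2 * \<rho> - \<beta>)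
      * japanese (t + (x ^ 3 / 4 + 3 * x * (\<eta> - x / 2)\<^sup>2)) powr (- a)) \<partial>lborel)
    \<le> ennreal (2 * (3 powr a * (4 / (a - 1))))"
\<comment> \<open>At \<open>x = 0\<close> the integrand vanishes, since
  \<open>0 powr r = 0\<close>.\<close>
proof (cases "x = 0")
  case False
  let ?P = "\<bar>x\<bar> powr (2 - 2 * \<rho>) * japanese x powr (- 2 * \<rho>) * japanese (t - x ^ 3) powr (2 * \<rho> - \<beta>)"
  let ?c = "t + x ^ 3 / 4"
  have "(\<integral>\<^sup>+\<eta>. ennreal (?P * japanese (t + (x ^ 3 / 4 + 3 * x * (\<eta> - x / 2)\<^sup>2)) powr (- a)) \<partial>lborel)
     = ennreal ?P * (\<integral>\<^sup>+\<eta>. ennreal (japanese (?c + 3 * x * (\<eta> + - (x / 2))\<^sup>2) powr (- a)) \<partial>lborel)"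
    by (subst nn_integral_cmult[symmetric]) (auto simp: ennreal_mult add.assoc)
  also have "(\<integral>\<^sup>+\<eta>. ennreal (japanese (?c + 3 * x * (\<eta> + - (x / 2))\<^sup>2) powr (- a)) \<partial>lborel)
     = (\<integral>\<^sup>+\<eta>. ennreal (japanese (?c + 3 * x * \<eta>\<^sup>2) powr (- a)) \<partial>lborel)"
    by (rule nn_integral_lborel_shift) measurable
  also have "\<dots> \<le> ennreal (3 powr a * (4 / (a - 1)) * \<bar>3 * x\<bar> powr (- (1/2)) * japanese ?c powr (- (1/2)))"
    using False by (intro nn_integral_japanese_quadratic a) auto
  also have "ennreal ?P * \<dots> = ennreal (3 powr a * (4 / (a - 1))) *
      ennreal (?P * (\<bar>3 * x\<bar> powr (- (1/2)) * japanese ?c powr (- (1/2))))"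
    using a by (simp flip: ennreal_mult add: mult_ac)
  also have "\<dots> \<le> ennreal (3 powr a * (4 / (a - 1))) * ennreal 2"
    by (intro mult_left_mono ennreal_leI odd_prefactor_bound \<rho> \<beta> False) auto
  also have "\<dots> = ennreal (2 * (3 powr a * (4 / (a - 1))))"
    using a by (subst ennreal_mult[symmetric]) (auto simp: mult_ac)
  finally show ?thesis by (simp add: mult_left_mono)
qed simp

section \<open>Trilinear forms\<close>

lemma nn_integral_Cauchy_Schwarz:
  fixes f g :: "'a \<Rightarrow> real"
  assumes [measurable]: "f \<in> borel_measurable M" "g \<in> borel_measurable M"
    and f: "\<And>x. f x \<ge> 0" and g: "\<And>x. g x \<ge> 0"
  shows "(\<integral>\<^sup>+x. ennreal (f x * g x) \<partial>M)\<^sup>2 \<le> (\<integral>\<^sup>+x. ennreal ((f x)\<^sup>2) \<partial>M) * (\<integral>\<^sup>+x. ennreal ((g x)\<^sup>2) \<partial>M)"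
    (is "?I\<^sup>2 \<le> ?X * ?Y")
proof -
  \<comment> \<open>In \<open>ennreal\<close> one has \<open>0 * \<infinity> = 0\<close>, so a
    vanishing factor must force the left-hand side to vanish even if the other factor is
    infinite.\<close>
  have zero: "?I = 0" if "?X = 0 \<or> ?Y = 0"
  proof -
    have "AE x in M. f x * g x = 0"
      using that by (auto simp: nn_integral_0_iff_AE elim!: eventually_mono)
    then show ?thesis by (auto simp: nn_integral_0_iff_AE elim!: eventually_mono)
  qed
  consider "?X = 0 \<or> ?Y = 0" | "?X \<noteq> 0" "?Y \<noteq> 0" "?X = \<infinity> \<or> ?Y = \<infinity>"
    | "?X \<noteq> 0" "?Y \<noteq> 0" "?X \<noteq> \<infinity>" "?Y \<noteq> \<infinity>" by blast
  then show ?thesis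
  proof cases
    case 1
    then show ?thesis using zero by simp
  next
    case 2
    then have "?X * ?Y = \<infinity>" by (auto simp: ennreal_mult_eq_top_iff)
    then show ?thesis by simp
  next
    case 3
    obtain X where X: "X \<ge> 0" "?X = ennreal X" using 3 by (cases ?X) auto
    obtain Y where Y: "Y \<ge> 0" "?Y = ennreal Y" using 3 by (cases ?Y) auto
    have X0: "X > 0" and Y0: "Y > 0" using X Y 3 by auto
    \<comment> \<open>With this weight in \<open>2 f g \<le> t f^2 + g^2 / t\<close>, both
      integrated terms equal \<open>sqrt (X * Y)\<close>.\<close>
    define t where "t = sqrt Y / sqrt X"
    have t: "t > 0" using X0 Y0 by (simp add: t_def)
    have "ennreal 2 * ?I = (\<integral>\<^sup>+x. ennreal (2 * (f x * g x)) \<partial>M)"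
      using f g by (subst nn_integral_cmult[symmetric]) (auto simp: ennreal_mult)
    also have "\<dots> \<le> (\<integral>\<^sup>+x. ennreal t * ennreal ((f x)\<^sup>2) + ennreal (1 / t) * ennreal ((g x)\<^sup>2) \<partial>M)"
    proof (rule nn_integral_mono)
      fix x
      have "0 \<le> (sqrt t * f x - g x / sqrt t)\<^sup>2" by simp
      also have "\<dots> = t * (f x)\<^sup>2 + 1 / t * (g x)\<^sup>2 - 2 * (f x * g x)"
        using t by (simp add: power2_diff power_mult_distrib power_divide)
      finally have "2 * (f x * g x) \<le> t * (f x)\<^sup>2 + 1 / t * (g x)\<^sup>2" by simp
      then show "ennreal (2 * (f x * g x)) \<le> ennreal t * ennreal ((f x)\<^sup>2) + ennreal (1 / t) * ennreal ((g x)\<^sup>2)"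
        using t by (simp flip: ennreal_mult ennreal_plus)
    qed
    also have "\<dots> = ennreal t * ?X + ennreal (1 / t) * ?Y"
      by (subst nn_integral_add) (auto simp: nn_integral_cmult)
    also have "\<dots> = ennreal (t * X + Y / t)"
      using t X Y by (simp flip: ennreal_mult ennreal_plus)
    also have "t * X + Y / t = 2 * sqrt (X * Y)"
      using X0 Y0 by (simp add: t_def real_sqrt_mult field_simps)
    finally have I: "ennreal 2 * ?I \<le> ennreal 2 * ennreal (sqrt (X * Y))"
      using X Y by (simp add: ennreal_mult)
    have "?I \<le> ennreal (sqrt (X * Y))"
    proof -
      have "ennreal (1/2) * (ennreal 2 * ?I) \<le> ennreal (1/2) * (ennreal 2 * ennreal (sqrt (X * Y)))"
        using I by (rule mult_left_mono) simp
      moreover have "ennreal (1/2) * ennreal 2 = 1" by (subst ennreal_mult[symmetric]) auto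
      ultimately show ?thesis by (simp only: mult.assoc[symmetric] mult_1)
    qed
    then have "?I\<^sup>2 \<le> (ennreal (sqrt (X * Y)))\<^sup>2" by (rule power_mono) simp
    also have "\<dots> = ?X * ?Y" using X Y by (simp add: ennreal_power flip: ennreal_mult)
    finally show ?thesis .
  qed
qed

definition nn_sq :: "('a::euclidean_space \<Rightarrow> real) \<Rightarrow> ennreal" where
  "nn_sq f = (\<integral>\<^sup>+z. ennreal ((f z)\<^sup>2) \<partial>lborel)"

lemma nn_sq_shift:
  assumes [measurable]: "f \<in> borel_measurable borel"
  shows "(\<integral>\<^sup>+z. ennreal ((f (z - w))\<^sup>2) \<partial>lborel) = nn_sq f"
  unfolding nn_sq_def using nn_integral_lborel_shift[of "\<lambda>z. ennreal ((f z)\<^sup>2)" "- w"] by simp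

lemma nn_sq_reflect:
  assumes [measurable]: "f \<in> borel_measurable borel"
  shows "(\<integral>\<^sup>+w. ennreal ((f (z - w))\<^sup>2) \<partial>lborel) = nn_sq f"
  unfolding nn_sq_def using nn_integral_lborel_reflect[of "\<lambda>z. ennreal ((f z)\<^sup>2)" z] by simp

lemma nn_integral_lborel_swap:
  fixes f :: "'a::euclidean_space \<Rightarrow> 'b::euclidean_space \<Rightarrow> ennreal"
  assumes [measurable]: "(\<lambda>(z, w). f z w) \<in> borel_measurable (borel \<Otimes>\<^sub>M borel)"
  shows "(\<integral>\<^sup>+z. \<integral>\<^sup>+w. f z w \<partial>lborel \<partial>lborel) = (\<integral>\<^sup>+w. \<integral>\<^sup>+z. f z w \<partial>lborel \<partial>lborel)"
  by (rule lborel_pair.Fubini') measurable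

text \<open>A Schur-type bound: Cauchy--Schwarz on the product space pairs \<open>sqrt A * H\<close>
  with \<open>F * G\<close>. The first factor is controlled by the slice integrals of
  \<open>A\<close>, and the second factorises by translation invariance.\<close>

lemma trilinear_output:
  fixes A :: "'a::euclidean_space \<Rightarrow> 'a \<Rightarrow> real" and H F G :: "'a \<Rightarrow> real"
  assumes mA [measurable]: "(\<lambda>(z, w). A z w) \<in> borel_measurable (borel \<Otimes>\<^sub>M borel)"
    and [measurable]: "H \<in> borel_measurable borel" "F \<in> borel_measurable borel" "G \<in> borel_measurable borel"
    and nn: "\<And>z w. A z w \<ge> 0" "\<And>z. H z \<ge> 0" "\<And>z. F z \<ge> 0" "\<And>z. G z \<ge> 0"
    and C: "\<And>z. (\<integral>\<^sup>+w. ennreal (A z w) \<partial>lborel) \<le> C"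
  shows "(\<integral>\<^sup>+z. \<integral>\<^sup>+w. ennreal (sqrt (A z w) * (H z * F w * G (z - w))) \<partial>lborel \<partial>lborel)\<^sup>2
      \<le> C * (nn_sq H * nn_sq F * nn_sq G)"
proof -
  let ?P = "lborel \<Otimes>\<^sub>M lborel :: ('a \<times> 'a) measure"
  have "(\<integral>\<^sup>+z. \<integral>\<^sup>+w. ennreal (sqrt (A z w) * (H z * F w * G (z - w))) \<partial>lborel \<partial>lborel)
    = (\<integral>\<^sup>+p. ennreal ((sqrt (A (fst p) (snd p)) * H (fst p)) * (F (snd p) * G (fst p - snd p))) \<partial>?P)"
    by (subst lborel.nn_integral_fst[symmetric]) (simp_all add: mult_ac)
  also have "\<dots>\<^sup>2 \<le> (\<integral>\<^sup>+p. ennreal ((sqrt (A (fst p) (snd p)) * H (fst p))\<^sup>2) \<partial>?P)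
      * (\<integral>\<^sup>+p. ennreal ((F (snd p) * G (fst p - snd p))\<^sup>2) \<partial>?P)"
    using nn by (intro nn_integral_Cauchy_Schwarz) auto
  also have "(\<integral>\<^sup>+p. ennreal ((sqrt (A (fst p) (snd p)) * H (fst p))\<^sup>2) \<partial>?P)
     = (\<integral>\<^sup>+z. \<integral>\<^sup>+w. ennreal ((H z)\<^sup>2) * ennreal (A z w) \<partial>lborel \<partial>lborel)"
    using nn by (subst lborel.nn_integral_fst[symmetric])
      (simp_all add: power_mult_distrib mult.commute flip: ennreal_mult)
  also have "\<dots> = (\<integral>\<^sup>+z. ennreal ((H z)\<^sup>2) * (\<integral>\<^sup>+w. ennreal (A z w) \<partial>lborel) \<partial>lborel)"
    by (intro nn_integral_cong nn_integral_cmult) measurable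
  also have "\<dots> \<le> (\<integral>\<^sup>+z. ennreal ((H z)\<^sup>2) * C \<partial>lborel)"
    by (intro nn_integral_mono mult_left_mono C) simp
  also have "\<dots> = nn_sq H * C"
    by (simp add: nn_integral_multc nn_sq_def)
  also have "(\<integral>\<^sup>+p. ennreal ((F (snd p) * G (fst p - snd p))\<^sup>2) \<partial>?P)
     = (\<integral>\<^sup>+w. \<integral>\<^sup>+z. ennreal ((F w)\<^sup>2) * ennreal ((G (z - w))\<^sup>2) \<partial>lborel \<partial>lborel)"
    by (subst lborel_pair.nn_integral_snd[symmetric])
      (simp_all add: power_mult_distrib case_prod_beta flip: ennreal_mult)
  also have "\<dots> = (\<integral>\<^sup>+w. ennreal ((F w)\<^sup>2) * nn_sq G \<partial>lborel)"
    by (intro nn_integral_cong) (simp add: nn_integral_cmult nn_sq_shift)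
  also have "\<dots> = nn_sq F * nn_sq G"
    by (simp add: nn_integral_multc nn_sq_def)
  finally show ?thesis by (simp add: mult_ac mult_right_mono)
qed

text \<open>With \<open>w\<close> as outer variable, \<open>H\<close> and \<open>F\<close> exchange
  their roles in \<open>trilinear_output\<close>, and \<open>G\<close> becomes its reflection, which
  has the same norm.\<close>

lemma trilinear_first:
  fixes A :: "'a::euclidean_space \<Rightarrow> 'a \<Rightarrow> real" and H F G :: "'a \<Rightarrow> real"
  assumes mA [measurable]: "(\<lambda>(z, w). A z w) \<in> borel_measurable (borel \<Otimes>\<^sub>M borel)"
    and [measurable]: "H \<in> borel_measurable borel" "F \<in> borel_measurable borel" "G \<in> borel_measurable borel"
    and nn: "\<And>z w. A z w \<ge> 0" "\<And>z. H z \<ge> 0" "\<And>z. F z \<ge> 0" "\<And>z. G z \<ge> 0"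
    and C: "\<And>w. (\<integral>\<^sup>+z. ennreal (A z w) \<partial>lborel) \<le> C"
  shows "(\<integral>\<^sup>+z. \<integral>\<^sup>+w. ennreal (sqrt (A z w) * (H z * F w * G (z - w))) \<partial>lborel \<partial>lborel)\<^sup>2
      \<le> C * (nn_sq H * nn_sq F * nn_sq G)"
proof -
  let ?G = "\<lambda>z. G (- z)"
  have "(\<integral>\<^sup>+z. \<integral>\<^sup>+w. ennreal (sqrt (A z w) * (H z * F w * G (z - w))) \<partial>lborel \<partial>lborel)
    = (\<integral>\<^sup>+w. \<integral>\<^sup>+z. ennreal (sqrt (A z w) * (H z * F w * G (z - w))) \<partial>lborel \<partial>lborel)"
    by (rule nn_integral_lborel_swap) measurable
  also have "\<dots> = (\<integral>\<^sup>+w. \<integral>\<^sup>+z. ennreal (sqrt (A z w) * (F w * H z * ?G (w - z))) \<partial>lborel \<partial>lborel)"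
    by (simp add: mult_ac)
  also have "\<dots>\<^sup>2 \<le> C * (nn_sq F * nn_sq H * nn_sq ?G)"
    using nn C by (intro trilinear_output) measurable
  also have "nn_sq ?G = nn_sq G"
    using nn_sq_reflect[of G 0] by (simp add: nn_sq_def)
  finally show ?thesis by (simp add: mult_ac)
qed

text \<open>Replacing \<open>w\<close> by \<open>z - w\<close> exchanges \<open>F\<close> and
  \<open>G\<close> and reduces the claim to \<open>trilinear_first\<close>.\<close>

lemma trilinear_second:
  fixes A :: "'a::euclidean_space \<Rightarrow> 'a \<Rightarrow> real" and H F G :: "'a \<Rightarrow> real"
  assumes mA [measurable]: "(\<lambda>(z, w). A z w) \<in> borel_measurable (borel \<Otimes>\<^sub>M borel)"
    and [measurable]: "H \<in> borel_measurable borel" "F \<in> borel_measurable borel" "G \<in> borel_measurable borel"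
    and nn: "\<And>z w. A z w \<ge> 0" "\<And>z. H z \<ge> 0" "\<And>z. F z \<ge> 0" "\<And>z. G z \<ge> 0"
    and C: "\<And>w. (\<integral>\<^sup>+z. ennreal (A z (z - w)) \<partial>lborel) \<le> C"
  shows "(\<integral>\<^sup>+z. \<integral>\<^sup>+w. ennreal (sqrt (A z w) * (H z * F w * G (z - w))) \<partial>lborel \<partial>lborel)\<^sup>2
      \<le> C * (nn_sq H * nn_sq F * nn_sq G)"
proof -
  have "(\<integral>\<^sup>+w. ennreal (sqrt (A z w) * (H z * F w * G (z - w))) \<partial>lborel)
    = (\<integral>\<^sup>+w. ennreal (sqrt (A z (z - w)) * (H z * G w * F (z - w))) \<partial>lborel)" for z
    using nn_integral_lborel_reflect[of "\<lambda>w. ennreal (sqrt (A z w) * (H z * F w * G (z - w)))" z]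
    by (simp add: mult_ac)
  then have "(\<integral>\<^sup>+z. \<integral>\<^sup>+w. ennreal (sqrt (A z w) * (H z * F w * G (z - w))) \<partial>lborel \<partial>lborel)\<^sup>2
     = (\<integral>\<^sup>+z. \<integral>\<^sup>+w. ennreal (sqrt (A z (z - w)) * (H z * G w * F (z - w))) \<partial>lborel \<partial>lborel)\<^sup>2"
    by simp
  also have "\<dots> \<le> C * (nn_sq H * nn_sq G * nn_sq F)"
    using nn C by (intro trilinear_first[where A = "\<lambda>z w. A z (z - w)"]) measurable
  finally show ?thesis by (simp add: mult_ac)
qed

text \<open>Each majorant is integrated with a different point held fixed: the output for
  \<open>A0\<close>, the first input for \<open>A1\<close>, the second input for \<open>A2\<close>.
  Three terms with the same bound produce the factor \<open>9 = 3^2\<close>.\<close>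

lemma trilinear_sum:
  fixes A0 A1 A2 :: "'a::euclidean_space \<Rightarrow> 'a \<Rightarrow> real" and H F G :: "'a \<Rightarrow> real"
  assumes [measurable]: "(\<lambda>(z, w). A0 z w) \<in> borel_measurable (borel \<Otimes>\<^sub>M borel)"
      "(\<lambda>(z, w). A1 z w) \<in> borel_measurable (borel \<Otimes>\<^sub>M borel)"
      "(\<lambda>(z, w). A2 z w) \<in> borel_measurable (borel \<Otimes>\<^sub>M borel)"
    and [measurable]: "H \<in> borel_measurable borel" "F \<in> borel_measurable borel" "G \<in> borel_measurable borel"
    and nnA: "\<And>z w. A0 z w \<ge> 0" "\<And>z w. A1 z w \<ge> 0" "\<And>z w. A2 z w \<ge> 0"
    and nn: "\<And>z. H z \<ge> 0" "\<And>z. F z \<ge> 0" "\<And>z. G z \<ge> 0"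
    and C0: "\<And>z. (\<integral>\<^sup>+w. ennreal (A0 z w) \<partial>lborel) \<le> C"
    and C1: "\<And>w. (\<integral>\<^sup>+z. ennreal (A1 z w) \<partial>lborel) \<le> C"
    and C2: "\<And>w. (\<integral>\<^sup>+z. ennreal (A2 z (z - w)) \<partial>lborel) \<le> C"
    and K: "\<And>z w. (K z w)\<^sup>2 \<le> A0 z w + A1 z w + A2 z w" "\<And>z w. K z w \<ge> 0"
  shows "(\<integral>\<^sup>+z. \<integral>\<^sup>+w. ennreal (K z w * (H z * F w * G (z - w))) \<partial>lborel \<partial>lborel)\<^sup>2
      \<le> 9 * C * (nn_sq H * nn_sq F * nn_sq G)"
proof -
  let ?E = "\<lambda>z w. H z * F w * G (z - w)"
  let ?I = "\<lambda>A. \<integral>\<^sup>+z. \<integral>\<^sup>+w. ennreal (sqrt (A z w) * ?E z w) \<partial>lborel \<partial>lborel"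
  let ?B = "C * (nn_sq H * nn_sq F * nn_sq G)"
  have pt: "ennreal (K z w * ?E z w) \<le> ennreal (sqrt (A0 z w) * ?E z w) + ennreal (sqrt (A1 z w) * ?E z w)
      + ennreal (sqrt (A2 z w) * ?E z w)" for z w
  proof -
    have E: "?E z w \<ge> 0" using nn by simp
    have "K z w \<le> sqrt (A0 z w) + sqrt (A1 z w) + sqrt (A2 z w)"
    proof (rule power2_le_imp_le)
      have "(K z w)\<^sup>2 \<le> (sqrt (A0 z w))\<^sup>2 + (sqrt (A1 z w))\<^sup>2 + (sqrt (A2 z w))\<^sup>2"
        using K nnA by simp
      also have "\<dots> \<le> (sqrt (A0 z w) + sqrt (A1 z w) + sqrt (A2 z w))\<^sup>2"
        using nnA by (simp add: power2_sum)
      finally show "(K z w)\<^sup>2 \<le> (sqrt (A0 z w) + sqrt (A1 z w) + sqrt (A2 z w))\<^sup>2" .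
    qed (use nnA in simp)
    then have "K z w * ?E z w \<le> (sqrt (A0 z w) + sqrt (A1 z w) + sqrt (A2 z w)) * ?E z w"
      using E by (rule mult_right_mono)
    also have "\<dots> = sqrt (A0 z w) * ?E z w + sqrt (A1 z w) * ?E z w + sqrt (A2 z w) * ?E z w"
      by (simp add: algebra_simps)
    finally show ?thesis using E nnA
      by (subst ennreal_plus[symmetric], simp, simp)+ (rule ennreal_leI)
  qed
  have "(\<integral>\<^sup>+z. \<integral>\<^sup>+w. ennreal (K z w * ?E z w) \<partial>lborel \<partial>lborel)
     \<le> (\<integral>\<^sup>+z. \<integral>\<^sup>+w. ennreal (sqrt (A0 z w) * ?E z w) + ennreal (sqrt (A1 z w) * ?E z w)
      + ennreal (sqrt (A2 z w) * ?E z w) \<partial>lborel \<partial>lborel)"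
    by (intro nn_integral_mono pt)
  also have "\<dots> = ?I A0 + ?I A1 + ?I A2"
    by (simp add: nn_integral_add)
  finally have le: "(\<integral>\<^sup>+z. \<integral>\<^sup>+w. ennreal (K z w * ?E z w) \<partial>lborel \<partial>lborel) \<le> ?I A0 + ?I A1 + ?I A2" .
  have I: "(?I A0)\<^sup>2 \<le> ?B" "(?I A1)\<^sup>2 \<le> ?B" "(?I A2)\<^sup>2 \<le> ?B"
    subgoal by (rule trilinear_output) (use nnA nn C0 in auto)
    subgoal by (rule trilinear_first) (use nnA nn C1 in auto)
    subgoal by (rule trilinear_second) (use nnA nn C2 in auto)
    done
  define m where "m = max (?I A0) (max (?I A1) (?I A2))"
  have m2: "m\<^sup>2 \<le> ?B" using I unfolding m_def by (metis (no_types, lifting) max_def)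
  have "?I A0 + ?I A1 + ?I A2 \<le> 3 * m"
  proof -
    have "?I A0 + ?I A1 + ?I A2 \<le> m + m + m" unfolding m_def by (intro add_mono) (simp_all add: max.coboundedI2)
    also have "\<dots> = 3 * m" by (metis (no_types, lifting) distrib_right mult_1 numeral_Bit1 numeral_One one_add_one add.assoc)
    finally show ?thesis .
  qed
  then have "(\<integral>\<^sup>+z. \<integral>\<^sup>+w. ennreal (K z w * ?E z w) \<partial>lborel \<partial>lborel)\<^sup>2 \<le> (3 * m)\<^sup>2"
    using le by (intro power_mono) auto
  also have "(3 * m)\<^sup>2 = 9 * m\<^sup>2" by (simp add: power_mult_distrib)
  finally have "(\<integral>\<^sup>+z. \<integral>\<^sup>+w. ennreal (K z w * ?E z w) \<partial>lborel \<partial>lborel)\<^sup>2 \<le> 9 * m\<^sup>2" .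
  moreover have "9 * m\<^sup>2 \<le> 9 * ?B" using m2 by (rule mult_left_mono) simp
  ultimately show ?thesis by (simp only: mult.assoc)
qed

section \<open>The kernel of the bilinear form and its slices\<close>

lemma measurable_fst_real [measurable]: "fst \<in> borel_measurable (borel :: (real \<times> real) measure)"
  by (intro borel_measurable_continuous_onI continuous_intros)

lemma measurable_snd_real [measurable]: "snd \<in> borel_measurable (borel :: (real \<times> real) measure)"
  by (intro borel_measurable_continuous_onI continuous_intros)

lemma japanese_cong: "u = v \<or> u = - v \<Longrightarrow> japanese u = japanese v"
  by auto

lemma japanese_sign: "e = 1 \<or> e = - 1 \<Longrightarrow> japanese (e * v) = japanese v"
  by auto

lemma japanese_powr_sq: "(japanese x powr r)\<^sup>2 = japanese x powr (2 * r)"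
  using powr_powr[of "japanese x" r 2] by (simp add: mult.commute)

text \<open>The exponents stand for \<open>\<beta> = - 2 b'\<close> and \<open>a = 2 b\<close>, and \<open>- \<rho>\<close> replaces the Sobolev exponent \<open>s \<ge> - \<rho>\<close>.\<close>

locale exponents =
  fixes \<rho> \<beta> a :: real
  assumes \<rho>: "1/2 \<le> \<rho>" "\<rho> \<le> 3/4"
    and \<beta>: "0 \<le> \<beta>" "\<beta> \<le> 1" "2 \<le> \<beta> + 2 * \<rho>" "0 \<le> 2 * \<rho> - \<beta>" "2 * \<rho> - \<beta> \<le> 1/2" "3/2 + 2 * \<rho> \<le> 3 * \<beta>"
    and a: "a > 1"
begin

definition slice_const :: real where
  "slice_const = 2 powr a * (4 / (a - 1)) * (2 * (3 powr a * (4 / (a - 1))) + 2 * (2 + 2 / (a - 1)))"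

lemma slice_const_nonneg: "slice_const \<ge> 0"
  using a by (simp add: slice_const_def)

text \<open>The free points have modulations \<open>\<tau> + p \<eta>\<close> and
  \<open>\<tau> + q \<eta>\<close> up to sign. The hypothesis on \<open>p - q\<close> is stated for
  brackets because in the applications the two sides agree only up to the dispersion sign.\<close>

lemma odd_slice:
  assumes [measurable]: "p \<in> borel_measurable borel" "q \<in> borel_measurable borel"
    and pq: "\<And>\<eta>. japanese (p \<eta> - q \<eta>) = japanese (t + (x ^ 3 / 4 + 3 * x * (\<eta> - x / 2)\<^sup>2))"
    and A: "A = japanese (t - x ^ 3)"
  shows "(\<integral>\<^sup>+(\<eta>, \<tau>). ennreal (odd_majorant \<rho> \<beta> a x A (japanese (\<tau> + p \<eta>)) (japanese (\<tau> + q \<eta>))) \<partial>lborel)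
    \<le> ennreal slice_const"
proof -
  have "(\<integral>\<^sup>+(\<eta>, \<tau>). ennreal (odd_majorant \<rho> \<beta> a x A (japanese (\<tau> + p \<eta>)) (japanese (\<tau> + q \<eta>))) \<partial>lborel)
    \<le> ennreal (2 powr a * (4 / (a - 1))) * (\<integral>\<^sup>+\<eta>. ennreal (\<bar>x\<bar> powr (2 - 2 * \<rho>) * japanese x powr (- 2 * \<rho>) * A powr (2 * \<rho> - \<beta>)
      * japanese (p \<eta> - q \<eta>) powr (- a)) \<partial>lborel)"
    unfolding odd_majorant_def by (rule nn_integral_modulation_conv[OF a]) auto
  also have "\<dots> \<le> ennreal (2 powr a * (4 / (a - 1))) * ennreal (2 * (3 powr a * (4 / (a - 1))))"
    unfolding A pq by (intro mult_left_mono nn_integral_odd a \<rho> \<beta>) auto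
  also have "\<dots> = ennreal (2 powr a * (4 / (a - 1)) * (2 * (3 powr a * (4 / (a - 1)))))"
    using a by (subst ennreal_mult[symmetric]) auto
  also have "\<dots> \<le> ennreal slice_const"
    unfolding slice_const_def using a by (intro ennreal_leI mult_left_mono) auto
  finally show ?thesis .
qed

lemma even_slice:
  assumes [measurable]: "p \<in> borel_measurable borel" "q \<in> borel_measurable borel"
      "y \<in> borel_measurable borel" "z \<in> borel_measurable borel"
    and pq: "\<And>\<eta>. japanese (p \<eta> - q \<eta>) = japanese (t + (\<eta> ^ 3 + (\<eta> - w) ^ 3))"
    and N: "\<And>\<eta>. 1 + (y \<eta>)\<^sup>2 + (z \<eta>)\<^sup>2 \<le> 1 + 3 * \<eta>\<^sup>2 + 3 * (\<eta> - w)\<^sup>2"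
  shows "(\<integral>\<^sup>+(\<eta>, \<tau>). ennreal (even_majorant a (y \<eta>) (z \<eta>) (japanese (\<tau> + p \<eta>)) (japanese (\<tau> + q \<eta>))) \<partial>lborel)
    \<le> ennreal slice_const"
proof -
  have "(\<integral>\<^sup>+(\<eta>, \<tau>). ennreal (even_majorant a (y \<eta>) (z \<eta>) (japanese (\<tau> + p \<eta>)) (japanese (\<tau> + q \<eta>))) \<partial>lborel)
    \<le> ennreal (2 powr a * (4 / (a - 1))) * (\<integral>\<^sup>+\<eta>. ennreal ((1 + (y \<eta>)\<^sup>2 + (z \<eta>)\<^sup>2)
      * japanese (p \<eta> - q \<eta>) powr (- a)) \<partial>lborel)"
    unfolding even_majorant_def by (rule nn_integral_modulation_conv[OF a]) auto
  also have "\<dots> \<le> ennreal (2 powr a * (4 / (a - 1))) * (\<integral>\<^sup>+\<eta>. ennreal ((1 + 3 * \<eta>\<^sup>2 + 3 * (\<eta> - w)\<^sup>2)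
      * japanese (t + (\<eta> ^ 3 + (\<eta> - w) ^ 3)) powr (- a)) \<partial>lborel)"
    unfolding pq by (intro mult_left_mono nn_integral_mono ennreal_leI mult_right_mono N) auto
  also have "\<dots> \<le> ennreal (2 powr a * (4 / (a - 1))) * ennreal (2 * (2 + 2 / (a - 1)))"
    by (intro mult_left_mono nn_integral_cubic a) auto
  also have "\<dots> = ennreal (2 powr a * (4 / (a - 1)) * (2 * (2 + 2 / (a - 1))))"
    using a by (subst ennreal_mult[symmetric]) auto
  also have "\<dots> \<le> ennreal slice_const"
    unfolding slice_const_def using a by (intro ennreal_leI mult_left_mono) auto
  finally show ?thesis .
qed

lemma nn_integral_scaled_slice:
  assumes "f \<in> borel_measurable lborel" "(\<integral>\<^sup>+x. ennreal (f x) \<partial>lborel) \<le> ennreal slice_const"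
  shows "(\<integral>\<^sup>+x. ennreal (1568 * f x) \<partial>lborel) \<le> ennreal (1568 * slice_const)"
proof -
  have "(\<integral>\<^sup>+x. ennreal (1568 * f x) \<partial>lborel) = ennreal 1568 * (\<integral>\<^sup>+x. ennreal (f x) \<partial>lborel)"
    using assms(1) by (subst nn_integral_cmult[symmetric]) (auto simp: ennreal_mult')
  also have "\<dots> \<le> ennreal 1568 * ennreal slice_const"
    by (rule mult_left_mono[OF assms(2)]) simp
  finally show ?thesis by (simp add: ennreal_mult')
qed

text \<open>The multiplier at Sobolev exponent -\<rho> after the weights of both inputs have been
  moved into the functions. \<open>e0\<close>, \<open>e1\<close>, \<open>e2\<close> are the
  dispersion coefficients of the output and of the two inputs.\<close>

definition kernel :: "real \<Rightarrow> real \<Rightarrow> real \<Rightarrow> real \<times> real \<Rightarrow> real \<times> real \<Rightarrow> real" where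
  "kernel e0 e1 e2 = (\<lambda>(\<xi>, \<tau>) (\<xi>1, \<tau>1).
     \<bar>\<xi>\<bar> * japanese \<xi> powr (- \<rho>) * (japanese \<xi>1 powr \<rho> * japanese (\<xi> - \<xi>1) powr \<rho>) *
     (japanese (\<tau> + e0 * \<xi> ^ 3) powr (- \<beta> / 2) * (japanese (\<tau>1 + e1 * \<xi>1 ^ 3) powr (- a / 2) *
       japanese (\<tau> - \<tau>1 + e2 * (\<xi> - \<xi>1) ^ 3) powr (- a / 2))))"

lemma kernel_nonneg: "kernel e0 e1 e2 z w \<ge> 0"
  by (simp add: kernel_def case_prod_beta)

lemma kernel_sq:
  "(kernel e0 e1 e2 (\<xi>, \<tau>) (\<xi>1, \<tau>1))\<^sup>2 =
     \<xi>\<^sup>2 * japanese \<xi> powr (- 2 * \<rho>) * (japanese \<xi>1 powr (2 * \<rho>) * japanese (\<xi> - \<xi>1) powr (2 * \<rho>)) *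
     (japanese (\<tau> + e0 * \<xi> ^ 3) powr (- \<beta>) * (japanese (\<tau>1 + e1 * \<xi>1 ^ 3) powr (- a) *
       japanese (\<tau> - \<tau>1 + e2 * (\<xi> - \<xi>1) ^ 3) powr (- a)))"
  by (simp add: kernel_def power_mult_distrib japanese_powr_sq)

text \<open>Here the output has the exceptional dispersion: \<open>x = \<xi>\<close>,
  \<open>y = - \<xi>1\<close>, \<open>z = - (\<xi> - \<xi>1)\<close>. The odd majorant is sliced at
  fixed output, the even ones at a fixed input.\<close>

lemma trilinear_kernel_odd_output:
  fixes H F G :: "real \<times> real \<Rightarrow> real"
  assumes e: "e = 1 \<or> e = - 1"
    and m [measurable]: "H \<in> borel_measurable borel" "F \<in> borel_measurable borel" "G \<in> borel_measurable borel"
    and nn: "\<And>z. H z \<ge> 0" "\<And>z. F z \<ge> 0" "\<And>z. G z \<ge> 0"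
  shows "(\<integral>\<^sup>+z. \<integral>\<^sup>+w. ennreal (kernel e (- e) (- e) z w * (H z * F w * G (z - w))) \<partial>lborel \<partial>lborel)\<^sup>2
      \<le> 9 * ennreal (1568 * slice_const) * (nn_sq H * nn_sq F * nn_sq G)"
proof -
  define A where "A = (\<lambda>z :: real \<times> real. japanese (snd z + e * fst z ^ 3))"
  define B where "B = (\<lambda>w :: real \<times> real. japanese (snd w - e * fst w ^ 3))"
  have [measurable]: "A \<in> borel_measurable borel" "B \<in> borel_measurable borel"
    unfolding A_def B_def by measurable
  show ?thesis
  proof (rule trilinear_sum[where
        ?A0.0 = "\<lambda>z w. 1568 * odd_majorant \<rho> \<beta> a (fst z) (A z) (B w) (B (z - w))" and
        ?A1.0 = "\<lambda>z w. 1568 * even_majorant a (- fst w) (- fst (z - w)) (A z) (B (z - w))" and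
        ?A2.0 = "\<lambda>z w. 1568 * even_majorant a (- fst w) (- fst (z - w)) (A z) (B w)", OF _ _ _ m _ _ _ nn])
    fix z w :: "real \<times> real"
    show "(kernel e (- e) (- e) z w)\<^sup>2 \<le> 1568 * odd_majorant \<rho> \<beta> a (fst z) (A z) (B w) (B (z - w))
        + 1568 * even_majorant a (- fst w) (- fst (z - w)) (A z) (B (z - w))
        + 1568 * even_majorant a (- fst w) (- fst (z - w)) (A z) (B w)"
    proof -
      obtain \<xi> \<tau> \<xi>1 \<tau>1 where zw: "z = (\<xi>, \<tau>)" "w = (\<xi>1, \<tau>1)" by (metis surj_pair)
      \<comment> \<open>In this combination of the modulations the time frequencies cancel, and
        \<open>e\<close> times the resonance remains.\<close>
      have id: "\<bar>\<xi> ^ 3 - (- \<xi>1) ^ 3 - (- (\<xi> - \<xi>1)) ^ 3\<bar> =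
          \<bar>(\<tau> + e * \<xi> ^ 3) - (\<tau>1 - e * \<xi>1 ^ 3) - (\<tau> - \<tau>1 - e * (\<xi> - \<xi>1) ^ 3)\<bar>"
        using e by (auto simp: algebra_simps power3_eq_cube)
      have res: "\<bar>\<xi> ^ 3 - (- \<xi>1) ^ 3 - (- (\<xi> - \<xi>1)) ^ 3\<bar> \<le> A z + B w + B (z - w)"
        unfolding id by (simp add: A_def B_def zw japanese_def)
      have "\<xi>\<^sup>2 * japanese \<xi> powr (- 2 * \<rho>) * (japanese (- \<xi>1) powr (2 * \<rho>) * japanese (- (\<xi> - \<xi>1)) powr (2 * \<rho>))
          * (A z powr (- \<beta>) * (B w powr (- a) * B (z - w) powr (- a)))
        \<le> 1568 * (odd_majorant \<rho> \<beta> a \<xi> (A z) (B w) (B (z - w))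
          + even_majorant a (- \<xi>1) (- (\<xi> - \<xi>1)) (A z) (B (z - w)) + even_majorant a (- \<xi>1) (- (\<xi> - \<xi>1)) (A z) (B w))"
        by (rule kernel_majorant_odd_output)
          (use \<rho> \<beta> a res in \<open>auto simp: A_def B_def japanese_ge_1\<close>)
      then show ?thesis
        unfolding japanese_minus by (simp add: zw kernel_sq A_def B_def)
    qed
    show "(\<integral>\<^sup>+w. ennreal (1568 * odd_majorant \<rho> \<beta> a (fst z) (A z) (B w) (B (z - w))) \<partial>lborel) \<le> ennreal (1568 * slice_const)"
    proof (rule nn_integral_scaled_slice)
      obtain \<xi> \<tau> where z: "z = (\<xi>, \<tau>)" by (metis surj_pair)
      define p where "p = (\<lambda>\<eta>. - e * \<eta> ^ 3)"
      define q where "q = (\<lambda>\<eta>. - \<tau> + e * (\<xi> - \<eta>) ^ 3)"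
      \<comment> \<open>In \<open>\<eta>^3 + (\<xi> - \<eta>)^3\<close> the cubic terms cancel,
        which leaves a quadratic with vertex \<open>\<xi> / 2\<close>.\<close>
      have "p \<eta> - q \<eta> = - e * (- e * \<tau> + (\<xi> ^ 3 / 4 + 3 * \<xi> * (\<eta> - \<xi> / 2)\<^sup>2))" for \<eta>
        using e by (auto simp: p_def q_def field_simps power2_eq_square power3_eq_cube)
      then have pq: "japanese (p \<eta> - q \<eta>) = japanese (- e * \<tau> + (\<xi> ^ 3 / 4 + 3 * \<xi> * (\<eta> - \<xi> / 2)\<^sup>2))" for \<eta>
        using e by (simp only: mult_minus_left japanese_minus japanese_sign)
      have t: "A z = japanese (- e * \<tau> - \<xi> ^ 3)"
        unfolding A_def z by (rule japanese_cong) (use e in auto)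
      have Bp: "B (\<eta>, \<tau>') = japanese (\<tau>' + p \<eta>)" for \<eta> \<tau>' by (simp add: B_def p_def)
      have Bq: "B (z - (\<eta>, \<tau>')) = japanese (\<tau>' + q \<eta>)" for \<eta> \<tau>'
        unfolding B_def z q_def by (rule japanese_cong) auto
      have "(\<integral>\<^sup>+w. ennreal (odd_majorant \<rho> \<beta> a (fst z) (A z) (B w) (B (z - w))) \<partial>lborel)
        = (\<integral>\<^sup>+(\<eta>, \<tau>'). ennreal (odd_majorant \<rho> \<beta> a \<xi> (A z) (japanese (\<tau>' + p \<eta>)) (japanese (\<tau>' + q \<eta>))) \<partial>lborel)"
        by (intro nn_integral_cong) (clarsimp simp only: split_paired_all Bp Bq prod.case, simp add: z)
      also have "\<dots> \<le> ennreal slice_const"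
        using pq t by (rule odd_slice[rotated 2]) (unfold p_def q_def, measurable)
      finally show "(\<integral>\<^sup>+w. ennreal (odd_majorant \<rho> \<beta> a (fst z) (A z) (B w) (B (z - w))) \<partial>lborel) \<le> ennreal slice_const" .
    qed (simp add: odd_majorant_def)
    obtain \<xi>1 \<tau>1 where w: "w = (\<xi>1, \<tau>1)" by (metis surj_pair)
    define p where "p = (\<lambda>\<eta>. e * \<eta> ^ 3)"
    define q where "q = (\<lambda>\<eta>. - \<tau>1 - e * (\<eta> - \<xi>1) ^ 3)"
    \<comment> \<open>With an input fixed, the free points have opposite dispersions, so the
      difference of their phases is a sum of two increasing cubes.\<close>
    have "p \<eta> - q \<eta> = e * (e * \<tau>1 + (\<eta> ^ 3 + (\<eta> - \<xi>1) ^ 3))" for \<eta>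
      using e by (auto simp: p_def q_def algebra_simps)
    then have pq: "japanese (p \<eta> - q \<eta>) = japanese (e * \<tau>1 + (\<eta> ^ 3 + (\<eta> - \<xi>1) ^ 3))" for \<eta>
      using e by (simp only: japanese_sign)
    have N: "1 + (- \<xi>1)\<^sup>2 + (- (\<eta> - \<xi>1))\<^sup>2 \<le> 1 + 3 * \<eta>\<^sup>2 + 3 * (\<eta> - \<xi>1)\<^sup>2" for \<eta>
    proof -
      have "1 + 3 * \<eta>\<^sup>2 + 3 * (\<eta> - \<xi>1)\<^sup>2 - (1 + (- \<xi>1)\<^sup>2 + (- (\<eta> - \<xi>1))\<^sup>2) = (2 * \<eta> - \<xi>1)\<^sup>2 + \<eta>\<^sup>2"
        by (simp add: power2_eq_square algebra_simps)
      then show ?thesis by (metis diff_ge_0_iff_ge sum_power2_ge_zero)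
    qed
    then have N': "1 + (- (\<eta> - \<xi>1))\<^sup>2 + (- \<xi>1)\<^sup>2 \<le> 1 + 3 * \<eta>\<^sup>2 + 3 * (\<eta> - \<xi>1)\<^sup>2" for \<eta>
      by (metis add.commute add.left_commute)
    have Ap: "A (\<eta>, \<tau>) = japanese (\<tau> + p \<eta>)" for \<eta> \<tau> by (simp add: A_def p_def)
    have Bq: "B ((\<eta>, \<tau>) - w) = japanese (\<tau> + q \<eta>)" for \<eta> \<tau>
      unfolding B_def w q_def by (rule japanese_cong) auto
    show "(\<integral>\<^sup>+z. ennreal (1568 * even_majorant a (- fst w) (- fst (z - w)) (A z) (B (z - w))) \<partial>lborel) \<le> ennreal (1568 * slice_const)"
    proof (rule nn_integral_scaled_slice)
      have "(\<integral>\<^sup>+z. ennreal (even_majorant a (- fst w) (- fst (z - w)) (A z) (B (z - w))) \<partial>lborel)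
        = (\<integral>\<^sup>+(\<eta>, \<tau>). ennreal (even_majorant a (- \<xi>1) (- (\<eta> - \<xi>1)) (japanese (\<tau> + p \<eta>)) (japanese (\<tau> + q \<eta>))) \<partial>lborel)"
        by (intro nn_integral_cong) (clarsimp simp only: split_paired_all Ap Bq prod.case, simp add: w)
      also have "\<dots> \<le> ennreal slice_const"
        using pq N by (rule even_slice[rotated 4]) (unfold p_def q_def, measurable)
      finally show "(\<integral>\<^sup>+z. ennreal (even_majorant a (- fst w) (- fst (z - w)) (A z) (B (z - w))) \<partial>lborel) \<le> ennreal slice_const" .
    qed (simp add: even_majorant_def)
    \<comment> \<open>Slicing at fixed second input: \<open>w\<close> now denotes the second input
      and \<open>z - w\<close> the first, so \<open>y\<close> and \<open>z\<close> trade
      places.\<close>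
    show "(\<integral>\<^sup>+z. ennreal (1568 * even_majorant a (- fst (z - w)) (- fst (z - (z - w))) (A z) (B (z - w))) \<partial>lborel) \<le> ennreal (1568 * slice_const)"
    proof (rule nn_integral_scaled_slice)
      have "(\<integral>\<^sup>+z. ennreal (even_majorant a (- fst (z - w)) (- fst (z - (z - w))) (A z) (B (z - w))) \<partial>lborel)
        = (\<integral>\<^sup>+(\<eta>, \<tau>). ennreal (even_majorant a (- (\<eta> - \<xi>1)) (- \<xi>1) (japanese (\<tau> + p \<eta>)) (japanese (\<tau> + q \<eta>))) \<partial>lborel)"
        by (intro nn_integral_cong) (clarsimp simp only: split_paired_all Ap Bq prod.case, simp add: w)
      also have "\<dots> \<le> ennreal slice_const"
        using pq N' by (rule even_slice[rotated 4]) (unfold p_def q_def, measurable)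
      finally show "(\<integral>\<^sup>+z. ennreal (even_majorant a (- fst (z - w)) (- fst (z - (z - w))) (A z) (B (z - w))) \<partial>lborel) \<le> ennreal slice_const" .
    qed (simp add: even_majorant_def)
  qed (simp_all add: odd_majorant_def even_majorant_def kernel_nonneg)
qed

text \<open>Now the second input is exceptional: \<open>x = \<xi> - \<xi>1\<close>,
  \<open>y = - \<xi>\<close>, \<open>z = \<xi>1\<close>. The odd majorant is sliced at fixed second
  input, the even ones at fixed output or fixed first input.\<close>

lemma trilinear_kernel_even_output:
  fixes H F G :: "real \<times> real \<Rightarrow> real"
  assumes e: "e = 1 \<or> e = - 1"
    and m [measurable]: "H \<in> borel_measurable borel" "F \<in> borel_measurable borel" "G \<in> borel_measurable borel"
    and nn: "\<And>z. H z \<ge> 0" "\<And>z. F z \<ge> 0" "\<And>z. G z \<ge> 0"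
  shows "(\<integral>\<^sup>+z. \<integral>\<^sup>+w. ennreal (kernel e e (- e) z w * (H z * F w * G (z - w))) \<partial>lborel \<partial>lborel)\<^sup>2
      \<le> 9 * ennreal (1568 * slice_const) * (nn_sq H * nn_sq F * nn_sq G)"
proof -
  define A where "A = (\<lambda>z :: real \<times> real. japanese (snd z + e * fst z ^ 3))"
  define B where "B = (\<lambda>w :: real \<times> real. japanese (snd w - e * fst w ^ 3))"
  have [measurable]: "A \<in> borel_measurable borel" "B \<in> borel_measurable borel"
    unfolding A_def B_def by measurable
  show ?thesis
  proof (rule trilinear_sum[where
        ?A0.0 = "\<lambda>z w. 1568 * even_majorant a (- fst z) (fst w) (B (z - w)) (A w)" and
        ?A1.0 = "\<lambda>z w. 1568 * even_majorant a (- fst z) (fst w) (B (z - w)) (A z)" and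
        ?A2.0 = "\<lambda>z w. 1568 * odd_majorant \<rho> \<beta> a (fst (z - w)) (B (z - w)) (A z) (A w)", OF _ _ _ m _ _ _ nn])
    fix z w :: "real \<times> real"
    obtain \<xi> \<tau> where z: "z = (\<xi>, \<tau>)" by (metis surj_pair)
    obtain \<xi>1 \<tau>1 where w: "w = (\<xi>1, \<tau>1)" by (metis surj_pair)
    show "(kernel e e (- e) z w)\<^sup>2 \<le> 1568 * even_majorant a (- fst z) (fst w) (B (z - w)) (A w)
        + 1568 * even_majorant a (- fst z) (fst w) (B (z - w)) (A z)
        + 1568 * odd_majorant \<rho> \<beta> a (fst (z - w)) (B (z - w)) (A z) (A w)"
    proof -
      have id: "\<bar>(\<xi> - \<xi>1) ^ 3 - (- \<xi>) ^ 3 - \<xi>1 ^ 3\<bar> =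
          \<bar>(\<tau> + e * \<xi> ^ 3) - (\<tau>1 + e * \<xi>1 ^ 3) - (\<tau> - \<tau>1 - e * (\<xi> - \<xi>1) ^ 3)\<bar>"
        using e by (auto simp: algebra_simps power3_eq_cube)
      have res: "\<bar>(\<xi> - \<xi>1) ^ 3 - (- \<xi>) ^ 3 - \<xi>1 ^ 3\<bar> \<le> B (z - w) + A z + A w"
        unfolding id by (simp add: A_def B_def z w japanese_def)
      have "(- \<xi>)\<^sup>2 * japanese (- \<xi>) powr (- 2 * \<rho>) * (japanese (\<xi> - \<xi>1) powr (2 * \<rho>) * japanese \<xi>1 powr (2 * \<rho>))
          * (A z powr (- \<beta>) * (B (z - w) powr (- a) * A w powr (- a)))
        \<le> 1568 * (odd_majorant \<rho> \<beta> a (\<xi> - \<xi>1) (B (z - w)) (A z) (A w)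
          + even_majorant a (- \<xi>) \<xi>1 (B (z - w)) (A w) + even_majorant a (- \<xi>) \<xi>1 (B (z - w)) (A z))"
        by (rule kernel_majorant_even_output)
          (use \<rho> \<beta> a res in \<open>auto simp: A_def B_def japanese_ge_1\<close>)
      then show ?thesis
        unfolding japanese_minus by (simp add: z w kernel_sq A_def B_def mult_ac add_ac)
    qed
    have Bq: "B (z - (\<eta>, \<tau>')) = japanese (\<tau>' + (- \<tau> + e * (\<xi> - \<eta>) ^ 3))" for \<eta> \<tau>'
      unfolding B_def z by (rule japanese_cong) auto
    have Ap: "A (\<eta>, \<tau>') = japanese (\<tau>' + e * \<eta> ^ 3)" for \<eta> \<tau>' by (simp add: A_def)
    have Bq1: "B ((\<eta>, \<tau>') - w) = japanese (\<tau>' + (- \<tau>1 - e * (\<eta> - \<xi>1) ^ 3))" for \<eta> \<tau>'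
      unfolding B_def w by (rule japanese_cong) auto
    have Aq: "A ((\<eta>, \<tau>') - w) = japanese (\<tau>' + (- \<tau>1 + e * (\<eta> - \<xi>1) ^ 3))" for \<eta> \<tau>'
      unfolding A_def w by (rule japanese_cong) auto
    have N: "1 + (- c)\<^sup>2 + \<eta>\<^sup>2 \<le> 1 + 3 * \<eta>\<^sup>2 + 3 * (\<eta> - c)\<^sup>2" for \<eta> c :: real
      using zero_le_power2[of "2 * \<eta> - c"] zero_le_power2[of \<eta>] zero_le_power2[of "\<eta> - c"]
      by (simp add: power2_eq_square algebra_simps)
    have N1: "1 + (- \<eta>)\<^sup>2 + c\<^sup>2 \<le> 1 + 3 * \<eta>\<^sup>2 + 3 * (\<eta> - c)\<^sup>2" for \<eta> c :: real
      using N[of c \<eta>] by (simp add: add_ac)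
    show "(\<integral>\<^sup>+w. ennreal (1568 * even_majorant a (- fst z) (fst w) (B (z - w)) (A w)) \<partial>lborel) \<le> ennreal (1568 * slice_const)"
    proof (rule nn_integral_scaled_slice)
      have "(- \<tau> + e * (\<xi> - \<eta>) ^ 3) - e * \<eta> ^ 3 = - e * (e * \<tau> + (\<eta> ^ 3 + (\<eta> - \<xi>) ^ 3))" for \<eta>
        using e by (auto simp: algebra_simps power3_eq_cube)
      then have pq: "japanese ((- \<tau> + e * (\<xi> - \<eta>) ^ 3) - e * \<eta> ^ 3) = japanese (e * \<tau> + (\<eta> ^ 3 + (\<eta> - \<xi>) ^ 3))" for \<eta>
        using e by (simp only: mult_minus_left japanese_minus japanese_sign)
      have "(\<integral>\<^sup>+w. ennreal (even_majorant a (- fst z) (fst w) (B (z - w)) (A w)) \<partial>lborel)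
        = (\<integral>\<^sup>+(\<eta>, \<tau>'). ennreal (even_majorant a (- \<xi>) \<eta> (japanese (\<tau>' + (- \<tau> + e * (\<xi> - \<eta>) ^ 3))) (japanese (\<tau>' + e * \<eta> ^ 3))) \<partial>lborel)"
        by (intro nn_integral_cong) (clarsimp simp only: split_paired_all Ap Bq prod.case, simp add: z)
      also have "\<dots> \<le> ennreal slice_const"
        using pq N by (rule even_slice[rotated 4]) measurable
      finally show "(\<integral>\<^sup>+w. ennreal (even_majorant a (- fst z) (fst w) (B (z - w)) (A w)) \<partial>lborel) \<le> ennreal slice_const" .
    qed (simp add: even_majorant_def)
    show "(\<integral>\<^sup>+z. ennreal (1568 * even_majorant a (- fst z) (fst w) (B (z - w)) (A z)) \<partial>lborel) \<le> ennreal (1568 * slice_const)"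
    proof (rule nn_integral_scaled_slice)
      have "(- \<tau>1 - e * (\<eta> - \<xi>1) ^ 3) - e * \<eta> ^ 3 = - e * (e * \<tau>1 + (\<eta> ^ 3 + (\<eta> - \<xi>1) ^ 3))" for \<eta>
        using e by (auto simp: algebra_simps)
      then have pq: "japanese ((- \<tau>1 - e * (\<eta> - \<xi>1) ^ 3) - e * \<eta> ^ 3) = japanese (e * \<tau>1 + (\<eta> ^ 3 + (\<eta> - \<xi>1) ^ 3))" for \<eta>
        using e by (simp only: mult_minus_left japanese_minus japanese_sign)
      have "(\<integral>\<^sup>+z. ennreal (even_majorant a (- fst z) (fst w) (B (z - w)) (A z)) \<partial>lborel)
        = (\<integral>\<^sup>+(\<eta>, \<tau>'). ennreal (even_majorant a (- \<eta>) \<xi>1 (japanese (\<tau>' + (- \<tau>1 - e * (\<eta> - \<xi>1) ^ 3))) (japanese (\<tau>' + e * \<eta> ^ 3))) \<partial>lborel)"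
        by (intro nn_integral_cong) (clarsimp simp only: split_paired_all Ap Bq1 prod.case, simp add: w)
      also have "\<dots> \<le> ennreal slice_const"
        using pq N1 by (rule even_slice[rotated 4]) measurable
      finally show "(\<integral>\<^sup>+z. ennreal (even_majorant a (- fst z) (fst w) (B (z - w)) (A z)) \<partial>lborel) \<le> ennreal slice_const" .
    qed (simp add: even_majorant_def)
    show "(\<integral>\<^sup>+z. ennreal (1568 * odd_majorant \<rho> \<beta> a (fst (z - (z - w))) (B (z - (z - w))) (A z) (A (z - w))) \<partial>lborel) \<le> ennreal (1568 * slice_const)"
    proof (rule nn_integral_scaled_slice)
      \<comment> \<open>Output and first input share their dispersion, so the cubes cancel and the
        quadratic reappears; \<open>\<xi>1\<close> is here the frequency of the fixed second
        input.\<close>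
      have "e * \<eta> ^ 3 - (- \<tau>1 + e * (\<eta> - \<xi>1) ^ 3) = e * (e * \<tau>1 + (\<xi>1 ^ 3 / 4 + 3 * \<xi>1 * (\<eta> - \<xi>1 / 2)\<^sup>2))" for \<eta>
        using e by (auto simp: field_simps power2_eq_square power3_eq_cube)
      then have pq: "japanese (e * \<eta> ^ 3 - (- \<tau>1 + e * (\<eta> - \<xi>1) ^ 3)) = japanese (e * \<tau>1 + (\<xi>1 ^ 3 / 4 + 3 * \<xi>1 * (\<eta> - \<xi>1 / 2)\<^sup>2))" for \<eta>
        using e by (simp only: japanese_sign)
      have t: "B w = japanese (e * \<tau>1 - \<xi>1 ^ 3)"
        unfolding B_def w by (rule japanese_cong) (use e in auto)
      have "(\<integral>\<^sup>+z. ennreal (odd_majorant \<rho> \<beta> a (fst (z - (z - w))) (B (z - (z - w))) (A z) (A (z - w))) \<partial>lborel)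
        = (\<integral>\<^sup>+(\<eta>, \<tau>'). ennreal (odd_majorant \<rho> \<beta> a \<xi>1 (B w) (japanese (\<tau>' + e * \<eta> ^ 3)) (japanese (\<tau>' + (- \<tau>1 + e * (\<eta> - \<xi>1) ^ 3)))) \<partial>lborel)"
        by (intro nn_integral_cong) (clarsimp simp only: split_paired_all Ap Aq prod.case, simp add: w)
      also have "\<dots> \<le> ennreal slice_const"
        using pq t by (rule odd_slice[rotated 2]) measurable
      finally show "(\<integral>\<^sup>+z. ennreal (odd_majorant \<rho> \<beta> a (fst (z - (z - w))) (B (z - (z - w))) (A z) (A (z - w))) \<partial>lborel) \<le> ennreal slice_const" .
    qed (simp add: odd_majorant_def)
  qed (simp_all add: odd_majorant_def even_majorant_def kernel_nonneg)
qed

end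

section \<open>Schwartz functions and their Fourier transforms\<close>

text \<open>Brackets in place of the powers of |x| and |t| make multiplication by a polynomial
  weight a shift of \<open>j\<close> and \<open>k\<close>, as in \<open>rapid_mono\<close>. The
  one-sided bound is meant for nonnegative functions.\<close>

definition rapid :: "(real \<times> real \<Rightarrow> real) \<Rightarrow> bool" where
  "rapid g \<longleftrightarrow> (\<forall>j k. \<exists>C. \<forall>x t. japanese x ^ j * japanese t ^ k * g (x, t) \<le> C)"

lemma japanese_power_le: "japanese x ^ j \<le> 2 ^ j * (1 + \<bar>x\<bar> ^ j)"
proof (cases "\<bar>x\<bar> \<le> 1")
  case True
  then have "japanese x ^ j \<le> 2 ^ j" by (intro power_mono) (auto simp: japanese_def)
  also have "\<dots> \<le> 2 ^ j * (1 + \<bar>x\<bar> ^ j)" by simp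
  finally show ?thesis .
next
  case False
  then have "japanese x ^ j \<le> (2 * \<bar>x\<bar>) ^ j" by (intro power_mono) (auto simp: japanese_def)
  also have "\<dots> \<le> 2 ^ j * (1 + \<bar>x\<bar> ^ j)" by (simp add: power_mult_distrib)
  finally show ?thesis .
qed

lemma rapidI:
  assumes "\<And>z. g z \<ge> 0" and *: "\<And>j k. \<exists>C. \<forall>x t. \<bar>x\<bar> ^ j * \<bar>t\<bar> ^ k * g (x, t) \<le> C"
  shows "rapid g"
  unfolding rapid_def
proof (intro allI)
  fix j k
  obtain C where C: "\<And>j k x t. \<bar>x\<bar> ^ j * \<bar>t\<bar> ^ k * g (x, t) \<le> C j k" using * by metis
  have "japanese x ^ j * japanese t ^ k * g (x, t) \<le> 2 ^ j * 2 ^ k * (C 0 0 + C j 0 + C 0 k + C j k)" for x t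
  proof -
    have "japanese x ^ j * japanese t ^ k * g (x, t)
      \<le> (2 ^ j * (1 + \<bar>x\<bar> ^ j)) * (2 ^ k * (1 + \<bar>t\<bar> ^ k)) * g (x, t)"
      using assms(1) by (intro mult_right_mono mult_mono japanese_power_le) (auto simp: japanese_nonneg)
    also have "\<dots> = 2 ^ j * 2 ^ k * (\<bar>x\<bar> ^ 0 * \<bar>t\<bar> ^ 0 * g (x, t) + \<bar>x\<bar> ^ j * \<bar>t\<bar> ^ 0 * g (x, t)
       + \<bar>x\<bar> ^ 0 * \<bar>t\<bar> ^ k * g (x, t) + \<bar>x\<bar> ^ j * \<bar>t\<bar> ^ k * g (x, t))"
      by (simp add: algebra_simps)
    also have "\<dots> \<le> 2 ^ j * 2 ^ k * (C 0 0 + C j 0 + C 0 k + C j k)"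
      by (intro mult_left_mono add_mono C) auto
    finally show ?thesis .
  qed
  then show "\<exists>C. \<forall>x t. japanese x ^ j * japanese t ^ k * g (x, t) \<le> C" by blast
qed

lemma rapid_mono:
  assumes "rapid g" "\<And>x t. f (x, t) \<le> c * (japanese x ^ m * japanese t ^ n) * g (x, t)" "c \<ge> 0"
  shows "rapid f"
  unfolding rapid_def
proof (intro allI)
  fix j k
  obtain C where C: "\<And>x t. japanese x ^ (j + m) * japanese t ^ (k + n) * g (x, t) \<le> C"
    using assms(1) unfolding rapid_def by blast
  have "japanese x ^ j * japanese t ^ k * f (x, t) \<le> c * C" for x t
  proof -
    have "japanese x ^ j * japanese t ^ k * f (x, t)
      \<le> japanese x ^ j * japanese t ^ k * (c * (japanese x ^ m * japanese t ^ n) * g (x, t))"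
      by (intro mult_left_mono assms(2) mult_nonneg_nonneg) (auto simp: japanese_nonneg)
    also have "\<dots> = c * (japanese x ^ (j + m) * japanese t ^ (k + n) * g (x, t))"
      by (simp add: power_add mult_ac)
    also have "\<dots> \<le> c * C" by (intro mult_left_mono C assms)
    finally show ?thesis .
  qed
  then show "\<exists>C. \<forall>x t. japanese x ^ j * japanese t ^ k * f (x, t) \<le> C" by blast
qed

lemma rapid_mult:
  assumes "rapid f" "rapid g" "\<And>z. f z \<ge> 0" "\<And>z. g z \<ge> 0"
  shows "rapid (\<lambda>z. f z * g z)"
  unfolding rapid_def
proof (intro allI)
  fix j k
  obtain C where C: "\<And>x t. japanese x ^ j * japanese t ^ k * f (x, t) \<le> C"
    using assms(1) unfolding rapid_def by blast
  obtain D where D: "\<And>x t. g (x, t) \<le> D"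
    using assms(2) unfolding rapid_def by (metis mult_1 power_0)
  have "japanese x ^ j * japanese t ^ k * (f (x, t) * g (x, t)) \<le> C * D" for x t
  proof -
    have nn: "0 \<le> japanese x ^ j * japanese t ^ k * f (x, t)"
      using assms(3) by (intro mult_nonneg_nonneg) (auto simp: japanese_nonneg)
    have "(japanese x ^ j * japanese t ^ k * f (x, t)) * g (x, t) \<le> C * D"
      using C[of x t] D[of x t] nn assms(4)[of "(x, t)"] by (intro mult_mono) auto
    then show ?thesis by (simp add: mult.assoc)
  qed
  then show "\<exists>C. \<forall>x t. japanese x ^ j * japanese t ^ k * (f (x, t) * g (x, t)) \<le> C" by blast
qed

lemma rapid_bounded:
  assumes "rapid g" obtains C where "\<And>z. g z \<le> C"
  using assms unfolding rapid_def by (metis mult_1 power_0 surj_pair)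

lemma nn_integral_japanese_weight: "(\<integral>\<^sup>+(x, t). ennreal (japanese x powr (- 2) * japanese t powr (- 2)) \<partial>lborel) < \<infinity>"
proof -
  have "(\<integral>\<^sup>+(x, t). ennreal (japanese x powr (- 2) * japanese t powr (- 2)) \<partial>lborel)
    = (\<integral>\<^sup>+x. \<integral>\<^sup>+t. ennreal (japanese x powr (- 2)) * ennreal (japanese t powr (- 2)) \<partial>lborel \<partial>lborel)"
    unfolding lborel_pair_eq by (subst lborel.nn_integral_fst[symmetric]) (simp_all add: case_prod_beta ennreal_mult)
  also have "\<dots> = (\<integral>\<^sup>+x. ennreal (japanese x powr (- 2)) \<partial>lborel) * (\<integral>\<^sup>+t. ennreal (japanese t powr (- 2)) \<partial>lborel)"
    by (simp add: nn_integral_cmult nn_integral_multc)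
  also have "\<dots> \<le> ennreal 2 * ennreal 2"
    using nn_integral_japanese[of 2] by (intro mult_mono) auto
  also have "\<dots> < \<infinity>" by (simp flip: ennreal_mult)
  finally show ?thesis .
qed

lemma rapid_integrable:
  fixes f :: "real \<times> real \<Rightarrow> 'b::{banach, second_countable_topology}"
  assumes [measurable]: "f \<in> borel_measurable borel" and r: "rapid (\<lambda>z. norm (f z))"
  shows "integrable lborel f"
proof (rule integrableI_bounded)
  obtain C where C: "\<And>x t. japanese x ^ 2 * japanese t ^ 2 * norm (f (x, t)) \<le> C"
    using r unfolding rapid_def by blast
  have C0: "C \<ge> 0" by (rule order_trans[OF _ C[of 0 0]]) (simp add: japanese_nonneg)
  have "norm (f (x, t)) \<le> C * (japanese x powr (- 2) * japanese t powr (- 2))" for x t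
    using C[of x t] japanese_pos[of x] japanese_pos[of t]
    by (simp add: powr_minus japanese_nonneg divide_simps) (simp add: mult_ac)
  then have "(\<integral>\<^sup>+z. ennreal (norm (f z)) \<partial>lborel)
      \<le> (\<integral>\<^sup>+z. ennreal C * (case z of (x, t) \<Rightarrow> ennreal (japanese x powr (- 2) * japanese t powr (- 2))) \<partial>lborel)"
    using C0 by (intro nn_integral_mono) (auto simp: split_paired_all simp flip: ennreal_mult intro!: ennreal_leI)
  also have "\<dots> = ennreal C * (\<integral>\<^sup>+(x, t). ennreal (japanese x powr (- 2) * japanese t powr (- 2)) \<partial>lborel)"
    by (rule nn_integral_cmult) (simp add: case_prod_beta)
  also have "\<dots> < \<infinity>" using nn_integral_japanese_weight by (simp add: ennreal_mult_less_top)
  finally show "(\<integral>\<^sup>+z. ennreal (norm (f z)) \<partial>lborel) < \<infinity>" .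
qed simp

text \<open>Carrying the whole family of mixed derivatives turns differentiation into a shift of
  indices and the product rule into an explicit Leibniz family.\<close>

definition derivs :: "(nat \<Rightarrow> nat \<Rightarrow> real \<times> real \<Rightarrow> complex) \<Rightarrow> bool" where
  "derivs D \<longleftrightarrow>
     (\<forall>m n z. (D m n has_derivative (\<lambda>h. fst h *\<^sub>R D (Suc m) n z + snd h *\<^sub>R D m (Suc n) z)) (at z)) \<and>
     (\<forall>m n. rapid (\<lambda>z. cmod (D m n z)))"

lemma schwartz_iff: "schwartz F \<longleftrightarrow> (\<exists>D. D 0 0 = F \<and> derivs D)"
proof -
  have "(\<forall>j k. \<exists>C. \<forall>x t. \<bar>x\<bar> ^ j * \<bar>t\<bar> ^ k * cmod (G (x, t)) \<le> C) \<longleftrightarrow> rapid (\<lambda>z. cmod (G z))" for G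
  proof
    assume r: "rapid (\<lambda>z. cmod (G z))"
    show "\<forall>j k. \<exists>C. \<forall>x t. \<bar>x\<bar> ^ j * \<bar>t\<bar> ^ k * cmod (G (x, t)) \<le> C"
    proof (intro allI)
      fix j k
      obtain C where C: "\<And>x t. japanese x ^ j * japanese t ^ k * cmod (G (x, t)) \<le> C"
        using r unfolding rapid_def by blast
      have "\<bar>x\<bar> ^ j * \<bar>t\<bar> ^ k * cmod (G (x, t)) \<le> C" for x t
        by (rule order_trans[OF mult_right_mono C]; (intro mult_mono power_mono)?) (simp_all add: japanese_def)
      then show "\<exists>C. \<forall>x t. \<bar>x\<bar> ^ j * \<bar>t\<bar> ^ k * cmod (G (x, t)) \<le> C" by blast
    qed
  qed (rule rapidI, simp, elim allE)
  then show ?thesis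
    unfolding schwartz_def derivs_def by (simp only:)
qed

lemma derivs_has_derivative:
  "derivs D \<Longrightarrow> (D m n has_derivative (\<lambda>h. fst h *\<^sub>R D (Suc m) n z + snd h *\<^sub>R D m (Suc n) z)) (at z)"
  by (simp add: derivs_def del: split_paired_All)

lemma derivs_rapid: "derivs D \<Longrightarrow> rapid (\<lambda>z. cmod (D m n z))"
  by (simp add: derivs_def del: split_paired_All)

lemma derivs_continuous: "derivs D \<Longrightarrow> continuous_on UNIV (D m n)"
  by (intro continuous_at_imp_continuous_on ballI has_derivative_continuous[OF derivs_has_derivative])

lemma derivs_measurable: "derivs D \<Longrightarrow> D m n \<in> borel_measurable borel"
  by (intro borel_measurable_continuous_onI derivs_continuous)

lemma derivs_integrable: "derivs D \<Longrightarrow> integrable lborel (D m n)"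
  by (intro rapid_integrable derivs_measurable derivs_rapid)

lemma derivs_schwartz: "derivs D \<Longrightarrow> schwartz (D m n)"
  unfolding schwartz_iff
  by (rule exI[of _ "\<lambda>i j. D (m + i) (n + j)"]) (simp add: derivs_def del: split_paired_All)

lemma schwartz_rapid: "schwartz F \<Longrightarrow> rapid (\<lambda>z. cmod (F z))"
  unfolding schwartz_iff by (elim exE conjE) (use derivs_rapid in fast)

lemma schwartz_continuous: "schwartz F \<Longrightarrow> continuous_on UNIV F"
  unfolding schwartz_iff by (elim exE conjE) (use derivs_continuous in fast)

lemma schwartz_measurable: "schwartz F \<Longrightarrow> F \<in> borel_measurable borel"
  by (intro borel_measurable_continuous_onI schwartz_continuous)

lemma schwartz_integrable: "schwartz F \<Longrightarrow> integrable lborel F"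
  by (intro rapid_integrable schwartz_measurable schwartz_rapid)

section \<open>Differences, products and derivatives of Schwartz functions\<close>

lemma rapid_add:
  assumes "rapid f" "rapid g"
  shows "rapid (\<lambda>z. f z + g z)"
  unfolding rapid_def
proof (intro allI)
  fix j k
  obtain C where C: "\<And>x t. japanese x ^ j * japanese t ^ k * f (x, t) \<le> C"
    using assms(1) unfolding rapid_def by blast
  obtain D where D: "\<And>x t. japanese x ^ j * japanese t ^ k * g (x, t) \<le> D"
    using assms(2) unfolding rapid_def by blast
  have "japanese x ^ j * japanese t ^ k * (f (x, t) + g (x, t)) \<le> C + D" for x t
    using C[of x t] D[of x t] by (simp add: distrib_left)
  then show "\<exists>C. \<forall>x t. japanese x ^ j * japanese t ^ k * (f (x, t) + g (x, t)) \<le> C" by blast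
qed

lemma rapid_le:
  assumes "rapid g" "\<And>z. f z \<le> g z"
  shows "rapid f"
  using assms by (intro rapid_mono[OF assms(1), of f 1 0 0]) auto

lemma rapid_zero: "rapid (\<lambda>z. 0)"
  unfolding rapid_def by auto

lemma rapid_cmult:
  assumes "rapid g" "c \<ge> 0"
  shows "rapid (\<lambda>z. c * g z)"
  using assms by (intro rapid_mono[OF assms(1), of _ c 0 0]) auto

lemma rapid_sum: "(\<And>i. i \<in> I \<Longrightarrow> rapid (f i)) \<Longrightarrow> rapid (\<lambda>z. \<Sum>i\<in>I. f i z)"
  by (induction I rule: infinite_finite_induct) (auto intro: rapid_add rapid_zero)

lemma schwartz_diff:
  assumes "schwartz f" "schwartz g"
  shows "schwartz (\<lambda>z. f z - g z)"
proof -
  obtain D where D: "D 0 0 = f" "derivs D" using assms(1) schwartz_iff by blast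
  obtain E where E: "E 0 0 = g" "derivs E" using assms(2) schwartz_iff by blast
  have "derivs (\<lambda>m n z. D m n z - E m n z)"
    unfolding derivs_def
  proof (intro conjI allI)
    fix m n z
    have "(D m n has_derivative (\<lambda>h. fst h *\<^sub>R D (Suc m) n z + snd h *\<^sub>R D m (Suc n) z)) (at z)"
      "(E m n has_derivative (\<lambda>h. fst h *\<^sub>R E (Suc m) n z + snd h *\<^sub>R E m (Suc n) z)) (at z)"
      by (intro derivs_has_derivative D E)+
    from has_derivative_diff[OF this]
    show "((\<lambda>z. D m n z - E m n z) has_derivative (\<lambda>h. fst h *\<^sub>R (D (Suc m) n z - E (Suc m) n z)
       + snd h *\<^sub>R (D m (Suc n) z - E m (Suc n) z))) (at z)"
      by (rule has_derivative_eq_rhs) (auto simp: algebra_simps)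
    have "rapid (\<lambda>z. cmod (D m n z))" "rapid (\<lambda>z. cmod (E m n z))" by (intro derivs_rapid D E)+
    from rapid_add[OF this] show "rapid (\<lambda>z. cmod (D m n z - E m n z))"
      by (rule rapid_le) (rule norm_triangle_ineq4)
  qed
  then show ?thesis unfolding schwartz_iff using D(1) E(1)
    by (intro exI[of _ "\<lambda>m n z. D m n z - E m n z"] conjI) auto
qed

text \<open>Pascal's rule. \<open>A i k\<close> stands for the product of the derivatives of orders
  \<open>i\<close> and \<open>k\<close> of the two factors, so that one identity serves both
  variables in \<open>schwartz_mult\<close>.\<close>

lemma binomial_Leibniz_step:
  fixes A :: "nat \<Rightarrow> nat \<Rightarrow> 'a::real_vector"
  shows "(\<Sum>i\<le>Suc m. of_nat (Suc m choose i) *\<^sub>R A i (Suc m - i))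
    = (\<Sum>i\<le>m. of_nat (m choose i) *\<^sub>R (A (Suc i) (m - i) + A i (Suc (m - i))))"
proof -
  have "(\<Sum>i\<le>Suc m. of_nat (Suc m choose i) *\<^sub>R A i (Suc m - i))
    = A 0 (Suc m) + (\<Sum>i\<le>m. of_nat (Suc m choose Suc i) *\<^sub>R A (Suc i) (m - i))"
    by (subst sum.atMost_Suc_shift) simp
  also have "(\<Sum>i\<le>m. of_nat (Suc m choose Suc i) *\<^sub>R A (Suc i) (m - i))
    = (\<Sum>i\<le>m. of_nat (m choose i) *\<^sub>R A (Suc i) (m - i)) + (\<Sum>i\<le>m. of_nat (m choose Suc i) *\<^sub>R A (Suc i) (m - i))"
    by (simp add: scaleR_left_distrib sum.distrib)
  also have "A 0 (Suc m) + (\<dots>) = (\<Sum>i\<le>m. of_nat (m choose i) *\<^sub>R A (Suc i) (m - i)) +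
     (A 0 (Suc m) + (\<Sum>i\<le>m. of_nat (m choose Suc i) *\<^sub>R A (Suc i) (m - i)))"
    by simp
  also have "A 0 (Suc m) + (\<Sum>i\<le>m. of_nat (m choose Suc i) *\<^sub>R A (Suc i) (m - i))
    = (\<Sum>i\<le>Suc m. of_nat (m choose i) *\<^sub>R A i (Suc m - i))"
    by (subst sum.atMost_Suc_shift) simp
  also have "\<dots> = (\<Sum>i\<le>m. of_nat (m choose i) *\<^sub>R A i (Suc (m - i)))"
    by (simp add: Suc_diff_le binomial_eq_0)
  finally show ?thesis by (simp add: scaleR_right_distrib sum.distrib)
qed

text \<open>\<open>p\<close> and \<open>q\<close> are the components of the direction of
  differentiation. In the \<open>p\<close> part the inner sums come separately, since there the
  product rule acts on the outer index; in the \<open>q\<close> part it acts inside the inner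
  sum.\<close>

lemma Leibniz_regroup:
  fixes U V W :: "'i \<Rightarrow> 'j \<Rightarrow> 'a::real_vector"
  shows "(\<Sum>i\<in>I. c i *\<^sub>R (\<Sum>j\<in>J. d j *\<^sub>R (p *\<^sub>R U i j + p *\<^sub>R V i j + q *\<^sub>R W i j)))
    = p *\<^sub>R (\<Sum>i\<in>I. c i *\<^sub>R ((\<Sum>j\<in>J. d j *\<^sub>R U i j) + (\<Sum>j\<in>J. d j *\<^sub>R V i j)))
      + q *\<^sub>R (\<Sum>i\<in>I. c i *\<^sub>R (\<Sum>j\<in>J. d j *\<^sub>R W i j))"
  by (simp add: scaleR_right_distrib sum.distrib scaleR_sum_right mult_ac)

lemma schwartz_mult:
  assumes "schwartz f" "schwartz g"
  shows "schwartz (\<lambda>z. f z * g z)"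
proof -
  obtain D where D: "D 0 0 = f" "derivs D" using assms(1) schwartz_iff by blast
  obtain E where E: "E 0 0 = g" "derivs E" using assms(2) schwartz_iff by blast
  define P where "P = (\<lambda>m n z. \<Sum>i\<le>m. of_nat (m choose i) *\<^sub>R (\<Sum>j\<le>n. of_nat (n choose j) *\<^sub>R (D i j z * E (m - i) (n - j) z)))"
  have Dd: "(D m n has_derivative (\<lambda>h. fst h *\<^sub>R D (Suc m) n z + snd h *\<^sub>R D m (Suc n) z)) (at z)"
    and Ed: "(E m n has_derivative (\<lambda>h. fst h *\<^sub>R E (Suc m) n z + snd h *\<^sub>R E m (Suc n) z)) (at z)" for m n z
    by (intro derivs_has_derivative D E)+
  have rD: "rapid (\<lambda>z. cmod (D m n z))" and rE: "rapid (\<lambda>z. cmod (E m n z))" for m n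
    by (intro derivs_rapid D E)+
  have "derivs P"
    unfolding derivs_def
  proof (intro conjI allI)
    fix m n z
    have Pm: "P (Suc m) n z = (\<Sum>i\<le>m. of_nat (m choose i) *\<^sub>R ((\<Sum>j\<le>n. of_nat (n choose j) *\<^sub>R (D (Suc i) j z * E (m - i) (n - j) z))
       + (\<Sum>j\<le>n. of_nat (n choose j) *\<^sub>R (D i j z * E (Suc (m - i)) (n - j) z))))"
      unfolding P_def
      by (rule binomial_Leibniz_step[of m "\<lambda>i k. \<Sum>j\<le>n. of_nat (n choose j) *\<^sub>R (D i j z * E k (n - j) z)"])
    have Pn: "P m (Suc n) z = (\<Sum>i\<le>m. of_nat (m choose i) *\<^sub>R (\<Sum>j\<le>n. of_nat (n choose j) *\<^sub>R
        (D i (Suc j) z * E (m - i) (n - j) z + D i j z * E (m - i) (Suc (n - j)) z)))"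
      unfolding P_def
      by (intro sum.cong refl arg_cong2[where f = scaleR] binomial_Leibniz_step[of n "\<lambda>j k. D i j z * E (m - i) k z" for i])
    have "(P m n has_derivative (\<lambda>h. \<Sum>i\<le>m. of_nat (m choose i) *\<^sub>R (\<Sum>j\<le>n. of_nat (n choose j) *\<^sub>R
       (D i j z * (fst h *\<^sub>R E (Suc (m - i)) (n - j) z + snd h *\<^sub>R E (m - i) (Suc (n - j)) z)
       + (fst h *\<^sub>R D (Suc i) j z + snd h *\<^sub>R D i (Suc j) z) * E (m - i) (n - j) z)))) (at z)"
      unfolding P_def
      by (intro has_derivative_sum has_derivative_scaleR_right has_derivative_mult Dd Ed)
    then show "(P m n has_derivative (\<lambda>h. fst h *\<^sub>R P (Suc m) n z + snd h *\<^sub>R P m (Suc n) z)) (at z)"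
    proof (rule has_derivative_eq_rhs, intro ext)
      fix h
      show "(\<Sum>i\<le>m. of_nat (m choose i) *\<^sub>R (\<Sum>j\<le>n. of_nat (n choose j) *\<^sub>R
       (D i j z * (fst h *\<^sub>R E (Suc (m - i)) (n - j) z + snd h *\<^sub>R E (m - i) (Suc (n - j)) z)
       + (fst h *\<^sub>R D (Suc i) j z + snd h *\<^sub>R D i (Suc j) z) * E (m - i) (n - j) z)))
       = fst h *\<^sub>R P (Suc m) n z + snd h *\<^sub>R P m (Suc n) z"
        unfolding Pm Pn Leibniz_regroup[symmetric]
        by (intro sum.cong refl arg_cong2[where f = scaleR]) (simp add: algebra_simps)
    qed
    have "rapid (\<lambda>z. \<Sum>i\<le>m. of_nat (m choose i) * (\<Sum>j\<le>n. of_nat (n choose j) * (cmod (D i j z) * cmod (E (m - i) (n - j) z))))"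
      by (intro rapid_sum rapid_cmult rapid_mult rD rE norm_ge_zero of_nat_0_le_iff)
    then show "rapid (\<lambda>z. cmod (P m n z))"
    proof (rule rapid_le)
      fix z
      show "cmod (P m n z) \<le> (\<Sum>i\<le>m. of_nat (m choose i) * (\<Sum>j\<le>n. of_nat (n choose j) * (cmod (D i j z) * cmod (E (m - i) (n - j) z))))"
        unfolding P_def
        by (rule sum_norm_le, simp, intro mult_left_mono sum_norm_le) (auto simp: norm_mult)
    qed
  qed
  moreover have "P 0 0 = (\<lambda>z. f z * g z)" by (simp add: P_def D(1) E(1))
  ultimately show ?thesis unfolding schwartz_iff by (intro exI[of _ P] conjI)
qed

lemma schwartz_dx_derivs:
  assumes "schwartz F"
  obtains D where "derivs D" "D 0 0 = F" "dx F = D 1 0"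
proof -
  obtain D where D: "D 0 0 = F" "derivs D" using assms unfolding schwartz_iff by blast
  have "dx F = D 1 0"
  proof (intro ext, clarify)
    fix x t :: real
    have d: "(D 0 0 has_derivative (\<lambda>h. fst h *\<^sub>R D 1 0 (x, t) + snd h *\<^sub>R D 0 1 (x, t))) (at (x, t))"
      using derivs_has_derivative[OF D(2), of 0 0] by simp
    have "((\<lambda>y. (y, t)) has_derivative (\<lambda>h. (h, 0))) (at x)"
      by (intro has_derivative_Pair has_derivative_ident has_derivative_const)
    from has_derivative_compose[OF this d]
    have "((\<lambda>y. D 0 0 (y, t)) has_derivative (\<lambda>h. h *\<^sub>R D 1 0 (x, t))) (at x)"
      by simp
    then have "((\<lambda>y. F (y, t)) has_vector_derivative D 1 0 (x, t)) (at x)"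
      by (simp add: has_vector_derivative_def D(1))
    then show "dx F (x, t) = D 1 0 (x, t)"
      by (simp add: dx_def vector_derivative_at)
  qed
  then show ?thesis using that D by blast
qed

section \<open>Translations, dilations and the Fourier transform of derivatives\<close>

lemma lborel_distr_shift: "distr lborel borel (\<lambda>x. x + c) = (lborel :: 'a::euclidean_space measure)"
proof -
  have "(\<lambda>x. x + c) = (+) c" by (auto simp: add.commute)
  then show ?thesis by (simp add: lborel_distr_plus)
qed

lemma integral_lborel_shift:
  fixes f :: "'a::euclidean_space \<Rightarrow> 'b::{banach, second_countable_topology}"
  assumes [measurable]: "f \<in> borel_measurable borel"
  shows "(\<integral>x. f (x + c) \<partial>lborel) = (\<integral>x. f x \<partial>lborel)"
proof -
  have "(\<integral>x. f x \<partial>lborel) = (\<integral>x. f x \<partial>distr lborel borel (\<lambda>x. x + c))"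
    by (simp only: lborel_distr_shift)
  also have "\<dots> = (\<integral>x. f (x + c) \<partial>lborel)"
    by (subst integral_distr) simp_all
  finally show ?thesis by simp
qed

lemma integrable_lborel_shift:
  fixes f :: "'a::euclidean_space \<Rightarrow> 'b::{banach, second_countable_topology}"
  assumes "integrable lborel f"
  shows "integrable lborel (\<lambda>x. f (x + c))"
proof -
  have "integrable (distr lborel borel (\<lambda>x. x + c)) f"
    using assms by (simp only: lborel_distr_shift)
  then show ?thesis by (subst (asm) integrable_distr_eq) (use assms in auto)
qed

lemma integral_lborel_scale:
  fixes f :: "'a::euclidean_space \<Rightarrow> 'b::{banach, second_countable_topology}"
  assumes [measurable]: "f \<in> borel_measurable borel" and "c \<noteq> 0"
  shows "(\<integral>x. f x \<partial>lborel) = \<bar>c\<bar> ^ DIM('a) *\<^sub>R (\<integral>x. f (t + c *\<^sub>R x) \<partial>lborel)"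
  using assms(2)
  by (subst lborel_affine[of c t]) (simp_all add: integral_density integral_distr)

lemma measurable_cis [measurable]: "cis \<in> borel_measurable borel"
  by (intro borel_measurable_continuous_onI continuous_intros)

lemma integrable_cis_mult:
  fixes F :: "'a::euclidean_space \<Rightarrow> complex"
  assumes "integrable lborel F" and [measurable]: "p \<in> borel_measurable borel"
  shows "integrable lborel (\<lambda>z. cis (p z) * F z)"
  using integrable_norm[OF assms(1)]
  by (rule Bochner_Integration.integrable_bound) (use assms(1) in \<open>auto simp: norm_mult\<close>)

text \<open>Integrating \<open>G (z + v) - G z\<close> over \<open>z\<close> instead of integrating along lines avoids any appeal to
  the decay of \<open>G\<close>.\<close>

lemma integral_directional_derivative_zero:
  fixes G G' :: "'a::euclidean_space \<Rightarrow> complex"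
  assumes G: "integrable lborel G" and G': "integrable lborel G'" and cont: "continuous_on UNIV G'"
    and deriv: "\<And>z s. ((\<lambda>s. G (z + s *\<^sub>R v)) has_vector_derivative G' (z + s *\<^sub>R v)) (at s)"
  shows "(\<integral>z. G' z \<partial>lborel) = 0"
proof -
  let ?f = "\<lambda>s z. indicator {0..1::real} s *\<^sub>R G' (z + s *\<^sub>R v)"
  have [measurable]: "G' \<in> borel_measurable borel" "G \<in> borel_measurable borel"
    using G G' by auto
  have int: "integrable (lborel \<Otimes>\<^sub>M lborel) (\<lambda>(s, z). ?f s z)"
  proof (rule lborel_pair.Fubini_integrable)
    have *: "(\<integral>z. norm (?f s z) \<partial>lborel) = indicator {0..1} s *\<^sub>R (\<integral>z. norm (G' z) \<partial>lborel)" for s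
      using integral_lborel_shift[of "\<lambda>z. norm (G' z)" "s *\<^sub>R v"] by simp
    show "integrable lborel (\<lambda>s. \<integral>z. norm (case (s, z) of (s, z) \<Rightarrow> ?f s z) \<partial>lborel)"
      by (simp only: prod.case *) simp
    show "AE s in lborel. integrable lborel (\<lambda>z. case (s, z) of (s, z) \<Rightarrow> ?f s z)"
      using integrable_lborel_shift[OF G'] by simp
  qed measurable
  have FTC: "(\<integral>s. ?f s z \<partial>lborel) = G (z + v) - G z" for z
  proof -
    have "(\<integral>s. ?f s z \<partial>lborel) = G (z + 1 *\<^sub>R v) - G (z + 0 *\<^sub>R v)"
    proof (rule integral_FTC_Icc)
      show "continuous_on {0..1} (\<lambda>s. G' (z + s *\<^sub>R v))"
        by (intro continuous_on_compose2[OF cont] continuous_intros) auto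
    qed (use deriv in \<open>auto intro: has_vector_derivative_at_within\<close>)
    then show ?thesis by simp
  qed
  have "0 = (\<integral>z. G (z + v) - G z \<partial>lborel)"
    using G integrable_lborel_shift[OF G] by (simp add: integral_lborel_shift)
  also have "\<dots> = (\<integral>z. \<integral>s. ?f s z \<partial>lborel \<partial>lborel)" by (simp only: FTC)
  also have "\<dots> = (\<integral>s. \<integral>z. ?f s z \<partial>lborel \<partial>lborel)"
    by (rule lborel_pair.Fubini_integral[OF int])
  also have "\<dots> = (\<integral>s. indicator {0..1::real} s *\<^sub>R (\<integral>z. G' z \<partial>lborel) \<partial>lborel)"
    by (simp add: integral_lborel_shift)
  also have "\<dots> = (\<integral>z. G' z \<partial>lborel)" by simp
  finally show ?thesis by simp
qed

lemma fourier_eq: "fourier F \<zeta> = 1 / (2 * pi) * (\<integral>z. cis (- (z \<bullet> \<zeta>)) * F z \<partial>lborel)"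
proof (cases \<zeta>)
  case (Pair \<xi> \<tau>)
  have "(\<lambda>(x, t). exp (- \<i> * complex_of_real (x * \<xi> + t * \<tau>)) * F (x, t)) = (\<lambda>z. cis (- (z \<bullet> \<zeta>)) * F z)"
  proof (rule ext)
    have e: "exp (- \<i> * complex_of_real r) = cis (- r)" for r by (simp add: cis_conv_exp)
    fix z
    show "(case z of (x, t) \<Rightarrow> exp (- \<i> * complex_of_real (x * \<xi> + t * \<tau>)) * F (x, t)) = cis (- (z \<bullet> \<zeta>)) * F z"
      by (cases z) (simp only: prod.case e Pair inner_Pair inner_real_def)
  qed
  then show ?thesis by (simp add: fourier_def Pair)
qed

lemma fourier_measurable [measurable]:
  assumes [measurable]: "F \<in> borel_measurable borel"
  shows "fourier F \<in> borel_measurable borel"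
  unfolding fourier_eq [abs_def] by measurable

lemma fourier_bound: "cmod (fourier F \<zeta>) \<le> (\<integral>z. cmod (F z) \<partial>lborel) / (2 * pi)"
proof -
  have "cmod (\<integral>z. cis (- (z \<bullet> \<zeta>)) * F z \<partial>lborel) \<le> (\<integral>z. cmod (cis (- (z \<bullet> \<zeta>)) * F z) \<partial>lborel)"
    by (rule integral_norm_bound)
  then show ?thesis by (simp add: fourier_eq norm_mult norm_divide divide_right_mono)
qed

lemma fourier_diff:
  assumes "integrable lborel f" "integrable lborel g"
  shows "fourier (\<lambda>z. f z - g z) \<zeta> = fourier f \<zeta> - fourier g \<zeta>"
  using assms by (simp add: fourier_eq right_diff_distrib integrable_cis_mult)

text \<open>Integration by parts: the derivative of the character times \<open>F\<close> in the
  direction \<open>v\<close> has integral zero.\<close>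

lemma fourier_derivative:
  assumes F: "integrable lborel F" "integrable lborel F'" and cont: "continuous_on UNIV F" "continuous_on UNIV F'"
    and deriv: "\<And>z s. ((\<lambda>s. F (z + s *\<^sub>R v)) has_vector_derivative F' (z + s *\<^sub>R v)) (at s)"
  shows "fourier F' \<zeta> = \<i> * (v \<bullet> \<zeta>) * fourier F \<zeta>"
proof -
  let ?e = "\<lambda>z. cis (- (z \<bullet> \<zeta>))"
  have i1: "integrable lborel (\<lambda>z. ?e z * F z)" "integrable lborel (\<lambda>z. ?e z * F' z)"
    using F by (auto intro!: integrable_cis_mult)
  have "(\<integral>z. ?e z * F' z - \<i> * (v \<bullet> \<zeta>) * (?e z * F z) \<partial>lborel) = 0"
  proof (rule integral_directional_derivative_zero)
    show "integrable lborel (\<lambda>z. ?e z * F z)" by (rule i1)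
    show "integrable lborel (\<lambda>z. ?e z * F' z - \<i> * (v \<bullet> \<zeta>) * (?e z * F z))" using i1 by simp
    show "continuous_on UNIV (\<lambda>z. ?e z * F' z - \<i> * (v \<bullet> \<zeta>) * (?e z * F z))"
      by (intro continuous_intros cont)
    fix z s
    have "((\<lambda>s. ?e (z + s *\<^sub>R v)) has_vector_derivative - \<i> * (v \<bullet> \<zeta>) * ?e (z + s *\<^sub>R v)) (at s)"
      unfolding has_vector_derivative_complex_iff
      by (auto intro!: derivative_eq_intros simp: inner_left_distrib)
    from has_vector_derivative_mult[OF this deriv]
    show "((\<lambda>s. ?e (z + s *\<^sub>R v) * F (z + s *\<^sub>R v)) has_vector_derivative
       ?e (z + s *\<^sub>R v) * F' (z + s *\<^sub>R v) - \<i> * (v \<bullet> \<zeta>) * (?e (z + s *\<^sub>R v) * F (z + s *\<^sub>R v))) (at s)"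
      by (rule has_vector_derivative_eq_rhs) (simp add: algebra_simps)
  qed
  then have "(\<integral>z. ?e z * F' z \<partial>lborel) = \<i> * (v \<bullet> \<zeta>) * (\<integral>z. ?e z * F z \<partial>lborel)"
    using i1 by simp
  then show ?thesis by (simp add: fourier_eq)
qed

lemma derivs_fourier_fst:
  assumes "derivs D"
  shows "fourier (D (Suc m) n) \<zeta> = \<i> * fst \<zeta> * fourier (D m n) \<zeta>"
proof -
  have "((\<lambda>s. D m n (z + s *\<^sub>R (1, 0))) has_vector_derivative D (Suc m) n (z + s *\<^sub>R (1, 0))) (at s)" for z s
    unfolding has_vector_derivative_def
    by (rule has_derivative_eq_rhs, rule has_derivative_compose[OF _ derivs_has_derivative[OF assms]])
      (auto intro!: derivative_eq_intros)
  then have "fourier (D (Suc m) n) \<zeta> = \<i> * ((1, 0) \<bullet> \<zeta>) * fourier (D m n) \<zeta>"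
    by (intro fourier_derivative derivs_integrable derivs_continuous assms)
  then show ?thesis by (simp add: inner_prod_def)
qed

lemma derivs_fourier_snd:
  assumes "derivs D"
  shows "fourier (D m (Suc n)) \<zeta> = \<i> * snd \<zeta> * fourier (D m n) \<zeta>"
proof -
  have "((\<lambda>s. D m n (z + s *\<^sub>R (0, 1))) has_vector_derivative D m (Suc n) (z + s *\<^sub>R (0, 1))) (at s)" for z s
    unfolding has_vector_derivative_def
    by (rule has_derivative_eq_rhs, rule has_derivative_compose[OF _ derivs_has_derivative[OF assms]])
      (auto intro!: derivative_eq_intros)
  then have "fourier (D m (Suc n)) \<zeta> = \<i> * ((0, 1) \<bullet> \<zeta>) * fourier (D m n) \<zeta>"
    by (intro fourier_derivative derivs_integrable derivs_continuous assms)
  then show ?thesis by (simp add: inner_prod_def)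
qed

lemma derivs_fourier:
  assumes "derivs D"
  shows "fourier (D m n) \<zeta> = (\<i> * fst \<zeta>) ^ m * (\<i> * snd \<zeta>) ^ n * fourier (D 0 0) \<zeta>"
proof -
  have "fourier (D m n) \<zeta> = (\<i> * fst \<zeta>) ^ m * fourier (D 0 n) \<zeta>"
    by (induction m) (simp_all add: derivs_fourier_fst[OF assms])
  also have "fourier (D 0 n) \<zeta> = (\<i> * snd \<zeta>) ^ n * fourier (D 0 0) \<zeta>"
    by (induction n) (simp_all add: derivs_fourier_snd[OF assms])
  finally show ?thesis by simp
qed

lemma fourier_dx:
  assumes "schwartz F"
  shows "fourier (dx F) \<zeta> = \<i> * fst \<zeta> * fourier F \<zeta>"
proof -
  obtain D where "derivs D" "D 0 0 = F" "dx F = D 1 0" by (rule schwartz_dx_derivs[OF assms])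
  then show ?thesis using derivs_fourier_fst[of D 0 0] by simp
qed

lemma schwartz_dx: "schwartz F \<Longrightarrow> schwartz (dx F)"
  by (erule schwartz_dx_derivs) (simp add: derivs_schwartz)

text \<open>A monomial in \<xi> and \<tau> times the transform is, in modulus, the transform of a
  derivative, and a transform is bounded by an L1 norm.\<close>

lemma fourier_rapid:
  assumes "schwartz F"
  shows "rapid (\<lambda>\<zeta>. cmod (fourier F \<zeta>))"
proof (rule rapidI)
  obtain D where D: "derivs D" "D 0 0 = F" using assms by (rule schwartz_dx_derivs)
  fix m n
  have "\<bar>\<xi>\<bar> ^ m * \<bar>\<tau>\<bar> ^ n * cmod (fourier F (\<xi>, \<tau>)) \<le> (\<integral>z. cmod (D m n z) \<partial>lborel) / (2 * pi)" for \<xi> \<tau>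
    using fourier_bound[of "D m n" "(\<xi>, \<tau>)"] derivs_fourier[OF D(1), of m n "(\<xi>, \<tau>)"] D(2)
    by (simp add: norm_mult norm_power power_mult_distrib)
  then show "\<exists>C. \<forall>\<xi> \<tau>. \<bar>\<xi>\<bar> ^ m * \<bar>\<tau>\<bar> ^ n * cmod (fourier F (\<xi>, \<tau>)) \<le> C" by blast
qed simp

lemma fourier_integrable: "schwartz F \<Longrightarrow> integrable lborel (fourier F)"
  by (intro rapid_integrable fourier_rapid fourier_measurable schwartz_measurable)

section \<open>Fourier inversion and the convolution formula\<close>

lemma integrable_tensor:
  fixes f :: "'a::euclidean_space \<Rightarrow> complex" and g :: "'b::euclidean_space \<Rightarrow> complex"
  assumes "integrable lborel f" "integrable lborel g"
  shows "integrable (lborel \<Otimes>\<^sub>M lborel) (\<lambda>(x, y). f x * g y)"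
proof (rule lborel_pair.Fubini_integrable)
  have [measurable]: "f \<in> borel_measurable borel" "g \<in> borel_measurable borel" using assms by auto
  show "(\<lambda>(x, y). f x * g y) \<in> borel_measurable (lborel \<Otimes>\<^sub>M lborel)" by measurable
  show "integrable lborel (\<lambda>x. \<integral>y. norm (case (x, y) of (x, y) \<Rightarrow> f x * g y) \<partial>lborel)"
    using assms by (simp add: norm_mult)
qed (use assms in simp)

lemma integral_tensor:
  fixes f g :: "real \<Rightarrow> complex"
  assumes "integrable lborel f" "integrable lborel g"
  shows "(\<integral>z. f (fst z) * g (snd z) \<partial>lborel) = (\<integral>x. f x \<partial>lborel) * (\<integral>y. g y \<partial>lborel)"
    and "integrable lborel (\<lambda>z. f (fst z) * g (snd z))"
proof -
  have *: "integrable (lborel \<Otimes>\<^sub>M lborel) (\<lambda>z. f (fst z) * g (snd z))"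
    using integrable_tensor[OF assms] by (simp add: case_prod_unfold)
  show "integrable lborel (\<lambda>z. f (fst z) * g (snd z))"
    using * by (simp add: lborel_prod)
  have "(\<integral>z. f (fst z) * g (snd z) \<partial>lborel) = (\<integral>z. f (fst z) * g (snd z) \<partial>(lborel \<Otimes>\<^sub>M lborel))"
    by (simp add: lborel_prod)
  also have "\<dots> = (\<integral>x. (\<integral>y. f x * g y \<partial>lborel) \<partial>lborel)"
    using lborel_pair.integral_fst'[OF *] by simp
  also have "\<dots> = (\<integral>x. f x \<partial>lborel) * (\<integral>y. g y \<partial>lborel)" by simp
  finally show "(\<integral>z. f (fst z) * g (snd z) \<partial>lborel) = (\<integral>x. f x \<partial>lborel) * (\<integral>y. g y \<partial>lborel)" .
qed

text \<open>The standard normal density of the plane has mass 1, value \<open>1 / (2 * pi)\<close>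
  at 0, and is its own transform up to \<open>2 * pi\<close>; these facts fix the constant in the
  inversion formula.\<close>

definition gauss :: "real \<times> real \<Rightarrow> real" where
  "gauss z = std_normal_density (fst z) * std_normal_density (snd z)"

lemma gauss_measurable [measurable]: "gauss \<in> borel_measurable borel"
  unfolding gauss_def [abs_def] by measurable

lemma gauss_eq: "gauss z = exp (- (norm z)\<^sup>2 / 2) / (2 * pi)"
proof -
  have "std_normal_density x = exp (- x\<^sup>2 / 2) / sqrt (2 * pi)" for x
    by (simp add: std_normal_density_def)
  then have "gauss z = (exp (- (fst z)\<^sup>2 / 2) * exp (- (snd z)\<^sup>2 / 2)) / (sqrt (2 * pi) * sqrt (2 * pi))"
    by (simp add: gauss_def)
  also have "exp (- (fst z)\<^sup>2 / 2) * exp (- (snd z)\<^sup>2 / 2) = exp (- (norm z)\<^sup>2 / 2)"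
    by (simp add: norm_prod_def flip: exp_add)
  finally show ?thesis by simp
qed

text \<open>In each coordinate the integral is the characteristic function of the standard normal
  distribution.\<close>

lemma gauss_transform:
  "(\<integral>z. cis (z \<bullet> u) * of_real (gauss z) \<partial>lborel) = of_real (2 * pi * gauss u)"
  "integrable lborel (\<lambda>z. cis (z \<bullet> u) * of_real (gauss z))"
proof -
  have i: "integrable lborel (\<lambda>x. cis (x * t) * of_real (std_normal_density x))" for t
    by (intro integrable_cis_mult) auto
  have v: "(\<integral>x. cis (x * t) * of_real (std_normal_density x) \<partial>lborel) = of_real (exp (- t\<^sup>2 / 2))" for t
  proof -
    have "(\<integral>x. cis (x * t) * of_real (std_normal_density x) \<partial>lborel) = char std_normal_distribution t"
      unfolding char_def
      by (subst integral_density) (auto simp: cis_conv_exp scaleR_conv_of_real mult_ac)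
    then show ?thesis by (simp add: char_std_normal_distribution)
  qed
  have eq: "cis (z \<bullet> u) * of_real (gauss z) =
      (cis (fst z * fst u) * of_real (std_normal_density (fst z))) * (cis (snd z * snd u) * of_real (std_normal_density (snd z)))" for z
    by (simp add: gauss_def inner_prod_def mult_ac flip: cis_mult)
  show "(\<integral>z. cis (z \<bullet> u) * of_real (gauss z) \<partial>lborel) = of_real (2 * pi * gauss u)"
  proof -
    have "2 * pi * gauss u = exp (- (fst u)\<^sup>2 / 2) * exp (- (snd u)\<^sup>2 / 2)"
      unfolding gauss_eq by (simp add: norm_prod_def add_divide_distrib flip: exp_add)
    then show ?thesis unfolding eq integral_tensor(1)[OF i i] v by (simp only: of_real_mult)
  qed
  show "integrable lborel (\<lambda>z. cis (z \<bullet> u) * of_real (gauss z))"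
    unfolding eq by (rule integral_tensor(2)[OF i i])
qed

lemma gauss_nonneg: "gauss z \<ge> 0"
  by (simp add: gauss_eq)

lemma gauss_le: "gauss z \<le> 1 / (2 * pi)"
  by (simp add: gauss_eq divide_right_mono)

lemma gauss_zero: "gauss 0 = 1 / (2 * pi)"
  by (simp add: gauss_eq)

lemma continuous_gauss: "continuous_on UNIV gauss"
  unfolding gauss_eq [abs_def] by (intro continuous_intros) auto

lemma gauss_integrable: "integrable lborel (\<lambda>z. complex_of_real (gauss z))"
  using gauss_transform(2)[of 0] by simp

lemma gauss_integral: "(\<integral>z. complex_of_real (gauss z) \<partial>lborel) = 1"
  using gauss_transform(1)[of 0] by (simp add: gauss_zero)

lemma gauss_transform_scaled:
  assumes c: "c > 0"
  shows "(\<integral>\<zeta>. cis (z \<bullet> \<zeta>) * of_real (gauss (c *\<^sub>R \<zeta>)) \<partial>lborel) = of_real (2 * pi * gauss (z /\<^sub>R c) / c\<^sup>2)"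
    and "integrable lborel (\<lambda>\<zeta>. cis (z \<bullet> \<zeta>) * complex_of_real (gauss (c *\<^sub>R \<zeta>)))"
proof -
  let ?f = "\<lambda>u. cis (u \<bullet> (z /\<^sub>R c)) * complex_of_real (gauss u)"
  have eq: "?f (0 + c *\<^sub>R \<zeta>) = cis (z \<bullet> \<zeta>) * of_real (gauss (c *\<^sub>R \<zeta>))" for \<zeta>
    using c by (simp add: inner_commute flip: mult.assoc)
  have "(\<integral>u. ?f u \<partial>lborel) = \<bar>c\<bar> ^ DIM(real \<times> real) *\<^sub>R (\<integral>\<zeta>. ?f (0 + c *\<^sub>R \<zeta>) \<partial>lborel)"
    using c by (intro integral_lborel_scale) auto
  then have "complex_of_real (2 * pi * gauss (z /\<^sub>R c)) = c\<^sup>2 *\<^sub>R (\<integral>\<zeta>. cis (z \<bullet> \<zeta>) * of_real (gauss (c *\<^sub>R \<zeta>)) \<partial>lborel)"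
    unfolding eq gauss_transform(1) by (simp add: power2_eq_square)
  then show "(\<integral>\<zeta>. cis (z \<bullet> \<zeta>) * of_real (gauss (c *\<^sub>R \<zeta>)) \<partial>lborel) = of_real (2 * pi * gauss (z /\<^sub>R c) / c\<^sup>2)"
    using c by (simp add: scaleR_conv_of_real field_simps power2_eq_square)
  have "integrable (density (distr lborel borel (\<lambda>x. 0 + c *\<^sub>R x)) (\<lambda>_. ennreal (\<bar>c\<bar> ^ DIM(real \<times> real)))) ?f"
    using gauss_transform(2)[of "z /\<^sub>R c"] c by (subst lborel_affine[of c 0, symmetric]) auto
  then have "integrable lborel (\<lambda>\<zeta>. \<bar>c\<bar> ^ DIM(real \<times> real) *\<^sub>R ?f (0 + c *\<^sub>R \<zeta>))"
    by (subst (asm) integrable_density) (auto simp: integrable_distr_eq)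
  then have "integrable lborel (\<lambda>\<zeta>. (1 / \<bar>c\<bar> ^ DIM(real \<times> real)) *\<^sub>R (\<bar>c\<bar> ^ DIM(real \<times> real) *\<^sub>R ?f (0 + c *\<^sub>R \<zeta>)))"
    by (rule integrable_scaleR_right)
  then show "integrable lborel (\<lambda>\<zeta>. cis (z \<bullet> \<zeta>) * complex_of_real (gauss (c *\<^sub>R \<zeta>)))"
    unfolding eq using c by simp
qed

text \<open>Gaussian damping makes the double integral absolutely convergent, so Fubini applies. The
  integral over \<zeta> is again a Gaussian, and \<open>g\<close> gets averaged around
  \<open>z\<close> at scale \<open>c\<close>.\<close>

lemma fourier_gauss_multiplier:
  assumes g: "integrable lborel g" and c: "c > 0"
  shows "(\<integral>\<zeta>. cis (z \<bullet> \<zeta>) * fourier g \<zeta> * of_real (gauss (c *\<^sub>R \<zeta>)) \<partial>lborel)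
     = (\<integral>u. g (z - c *\<^sub>R u) * of_real (gauss u) \<partial>lborel)"
proof -
  let ?h = "\<lambda>\<zeta> w. cis ((z - w) \<bullet> \<zeta>) * (of_real (gauss (c *\<^sub>R \<zeta>)) * g w)"
  have [measurable]: "g \<in> borel_measurable borel" using g by auto
  have "integrable lborel (\<lambda>\<zeta>. complex_of_real (gauss (c *\<^sub>R \<zeta>)))"
    using gauss_transform_scaled(2)[OF c, of 0] by simp
  from integrable_norm[OF integrable_tensor[OF this g]]
  have int: "integrable (lborel \<Otimes>\<^sub>M lborel) (\<lambda>(\<zeta>, w). ?h \<zeta> w)"
    by (rule Bochner_Integration.integrable_bound) (auto simp: norm_mult split_beta)
  have "cis (z \<bullet> \<zeta>) * fourier g \<zeta> * of_real (gauss (c *\<^sub>R \<zeta>)) = 1 / (2 * pi) * (\<integral>w. ?h \<zeta> w \<partial>lborel)" for \<zeta>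
  proof -
    have "(\<integral>w. ?h \<zeta> w \<partial>lborel) = (\<integral>w. (cis (z \<bullet> \<zeta>) * of_real (gauss (c *\<^sub>R \<zeta>))) * (cis (- (w \<bullet> \<zeta>)) * g w) \<partial>lborel)"
    proof -
      have "cis ((z - w) \<bullet> \<zeta>) = cis (z \<bullet> \<zeta>) * cis (- (w \<bullet> \<zeta>))" for w
        by (simp add: inner_diff_left cis_mult)
      then show ?thesis by (simp only: mult_ac)
    qed
    also have "\<dots> = (cis (z \<bullet> \<zeta>) * of_real (gauss (c *\<^sub>R \<zeta>))) * (\<integral>w. cis (- (w \<bullet> \<zeta>)) * g w \<partial>lborel)"
      by simp
    finally show ?thesis by (simp add: fourier_eq)
  qed
  then have "(\<integral>\<zeta>. cis (z \<bullet> \<zeta>) * fourier g \<zeta> * of_real (gauss (c *\<^sub>R \<zeta>)) \<partial>lborel)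
     = 1 / (2 * pi) * (\<integral>\<zeta>. \<integral>w. ?h \<zeta> w \<partial>lborel \<partial>lborel)"
    by simp
  also have "(\<integral>\<zeta>. \<integral>w. ?h \<zeta> w \<partial>lborel \<partial>lborel) = (\<integral>w. \<integral>\<zeta>. ?h \<zeta> w \<partial>lborel \<partial>lborel)"
    by (rule lborel_pair.Fubini_integral[OF int, symmetric])
  also have "(\<lambda>w. \<integral>\<zeta>. ?h \<zeta> w \<partial>lborel) = (\<lambda>w. g w * of_real (2 * pi * gauss ((z - w) /\<^sub>R c) / c\<^sup>2))"
  proof
    fix w
    have "(\<integral>\<zeta>. ?h \<zeta> w \<partial>lborel) = (\<integral>\<zeta>. g w * (cis ((z - w) \<bullet> \<zeta>) * of_real (gauss (c *\<^sub>R \<zeta>))) \<partial>lborel)"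
      by (simp add: mult_ac)
    also have "\<dots> = g w * of_real (2 * pi * gauss ((z - w) /\<^sub>R c) / c\<^sup>2)"
      unfolding integral_mult_right_zero gauss_transform_scaled(1)[OF c] ..
    finally show "(\<integral>\<zeta>. ?h \<zeta> w \<partial>lborel) = g w * of_real (2 * pi * gauss ((z - w) /\<^sub>R c) / c\<^sup>2)" .
  qed
  also have "(\<integral>w. g w * of_real (2 * pi * gauss ((z - w) /\<^sub>R c) / c\<^sup>2) \<partial>lborel)
     = \<bar>- c\<bar> ^ DIM(real \<times> real) *\<^sub>R (\<integral>u. g (z + (- c) *\<^sub>R u) * of_real (2 * pi * gauss ((z - (z + (- c) *\<^sub>R u)) /\<^sub>R c) / c\<^sup>2) \<partial>lborel)"
    using c by (intro integral_lborel_scale) auto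
  also have "\<dots> = (\<integral>u. g (z - c *\<^sub>R u) * (of_real (2 * pi) * of_real (gauss u)) \<partial>lborel)"
  proof -
    have "\<bar>- c\<bar> ^ DIM(real \<times> real) *\<^sub>R (g (z + (- c) *\<^sub>R u) * complex_of_real (2 * pi * gauss ((z - (z + (- c) *\<^sub>R u)) /\<^sub>R c) / c\<^sup>2))
        = g (z - c *\<^sub>R u) * (of_real (2 * pi) * of_real (gauss u))" for u
      using c by (simp add: scaleR_conv_of_real power2_eq_square)
    then show ?thesis by (simp only: integral_scaleR_right[symmetric])
  qed
  also have "\<dots> = of_real (2 * pi) * (\<integral>u. g (z - c *\<^sub>R u) * of_real (gauss u) \<partial>lborel)"
    by (simp add: mult_ac flip: integral_mult_right_zero)
  finally show ?thesis by simp
qed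

text \<open>Let the scale tend to 0 in \<open>fourier_gauss_multiplier\<close>: the damping tends to
  the constant \<open>gauss 0 = 1 / (2 * pi)\<close> and the averages tend to \<open>g z\<close>.
  Both limits are dominated, as \<open>fourier g\<close> is integrable and \<open>g\<close> is
  bounded.\<close>

lemma fourier_inversion:
  assumes g: "schwartz g"
  shows "g z = 1 / (2 * pi) * (\<integral>\<zeta>. cis (z \<bullet> \<zeta>) * fourier g \<zeta> \<partial>lborel)"
proof -
  define c where "c = (\<lambda>n. 1 / real (Suc n))"
  have c: "c n > 0" for n by (simp add: c_def)
  have c0: "c \<longlonglongrightarrow> 0" unfolding c_def by (rule LIMSEQ_Suc[OF lim_1_over_n])
  have [measurable]: "g \<in> borel_measurable borel" by (rule schwartz_measurable[OF g])
  have gi: "integrable lborel g" by (rule schwartz_integrable[OF g])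
  obtain B where B: "\<And>z. cmod (g z) \<le> B" using rapid_bounded[OF schwartz_rapid[OF g]] by blast
  let ?L = "\<lambda>n. (\<integral>\<zeta>. cis (z \<bullet> \<zeta>) * fourier g \<zeta> * of_real (gauss (c n *\<^sub>R \<zeta>)) \<partial>lborel)"
  have "?L \<longlonglongrightarrow> (\<integral>\<zeta>. cis (z \<bullet> \<zeta>) * fourier g \<zeta> * of_real (gauss 0) \<partial>lborel)"
  proof (rule integral_dominated_convergence[where w = "\<lambda>\<zeta>. cmod (fourier g \<zeta>) * (1 / (2 * pi))"])
    show "integrable lborel (\<lambda>\<zeta>. cmod (fourier g \<zeta>) * (1 / (2 * pi)))"
      using fourier_integrable[OF g] by simp
    show "AE \<zeta> in lborel. (\<lambda>n. cis (z \<bullet> \<zeta>) * fourier g \<zeta> * of_real (gauss (c n *\<^sub>R \<zeta>)))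
       \<longlonglongrightarrow> cis (z \<bullet> \<zeta>) * fourier g \<zeta> * of_real (gauss 0)"
    proof (intro always_eventually allI tendsto_intros)
      fix \<zeta> :: "real \<times> real"
      have "(\<lambda>n. c n *\<^sub>R \<zeta>) \<longlonglongrightarrow> 0" using tendsto_scaleR[OF c0 tendsto_const, of \<zeta>] by simp
      then show "(\<lambda>n. gauss (c n *\<^sub>R \<zeta>)) \<longlonglongrightarrow> gauss 0"
        by (rule continuous_on_tendsto_compose[OF continuous_gauss]) auto
    qed
    show "AE \<zeta> in lborel. norm (cis (z \<bullet> \<zeta>) * fourier g \<zeta> * of_real (gauss (c n *\<^sub>R \<zeta>))) \<le> cmod (fourier g \<zeta>) * (1 / (2 * pi))" for n
      by (intro always_eventually allI) (simp only: norm_mult norm_cis mult_1 norm_of_real abs_of_nonneg gauss_nonneg mult_left_mono gauss_le norm_ge_zero)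
  qed measurable
  moreover have "?L \<longlonglongrightarrow> (\<integral>u. g z * of_real (gauss u) \<partial>lborel)"
    unfolding fourier_gauss_multiplier[OF gi c]
  proof (rule integral_dominated_convergence[where w = "\<lambda>u. B * cmod (complex_of_real (gauss u))"])
    show "integrable lborel (\<lambda>u. B * cmod (complex_of_real (gauss u)))"
      using gauss_integrable by (intro integrable_mult_right integrable_norm)
    show "AE u in lborel. (\<lambda>n. g (z - c n *\<^sub>R u) * of_real (gauss u)) \<longlonglongrightarrow> g z * of_real (gauss u)"
    proof (intro always_eventually allI tendsto_intros)
      fix u
      have "(\<lambda>n. z - c n *\<^sub>R u) \<longlonglongrightarrow> z - 0 *\<^sub>R u" by (intro tendsto_intros c0)
      then have "(\<lambda>n. z - c n *\<^sub>R u) \<longlonglongrightarrow> z" by simp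
      then show "(\<lambda>n. g (z - c n *\<^sub>R u)) \<longlonglongrightarrow> g z"
        by (rule continuous_on_tendsto_compose[OF schwartz_continuous[OF g]]) auto
    qed
    show "AE u in lborel. norm (g (z - c n *\<^sub>R u) * of_real (gauss u)) \<le> B * cmod (complex_of_real (gauss u))" for n
      by (intro always_eventually allI) (simp add: norm_mult B mult_right_mono)
  qed measurable
  ultimately have "(\<integral>\<zeta>. cis (z \<bullet> \<zeta>) * fourier g \<zeta> * of_real (gauss 0) \<partial>lborel) = (\<integral>u. g z * of_real (gauss u) \<partial>lborel)"
    by (rule LIMSEQ_unique)
  also have "(\<integral>u. g z * of_real (gauss u) \<partial>lborel) = g z"
    by (simp only: integral_mult_right_zero gauss_integral mult_1_right)
  finally show ?thesis by (simp add: gauss_zero mult.commute)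
qed

text \<open>Write \<open>f\<close> by the inversion formula and exchange the integrals; what remains
  inside is the transform of \<open>g\<close> at a shifted frequency.\<close>

lemma fourier_mult:
  assumes f: "schwartz f" and g: "schwartz g"
  shows "fourier (\<lambda>z. f z * g z) \<zeta> = 1 / (2 * pi) * (\<integral>\<eta>. fourier f \<eta> * fourier g (\<zeta> - \<eta>) \<partial>lborel)"
proof -
  let ?h = "\<lambda>\<eta> w. cis (- (w \<bullet> (\<zeta> - \<eta>))) * (fourier f \<eta> * g w)"
  have [measurable]: "f \<in> borel_measurable borel" "g \<in> borel_measurable borel"
    using f g by (auto intro: schwartz_measurable)
  from integrable_norm[OF integrable_tensor[OF fourier_integrable[OF f] schwartz_integrable[OF g]]]
  have int: "integrable (lborel \<Otimes>\<^sub>M lborel) (\<lambda>(\<eta>, w). ?h \<eta> w)"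
    by (rule Bochner_Integration.integrable_bound) (auto simp: norm_mult split_beta)
  have "cis (- (w \<bullet> \<zeta>)) * (f w * g w) = 1 / (2 * pi) * (\<integral>\<eta>. ?h \<eta> w \<partial>lborel)" for w
  proof -
    have "(\<integral>\<eta>. ?h \<eta> w \<partial>lborel) = (\<integral>\<eta>. (cis (- (w \<bullet> \<zeta>)) * g w) * (cis (w \<bullet> \<eta>) * fourier f \<eta>) \<partial>lborel)"
    proof -
      have "cis (- (w \<bullet> (\<zeta> - \<eta>))) = cis (- (w \<bullet> \<zeta>)) * cis (w \<bullet> \<eta>)" for \<eta>
        by (simp add: inner_diff_right cis_mult)
      then show ?thesis by (simp only: mult_ac)
    qed
    also have "\<dots> = (cis (- (w \<bullet> \<zeta>)) * g w) * (\<integral>\<eta>. cis (w \<bullet> \<eta>) * fourier f \<eta> \<partial>lborel)"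
      by simp
    finally show ?thesis using fourier_inversion[OF f, of w] by simp
  qed
  then have "fourier (\<lambda>z. f z * g z) \<zeta> = 1 / (2 * pi) * (1 / (2 * pi) * (\<integral>w. \<integral>\<eta>. ?h \<eta> w \<partial>lborel \<partial>lborel))"
    by (simp add: fourier_eq[of "\<lambda>z. f z * g z"])
  also have "(\<integral>w. \<integral>\<eta>. ?h \<eta> w \<partial>lborel \<partial>lborel) = (\<integral>\<eta>. \<integral>w. ?h \<eta> w \<partial>lborel \<partial>lborel)"
    by (rule lborel_pair.Fubini_integral[OF int])
  also have "(\<lambda>\<eta>. \<integral>w. ?h \<eta> w \<partial>lborel) = (\<lambda>\<eta>. of_real (2 * pi) * (fourier f \<eta> * fourier g (\<zeta> - \<eta>)))"
  proof
    fix \<eta>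
    have "(\<integral>w. ?h \<eta> w \<partial>lborel) = (\<integral>w. fourier f \<eta> * (cis (- (w \<bullet> (\<zeta> - \<eta>))) * g w) \<partial>lborel)"
      by (simp add: mult_ac)
    also have "\<dots> = fourier f \<eta> * (\<integral>w. cis (- (w \<bullet> (\<zeta> - \<eta>))) * g w \<partial>lborel)"
      by (rule integral_mult_right_zero)
    finally show "(\<integral>w. ?h \<eta> w \<partial>lborel) = of_real (2 * pi) * (fourier f \<eta> * fourier g (\<zeta> - \<eta>))"
      by (simp add: fourier_eq[of g])
  qed
  finally show ?thesis by simp
qed

lemma fourier_mult_bound:
  assumes f: "schwartz f" and g: "schwartz g"
  shows "ennreal (cmod (fourier (\<lambda>z. f z * g z) \<zeta>))
    \<le> (\<integral>\<^sup>+\<eta>. ennreal (cmod (fourier f \<eta>) * cmod (fourier g (\<zeta> - \<eta>))) \<partial>lborel)"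
proof -
  let ?I = "\<integral>\<eta>. fourier f \<eta> * fourier g (\<zeta> - \<eta>) \<partial>lborel"
  have [measurable]: "f \<in> borel_measurable borel" "g \<in> borel_measurable borel"
    using f g by (auto intro: schwartz_measurable)
  obtain B where B: "\<And>z. cmod (fourier g z) \<le> B" using rapid_bounded[OF fourier_rapid[OF g]] by blast
  have "integrable lborel (\<lambda>\<eta>. B * cmod (fourier f \<eta>))"
    using fourier_integrable[OF f] by simp
  then have int: "integrable lborel (\<lambda>\<eta>. fourier f \<eta> * fourier g (\<zeta> - \<eta>))"
  proof (rule Bochner_Integration.integrable_bound)
    show "AE \<eta> in lborel. norm (fourier f \<eta> * fourier g (\<zeta> - \<eta>)) \<le> norm (B * cmod (fourier f \<eta>))"
    proof (intro always_eventually allI)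
      fix \<eta>
      have "cmod (fourier f \<eta>) * cmod (fourier g (\<zeta> - \<eta>)) \<le> cmod (fourier f \<eta>) * B"
        by (intro mult_left_mono B norm_ge_zero)
      then show "norm (fourier f \<eta> * fourier g (\<zeta> - \<eta>)) \<le> norm (B * cmod (fourier f \<eta>))"
        using abs_ge_self[of "B * cmod (fourier f \<eta>)"] by (simp only: norm_mult real_norm_def mult.commute)
    qed
  qed measurable
  \<comment> \<open>The convolution constant \<open>1 / (2 * pi)\<close> is below 1 and is
    discarded.\<close>
  have "1 * cmod (fourier (\<lambda>z. f z * g z) \<zeta>) \<le> (2 * pi) * cmod (fourier (\<lambda>z. f z * g z) \<zeta>)"
    using pi_gt3 by (intro mult_right_mono) auto
  also have "\<dots> = cmod ?I"
    unfolding fourier_mult[OF f g] by (simp add: norm_mult norm_divide)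
  finally have "ennreal (cmod (fourier (\<lambda>z. f z * g z) \<zeta>)) \<le> ennreal (cmod ?I)"
    by (simp add: ennreal_leI)
  also have "\<dots> \<le> (\<integral>\<^sup>+\<eta>. ennreal (norm (fourier f \<eta> * fourier g (\<zeta> - \<eta>))) \<partial>lborel)"
    by (rule integral_norm_bound_ennreal[OF int])
  finally show ?thesis by (simp add: norm_mult)
qed

section \<open>The bilinear estimate on Schwartz functions\<close>

definition weighted :: "real \<Rightarrow> real \<Rightarrow> real \<Rightarrow> (real \<times> real \<Rightarrow> complex) \<Rightarrow> real \<times> real \<Rightarrow> real" where
  "weighted a s b F = (\<lambda>(\<xi>, \<tau>). japanese (\<tau> + a * \<xi> ^ 3) powr b * japanese \<xi> powr s * cmod (fourier F (\<xi>, \<tau>)))"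

lemma weighted_nonneg: "weighted a s b F z \<ge> 0"
  by (simp add: weighted_def case_prod_beta)

lemma weighted_measurable:
  assumes "schwartz F"
  shows "weighted a s b F \<in> borel_measurable borel"
proof -
  have [measurable]: "fourier F \<in> borel_measurable borel"
    using assms by (intro fourier_measurable schwartz_measurable)
  show ?thesis unfolding weighted_def case_prod_beta by measurable
qed

lemma japanese_powr_le_power: "japanese x powr r \<le> japanese x ^ nat \<lceil>r\<rceil>"
proof -
  have "japanese x powr r \<le> japanese x powr real (nat \<lceil>r\<rceil>)"
    by (intro powr_mono japanese_ge_1) linarith
  then show ?thesis by (simp add: powr_realpow)
qed

text \<open>The weights grow at most polynomially: real exponents are dominated by natural ones, and
  the bracket of \<open>\<tau> + a * \<xi> ^ 3\<close> is at most
  \<open>japanese a * japanese \<tau> * japanese \<xi> ^ 3\<close>.\<close>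

lemma weighted_rapid:
  assumes F: "schwartz F"
  shows "rapid (weighted a s b F)"
proof (rule rapid_mono[OF fourier_rapid[OF F]])
  define n where "n = nat \<lceil>b\<rceil>"
  define m where "m = nat \<lceil>s\<rceil>"
  fix \<xi> \<tau> :: real
  have "japanese (a * \<xi> ^ 3) \<le> japanese a * japanese \<xi> ^ 3"
  proof -
    have "\<bar>\<xi>\<bar> ^ 3 \<le> japanese \<xi> ^ 3" "1 \<le> japanese \<xi> ^ 3"
      using japanese_ge_1[of \<xi>] by (auto intro!: power_mono simp: japanese_def)
    then have "1 + \<bar>a\<bar> * \<bar>\<xi>\<bar> ^ 3 \<le> japanese \<xi> ^ 3 + \<bar>a\<bar> * japanese \<xi> ^ 3"
      by (intro add_mono mult_left_mono) auto
    then show ?thesis by (simp add: japanese_def abs_mult power_abs algebra_simps)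
  qed
  then have "japanese (\<tau> + a * \<xi> ^ 3) \<le> japanese \<tau> * (japanese a * japanese \<xi> ^ 3)"
    by (intro order_trans[OF japanese_add_le] mult_left_mono) (auto simp: japanese_nonneg)
  then have "japanese (\<tau> + a * \<xi> ^ 3) ^ n \<le> (japanese \<tau> * (japanese a * japanese \<xi> ^ 3)) ^ n"
    by (intro power_mono) (auto simp: japanese_nonneg)
  then have "japanese (\<tau> + a * \<xi> ^ 3) powr b \<le> (japanese \<tau> * (japanese a * japanese \<xi> ^ 3)) ^ n"
    using japanese_powr_le_power[of "\<tau> + a * \<xi> ^ 3" b] by (simp add: n_def)
  then have "japanese (\<tau> + a * \<xi> ^ 3) powr b * japanese \<xi> powr s * cmod (fourier F (\<xi>, \<tau>))
    \<le> (japanese \<tau> * (japanese a * japanese \<xi> ^ 3)) ^ n * japanese \<xi> ^ m * cmod (fourier F (\<xi>, \<tau>))"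
    using japanese_powr_le_power[of \<xi> s]
    by (intro mult_right_mono mult_mono) (auto simp: m_def japanese_nonneg)
  also have "\<dots> = japanese a ^ n * (japanese \<xi> ^ (3 * n + m) * japanese \<tau> ^ n) * cmod (fourier F (\<xi>, \<tau>))"
    by (simp add: power_mult_distrib power_add mult_ac flip: power_mult)
  finally show "weighted a s b F (\<xi>, \<tau>) \<le> japanese a ^ n * (japanese \<xi> ^ (3 * n + m) * japanese \<tau> ^ n) * cmod (fourier F (\<xi>, \<tau>))"
    by (simp add: weighted_def)
qed (simp add: japanese_nonneg)

text \<open>Ensures that the Bochner integral in \<open>pre_norm\<close> has its true value and not
  the default 0 of a non-integrable function.\<close>

lemma weighted_sq_integrable:
  assumes F: "schwartz F"
  shows "integrable lborel (\<lambda>z. (weighted a s b F z)\<^sup>2)"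
proof (rule rapid_integrable)
  show "(\<lambda>z. (weighted a s b F z)\<^sup>2) \<in> borel_measurable borel"
    using weighted_measurable[OF F] by measurable
  show "rapid (\<lambda>z. norm ((weighted a s b F z)\<^sup>2))"
    using rapid_mult[OF weighted_rapid[OF F] weighted_rapid[OF F] weighted_nonneg weighted_nonneg]
    by (simp add: power2_eq_square)
qed

lemma pre_norm_eq: "pre_norm a s b F = sqrt (\<integral>z. (weighted a s b F z)\<^sup>2 \<partial>lborel)"
proof -
  have "(\<lambda>(\<xi>, \<tau>). japanese (\<tau> + a * \<xi> ^ 3) powr (2 * b) * japanese \<xi> powr (2 * s) * (cmod (fourier F (\<xi>, \<tau>)))\<^sup>2)
    = (\<lambda>z. (weighted a s b F z)\<^sup>2)"
    by (auto simp: fun_eq_iff weighted_def power_mult_distrib japanese_powr_sq)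
  then show ?thesis by (simp add: pre_norm_def)
qed

lemma pre_norm_nonneg: "pre_norm a s b F \<ge> 0"
  by (simp add: pre_norm_eq)

lemma pre_norm_sq: "(pre_norm a s b F)\<^sup>2 = (\<integral>z. (weighted a s b F z)\<^sup>2 \<partial>lborel)"
  by (simp add: pre_norm_eq)

lemma nn_integral_weighted_sq:
  assumes "schwartz F"
  shows "(\<integral>\<^sup>+z. ennreal ((weighted a s b F z)\<^sup>2) \<partial>lborel) = ennreal ((pre_norm a s b F)\<^sup>2)"
  unfolding pre_norm_sq by (intro nn_integral_eq_integral weighted_sq_integrable assms) auto

section \<open>Triangle inequalities for the norm\<close>

lemma Minkowski_sqrt_integral:
  fixes p q h :: "'a \<Rightarrow> real"
  assumes [measurable]: "p \<in> borel_measurable M" "q \<in> borel_measurable M" "h \<in> borel_measurable M"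
    and int: "integrable M (\<lambda>z. (p z)\<^sup>2)" "integrable M (\<lambda>z. (q z)\<^sup>2)"
    and nn: "\<And>z. 0 \<le> p z" "\<And>z. 0 \<le> q z" "\<And>z. 0 \<le> h z" and le: "\<And>z. h z \<le> p z + q z"
  shows "sqrt (\<integral>z. (h z)\<^sup>2 \<partial>M) \<le> sqrt (\<integral>z. (p z)\<^sup>2 \<partial>M) + sqrt (\<integral>z. (q z)\<^sup>2 \<partial>M)"
proof (rule real_le_lsqrt[rotated])
  let ?P = "\<integral>z. (p z)\<^sup>2 \<partial>M" and ?Q = "\<integral>z. (q z)\<^sup>2 \<partial>M"
  have P: "?P \<ge> 0" and Q: "?Q \<ge> 0" by simp_all
  show "0 \<le> sqrt ?P + sqrt ?Q" by simp
  have pq: "integrable M (\<lambda>z. p z * q z)"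
  proof (rule Bochner_Integration.integrable_bound)
    show "integrable M (\<lambda>z. (p z)\<^sup>2 + (q z)\<^sup>2)" using int by simp
    show "AE z in M. norm (p z * q z) \<le> norm ((p z)\<^sup>2 + (q z)\<^sup>2)"
    proof (intro always_eventually allI)
      fix z
      have "2 * (p z * q z) \<le> (p z)\<^sup>2 + (q z)\<^sup>2"
        using zero_le_power2[of "p z - q z"] by (simp add: power2_diff)
      moreover have "0 \<le> p z * q z" using nn by simp
      ultimately show "norm (p z * q z) \<le> norm ((p z)\<^sup>2 + (q z)\<^sup>2)" by simp
    qed
  qed measurable
  have "ennreal ((\<integral>z. p z * q z \<partial>M)\<^sup>2) = (\<integral>\<^sup>+z. ennreal (p z * q z) \<partial>M)\<^sup>2"
    using pq nn by (simp add: nn_integral_eq_integral ennreal_power integral_nonneg_AE)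
  also have "\<dots> \<le> (\<integral>\<^sup>+z. ennreal ((p z)\<^sup>2) \<partial>M) * (\<integral>\<^sup>+z. ennreal ((q z)\<^sup>2) \<partial>M)"
    using nn by (intro nn_integral_Cauchy_Schwarz) auto
  also have "\<dots> = ennreal (?P * ?Q)"
    using int by (simp add: nn_integral_eq_integral ennreal_mult)
  finally have "(\<integral>z. p z * q z \<partial>M)\<^sup>2 \<le> ?P * ?Q" by simp
  then have CS: "(\<integral>z. p z * q z \<partial>M) \<le> sqrt ?P * sqrt ?Q"
    by (metis real_le_rsqrt real_sqrt_mult)
  have "(\<integral>z. (h z)\<^sup>2 \<partial>M) \<le> (\<integral>z. (p z)\<^sup>2 + 2 * (p z * q z) + (q z)\<^sup>2 \<partial>M)"
  proof (rule integral_mono_AE')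
    show "integrable M (\<lambda>z. (p z)\<^sup>2 + 2 * (p z * q z) + (q z)\<^sup>2)" using int pq by simp
    show "AE z in M. (h z)\<^sup>2 \<le> (p z)\<^sup>2 + 2 * (p z * q z) + (q z)\<^sup>2"
    proof (intro always_eventually allI)
      fix z
      have "(h z)\<^sup>2 \<le> (p z + q z)\<^sup>2" using nn le by (intro power_mono)
      then show "(h z)\<^sup>2 \<le> (p z)\<^sup>2 + 2 * (p z * q z) + (q z)\<^sup>2" by (simp add: power2_sum algebra_simps)
    qed
  qed (use nn in simp)
  also have "\<dots> = ?P + 2 * (\<integral>z. p z * q z \<partial>M) + ?Q" using int pq by simp
  also have "\<dots> \<le> (sqrt ?P + sqrt ?Q)\<^sup>2" using CS P Q by (simp add: power2_sum)
  finally show "(\<integral>z. (h z)\<^sup>2 \<partial>M) \<le> (sqrt ?P + sqrt ?Q)\<^sup>2" .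
qed

text \<open>Comparing only Fourier moduli makes one lemma cover the triangle inequality, the reverse
  one and the splitting of products in \<open>dx_product_extension\<close>.\<close>

lemma pre_norm_le_add:
  assumes "schwartz f" "schwartz g" "schwartz h"
    and le: "\<And>z. cmod (fourier h z) \<le> cmod (fourier f z) + cmod (fourier g z)"
  shows "pre_norm a s b h \<le> pre_norm a s b f + pre_norm a s b g"
  unfolding pre_norm_eq
proof (rule Minkowski_sqrt_integral)
  fix z :: "real \<times> real"
  obtain \<xi> \<tau> where z: "z = (\<xi>, \<tau>)" by (metis surj_pair)
  have "japanese (\<tau> + a * \<xi> ^ 3) powr b * japanese \<xi> powr s * cmod (fourier h z)
    \<le> japanese (\<tau> + a * \<xi> ^ 3) powr b * japanese \<xi> powr s * (cmod (fourier f z) + cmod (fourier g z))"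
    by (intro mult_left_mono le) auto
  then show "weighted a s b h z \<le> weighted a s b f z + weighted a s b g z"
    by (simp add: weighted_def z distrib_left)
qed (use assms in \<open>auto intro: weighted_measurable weighted_sq_integrable weighted_nonneg\<close>)

lemma fourier_schwartz_diff:
  "schwartz f \<Longrightarrow> schwartz g \<Longrightarrow> fourier (\<lambda>z. f z - g z) \<zeta> = fourier f \<zeta> - fourier g \<zeta>"
  by (intro fourier_diff schwartz_integrable)

lemma pre_norm_diff_triangle:
  assumes "schwartz f" "schwartz g" "schwartz h"
  shows "pre_norm a s b (\<lambda>z. f z - h z) \<le> pre_norm a s b (\<lambda>z. f z - g z) + pre_norm a s b (\<lambda>z. g z - h z)"
  using assms norm_triangle_ineq[of "fourier f \<zeta> - fourier g \<zeta>" "fourier g \<zeta> - fourier h \<zeta>" for \<zeta>]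
  by (intro pre_norm_le_add schwartz_diff) (simp_all add: fourier_schwartz_diff)

lemma pre_norm_diff_commute:
  assumes "schwartz f" "schwartz g"
  shows "pre_norm a s b (\<lambda>z. f z - g z) = pre_norm a s b (\<lambda>z. g z - f z)"
proof -
  have "weighted a s b (\<lambda>z. f z - g z) = weighted a s b (\<lambda>z. g z - f z)"
    using assms by (simp add: weighted_def fourier_schwartz_diff norm_minus_commute)
  then show ?thesis by (simp add: pre_norm_eq)
qed

lemma pre_norm_reverse_triangle:
  assumes "schwartz f" "schwartz g"
  shows "\<bar>pre_norm a s b f - pre_norm a s b g\<bar> \<le> pre_norm a s b (\<lambda>z. f z - g z)"
proof -
  have *: "pre_norm a s b f \<le> pre_norm a s b (\<lambda>z. f z - g z) + pre_norm a s b g"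
    if "schwartz f" "schwartz g" for f g
    using that norm_triangle_ineq[of "fourier f \<zeta> - fourier g \<zeta>" "fourier g \<zeta>" for \<zeta>]
    by (intro pre_norm_le_add schwartz_diff) (simp_all add: fourier_schwartz_diff)
  show ?thesis using *[OF assms] *[OF assms(2,1)] pre_norm_diff_commute[OF assms, of a s b] by linarith
qed

section \<open>From the trilinear form to the bilinear estimate\<close>

lemma weighted_dx:
  assumes "schwartz h"
  shows "weighted a s b (dx h) (\<xi>, \<tau>) =
    \<bar>\<xi>\<bar> * (japanese (\<tau> + a * \<xi> ^ 3) powr b * japanese \<xi> powr s) * cmod (fourier h (\<xi>, \<tau>))"
  using fourier_dx[OF assms, of "(\<xi>, \<tau>)"] by (simp add: weighted_def norm_mult)

context exponents
begin

text \<open>Reduces the exponent \<open>s\<close> to -\<rho>: the surplus \<open>\<rho> + s\<close>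
  is nonnegative, so submultiplicativity of the bracket distributes its power from \<xi> to the two
  input frequencies.\<close>

lemma kernel_weighted:
  assumes s: "- \<rho> \<le> s"
  shows "\<bar>\<xi>\<bar> * (japanese (\<tau> + e0 * \<xi> ^ 3) powr (- \<beta> / 2) * japanese \<xi> powr s) *
      (cmod (fourier f w) * cmod (fourier g ((\<xi>, \<tau>) - w)))
    \<le> kernel e0 e1 e2 (\<xi>, \<tau>) w * (weighted e1 s (a / 2) f w * weighted e2 s (a / 2) g ((\<xi>, \<tau>) - w))"
proof -
  obtain \<xi>1 \<tau>1 where w: "w = (\<xi>1, \<tau>1)" by (metis surj_pair)
  define A where "A = japanese (\<tau> + e0 * \<xi> ^ 3) powr (- \<beta> / 2)"
  define B where "B = japanese (\<tau>1 + e1 * \<xi>1 ^ 3)"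
  define D where "D = japanese (\<tau> - \<tau>1 + e2 * (\<xi> - \<xi>1) ^ 3)"
  define p where "p = cmod (fourier f (\<xi>1, \<tau>1))"
  define q where "q = cmod (fourier g (\<xi> - \<xi>1, \<tau> - \<tau>1))"
  have BD: "B powr (- a / 2) * B powr (a / 2) = 1" "D powr (- a / 2) * D powr (a / 2) = 1"
    by (simp_all add: B_def D_def flip: powr_add)
  have "japanese \<xi> powr s = japanese \<xi> powr (- \<rho>) * japanese \<xi> powr (\<rho> + s)"
    by (simp flip: powr_add)
  also have "\<dots> \<le> japanese \<xi> powr (- \<rho>) * (japanese \<xi>1 * japanese (\<xi> - \<xi>1)) powr (\<rho> + s)"
    using japanese_add_le[of \<xi>1 "\<xi> - \<xi>1"] s
    by (intro mult_left_mono powr_mono2) (auto simp: japanese_nonneg)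
  also have "\<dots> = japanese \<xi> powr (- \<rho>) * ((japanese \<xi>1 powr \<rho> * japanese (\<xi> - \<xi>1) powr \<rho>) *
       (japanese \<xi>1 powr s * japanese (\<xi> - \<xi>1) powr s))"
    by (simp add: powr_mult powr_add mult_ac)
  finally have J: "japanese \<xi> powr s \<le> japanese \<xi> powr (- \<rho>) * ((japanese \<xi>1 powr \<rho> * japanese (\<xi> - \<xi>1) powr \<rho>) *
       (japanese \<xi>1 powr s * japanese (\<xi> - \<xi>1) powr s))" .
  have "\<bar>\<xi>\<bar> * (A * japanese \<xi> powr s) * (p * q) \<le>
     \<bar>\<xi>\<bar> * (A * (japanese \<xi> powr (- \<rho>) * ((japanese \<xi>1 powr \<rho> * japanese (\<xi> - \<xi>1) powr \<rho>) *
       (japanese \<xi>1 powr s * japanese (\<xi> - \<xi>1) powr s)))) * (p * q)"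
    by (intro mult_right_mono mult_left_mono J) (auto simp: A_def p_def q_def)
  also have "\<dots> = \<bar>\<xi>\<bar> * japanese \<xi> powr (- \<rho>) * (japanese \<xi>1 powr \<rho> * japanese (\<xi> - \<xi>1) powr \<rho>) *
       (A * ((B powr (- a / 2) * B powr (a / 2)) * (D powr (- a / 2) * D powr (a / 2)))) *
       ((japanese \<xi>1 powr s * p) * (japanese (\<xi> - \<xi>1) powr s * q))"
    unfolding BD by (simp add: mult_ac)
  also have "\<dots> = kernel e0 e1 e2 (\<xi>, \<tau>) w * (weighted e1 s (a / 2) f w * weighted e2 s (a / 2) g ((\<xi>, \<tau>) - w))"
    by (simp add: kernel_def weighted_def w A_def B_def D_def p_def q_def mult_ac)
  finally show ?thesis by (simp add: A_def p_def q_def w)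
qed

text \<open>The trilinear form is tested on \<open>H\<close>, the weighted output itself, and is
  then at least the square of its norm \<open>n\<close>. This gives
  \<open>n^4 \<le> C n^2 p^2 q^2\<close>, where \<open>n\<close> is finite because the product is a
  Schwartz function, so \<open>n^2\<close> can be cancelled.\<close>

lemma bilinear_of_trilinear:
  fixes C :: real
  assumes tri: "\<And>H F G. H \<in> borel_measurable borel \<Longrightarrow> F \<in> borel_measurable borel \<Longrightarrow> G \<in> borel_measurable borel \<Longrightarrow>
      (\<And>z. 0 \<le> H z) \<Longrightarrow> (\<And>z. 0 \<le> F z) \<Longrightarrow> (\<And>z. 0 \<le> G z) \<Longrightarrow>
      (\<integral>\<^sup>+z. \<integral>\<^sup>+w. ennreal (kernel e0 e1 e2 z w * (H z * F w * G (z - w))) \<partial>lborel \<partial>lborel)\<^sup>2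
        \<le> ennreal C * (nn_sq H * nn_sq F * nn_sq G)"
    and C: "C \<ge> 0" and s: "- \<rho> \<le> s" and f: "schwartz f" and g: "schwartz g"
  shows "pre_norm e0 s (- \<beta> / 2) (dx (\<lambda>z. f z * g z)) \<le> sqrt C * pre_norm e1 s (a / 2) f * pre_norm e2 s (a / 2) g"
proof -
  define h where "h = (\<lambda>z. f z * g z)"
  have h: "schwartz h" unfolding h_def by (rule schwartz_mult[OF f g])
  define H where "H = weighted e0 s (- \<beta> / 2) (dx h)"
  define F where "F = weighted e1 s (a / 2) f"
  define G where "G = weighted e2 s (a / 2) g"
  define n where "n = pre_norm e0 s (- \<beta> / 2) (dx h)"
  define p where "p = pre_norm e1 s (a / 2) f"
  define q where "q = pre_norm e2 s (a / 2) g"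
  have nn: "H z \<ge> 0" "F z \<ge> 0" "G z \<ge> 0" for z by (simp_all add: H_def F_def G_def weighted_nonneg)
  have npq: "n \<ge> 0" "p \<ge> 0" "q \<ge> 0" by (simp_all add: n_def p_def q_def pre_norm_nonneg)
  have m [measurable]: "H \<in> borel_measurable borel" "F \<in> borel_measurable borel" "G \<in> borel_measurable borel"
    unfolding H_def F_def G_def by (intro weighted_measurable schwartz_dx h f g)+
  have [measurable]: "fourier f \<in> borel_measurable borel" "fourier g \<in> borel_measurable borel"
    by (intro fourier_measurable schwartz_measurable f g)+
  have N: "nn_sq H = ennreal (n\<^sup>2)" "nn_sq F = ennreal (p\<^sup>2)" "nn_sq G = ennreal (q\<^sup>2)"
    unfolding nn_sq_def H_def F_def G_def n_def p_def q_def
    by (intro nn_integral_weighted_sq schwartz_dx h f g)+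
  have "nn_sq H \<le> (\<integral>\<^sup>+z. \<integral>\<^sup>+w. ennreal (kernel e0 e1 e2 z w * (H z * F w * G (z - w))) \<partial>lborel \<partial>lborel)"
    unfolding nn_sq_def
  proof (rule nn_integral_mono)
    fix z :: "real \<times> real"
    obtain \<xi> \<tau> where z: "z = (\<xi>, \<tau>)" by (metis surj_pair)
    define W where "W = \<bar>\<xi>\<bar> * (japanese (\<tau> + e0 * \<xi> ^ 3) powr (- \<beta> / 2) * japanese \<xi> powr s)"
    have W: "W \<ge> 0" by (simp add: W_def)
    have Hz: "H z = W * cmod (fourier h z)"
      unfolding H_def z W_def by (rule weighted_dx[OF h])
    have "ennreal ((H z)\<^sup>2) = ennreal (H z * W) * ennreal (cmod (fourier h z))"
      using nn(1)[of z] W by (subst ennreal_mult[symmetric]) (auto simp: power2_eq_square Hz mult_ac)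
    also have "\<dots> \<le> ennreal (H z * W) * (\<integral>\<^sup>+w. ennreal (cmod (fourier f w) * cmod (fourier g (z - w))) \<partial>lborel)"
      unfolding h_def by (intro mult_left_mono fourier_mult_bound f g) simp
    also have "\<dots> = (\<integral>\<^sup>+w. ennreal (H z * (W * (cmod (fourier f w) * cmod (fourier g (z - w))))) \<partial>lborel)"
      using nn(1)[of z] W by (subst nn_integral_cmult[symmetric]) (auto simp: ennreal_mult mult_ac)
    also have "\<dots> \<le> (\<integral>\<^sup>+w. ennreal (kernel e0 e1 e2 z w * (H z * F w * G (z - w))) \<partial>lborel)"
    proof (intro nn_integral_mono ennreal_leI)
      fix w
      have "H z * (W * (cmod (fourier f w) * cmod (fourier g (z - w)))) \<le> H z * (kernel e0 e1 e2 z w * (F w * G (z - w)))"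
        unfolding W_def F_def G_def z by (intro mult_left_mono kernel_weighted s) (use nn z in auto)
      then show "H z * (W * (cmod (fourier f w) * cmod (fourier g (z - w)))) \<le> kernel e0 e1 e2 z w * (H z * F w * G (z - w))"
        by (simp only: mult_ac)
    qed
    finally show "ennreal ((H z)\<^sup>2) \<le> (\<integral>\<^sup>+w. ennreal (kernel e0 e1 e2 z w * (H z * F w * G (z - w))) \<partial>lborel)" .
  qed
  then have "(nn_sq H)\<^sup>2 \<le> (\<integral>\<^sup>+z. \<integral>\<^sup>+w. ennreal (kernel e0 e1 e2 z w * (H z * F w * G (z - w))) \<partial>lborel \<partial>lborel)\<^sup>2"
    by (rule power_mono) simp
  also have "\<dots> \<le> ennreal C * (nn_sq H * nn_sq F * nn_sq G)"
    by (rule tri) (use nn in auto)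
  finally have "ennreal ((n\<^sup>2)\<^sup>2) \<le> ennreal (C * (n\<^sup>2 * p\<^sup>2 * q\<^sup>2))"
    using C by (simp add: N ennreal_power ennreal_mult)
  then have ineq: "(n\<^sup>2)\<^sup>2 \<le> C * (n\<^sup>2 * p\<^sup>2 * q\<^sup>2)"
    using C by (subst (asm) ennreal_le_iff) auto
  have "n \<le> sqrt C * p * q"
  proof (cases "n = 0")
    case True
    then show ?thesis using C npq by simp
  next
    case False
    have "n\<^sup>2 * n\<^sup>2 \<le> n\<^sup>2 * (C * (p\<^sup>2 * q\<^sup>2))"
      using ineq by (simp only: power2_eq_square mult_ac)
    then have "n\<^sup>2 \<le> C * (p\<^sup>2 * q\<^sup>2)"
      by (rule mult_left_le_imp_le) (use False in simp)
    also have "\<dots> = (sqrt C * p * q)\<^sup>2" using C by (simp add: power_mult_distrib)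
    finally show ?thesis by (rule power2_le_imp_le) (use C npq in simp)
  qed
  then show ?thesis by (simp add: n_def p_def q_def h_def)
qed

text \<open>The factor 9 comes from \<open>trilinear_sum\<close> and 1568 from the majorants; the
  root undoes the squaring of the trilinear form.\<close>

definition bilinear_const :: real where
  "bilinear_const = sqrt (9 * (1568 * slice_const))"

lemma bilinear_const_nonneg: "bilinear_const \<ge> 0"
  using slice_const_nonneg by (simp add: bilinear_const_def)

lemma bilinear_odd_output:
  assumes "e = 1 \<or> e = - 1" "- \<rho> \<le> s" "schwartz f" "schwartz g"
  shows "pre_norm e s (- \<beta> / 2) (dx (\<lambda>z. f z * g z))
    \<le> bilinear_const * pre_norm (- e) s (a / 2) f * pre_norm (- e) s (a / 2) g"
  unfolding bilinear_const_def
proof (rule bilinear_of_trilinear)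
  show "(\<integral>\<^sup>+z. \<integral>\<^sup>+w. ennreal (kernel e (- e) (- e) z w * (H z * F w * G (z - w))) \<partial>lborel \<partial>lborel)\<^sup>2
        \<le> ennreal (9 * (1568 * slice_const)) * (nn_sq H * nn_sq F * nn_sq G)"
    if "H \<in> borel_measurable borel" "F \<in> borel_measurable borel" "G \<in> borel_measurable borel"
      "\<And>z. 0 \<le> H z" "\<And>z. 0 \<le> F z" "\<And>z. 0 \<le> G z" for H F G
    using trilinear_kernel_odd_output[OF assms(1) that] slice_const_nonneg by (simp add: ennreal_mult)
qed (use assms slice_const_nonneg in auto)

lemma bilinear_even_output:
  assumes "e = 1 \<or> e = - 1" "- \<rho> \<le> s" "schwartz f" "schwartz g"
  shows "pre_norm e s (- \<beta> / 2) (dx (\<lambda>z. f z * g z))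
    \<le> bilinear_const * pre_norm e s (a / 2) f * pre_norm (- e) s (a / 2) g"
  unfolding bilinear_const_def
proof (rule bilinear_of_trilinear)
  show "(\<integral>\<^sup>+z. \<integral>\<^sup>+w. ennreal (kernel e e (- e) z w * (H z * F w * G (z - w))) \<partial>lborel \<partial>lborel)\<^sup>2
        \<le> ennreal (9 * (1568 * slice_const)) * (nn_sq H * nn_sq F * nn_sq G)"
    if "H \<in> borel_measurable borel" "F \<in> borel_measurable borel" "G \<in> borel_measurable borel"
      "\<And>z. 0 \<le> H z" "\<And>z. 0 \<le> F z" "\<And>z. 0 \<le> G z" for H F G
    using trilinear_kernel_even_output[OF assms(1) that] slice_const_nonneg by (simp add: ennreal_mult)
qed (use assms slice_const_nonneg in auto)

end

section \<open>Passage to the completion\<close>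

lemma X_cauchyD: "u \<in> X_cauchy a s b \<Longrightarrow> schwartz (u n)"
  by (simp add: X_cauchy_def)

lemma X_rel_equiv: "equiv (X_cauchy a s b) (X_rel a s b)"
proof (rule equivI)
  show "X_rel a s b \<subseteq> X_cauchy a s b \<times> X_cauchy a s b" by (auto simp: X_rel_def)
  have "weighted a s b (\<lambda>z. 0) = (\<lambda>z. 0)"
    by (auto simp: weighted_def fourier_eq)
  then have zero: "pre_norm a s b (\<lambda>z. 0) = 0" by (simp add: pre_norm_eq)
  show "refl_on (X_cauchy a s b) (X_rel a s b)"
    by (auto simp: refl_on_def X_rel_def zero)
  show "sym (X_rel a s b)"
    by (auto simp: sym_def X_rel_def pre_norm_diff_commute[OF X_cauchyD X_cauchyD])
  show "trans (X_rel a s b)"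
  proof (rule transI)
    fix u v w assume uv: "(u, v) \<in> X_rel a s b" and vw: "(v, w) \<in> X_rel a s b"
    then have c: "u \<in> X_cauchy a s b" "v \<in> X_cauchy a s b" "w \<in> X_cauchy a s b"
      by (auto simp: X_rel_def)
    have "(\<lambda>n. pre_norm a s b (\<lambda>z. u n z - v n z) + pre_norm a s b (\<lambda>z. v n z - w n z)) \<longlonglongrightarrow> 0 + 0"
      using uv vw by (intro tendsto_add) (auto simp: X_rel_def)
    then have lim: "(\<lambda>n. pre_norm a s b (\<lambda>z. u n z - v n z) + pre_norm a s b (\<lambda>z. v n z - w n z)) \<longlonglongrightarrow> 0"
      by simp
    have le: "\<forall>\<^sub>F n in sequentially. pre_norm a s b (\<lambda>z. u n z - w n z)
        \<le> pre_norm a s b (\<lambda>z. u n z - v n z) + pre_norm a s b (\<lambda>z. v n z - w n z)"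
      by (intro always_eventually allI pre_norm_diff_triangle X_cauchyD[OF c(1)] X_cauchyD[OF c(2)] X_cauchyD[OF c(3)])
    have "(\<lambda>n. pre_norm a s b (\<lambda>z. u n z - w n z)) \<longlonglongrightarrow> 0"
      by (rule tendsto_sandwich[OF _ le tendsto_const lim]) (simp add: pre_norm_nonneg)
    with c show "(u, w) \<in> X_rel a s b" by (simp add: X_rel_def)
  qed
qed

lemma X_space_cauchy: "U \<in> X_space a s b \<Longrightarrow> u \<in> U \<Longrightarrow> u \<in> X_cauchy a s b"
  unfolding X_space_def by (rule subsetD[OF in_quotient_imp_subset[OF X_rel_equiv]])

lemma X_space_rep:
  assumes "U \<in> X_space a s b"
  obtains u where "u \<in> U" "u \<in> X_cauchy a s b"
proof -
  have "U \<noteq> {}"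
    using assms unfolding X_space_def by (rule in_quotient_imp_non_empty[OF X_rel_equiv])
  then obtain u where "u \<in> U" by auto
  then show ?thesis using that X_space_cauchy[OF assms] by auto
qed

lemma X_space_related: "U \<in> X_space a s b \<Longrightarrow> u \<in> U \<Longrightarrow> v \<in> U \<Longrightarrow> (u, v) \<in> X_rel a s b"
  unfolding X_space_def by (rule in_quotient_imp_in_rel[OF X_rel_equiv]) simp_all

lemma X_cauchy_norm_converges:
  assumes u: "u \<in> X_cauchy a s b"
  shows "convergent (\<lambda>n. pre_norm a s b (u n))"
proof -
  have "Cauchy (\<lambda>n. pre_norm a s b (u n))"
  proof (rule metric_CauchyI)
    fix e :: real assume "e > 0"
    then obtain N where N: "\<And>m n. m \<ge> N \<Longrightarrow> n \<ge> N \<Longrightarrow> pre_norm a s b (\<lambda>z. u m z - u n z) < e"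
      using u unfolding X_cauchy_def by blast
    have "dist (pre_norm a s b (u m)) (pre_norm a s b (u n)) < e" if "m \<ge> N" "n \<ge> N" for m n
      using N[OF that] pre_norm_reverse_triangle[OF X_cauchyD[OF u] X_cauchyD[OF u], of a s b m n]
      by (simp add: dist_real_def)
    then show "\<exists>N. \<forall>m\<ge>N. \<forall>n\<ge>N. dist (pre_norm a s b (u m)) (pre_norm a s b (u n)) < e" by blast
  qed
  then show ?thesis by (rule Cauchy_convergent)
qed

lemma X_cauchy_norm_bounded:
  assumes "u \<in> X_cauchy a s b"
  obtains K where "K > 0" "\<And>n. pre_norm a s b (u n) \<le> K"
proof -
  obtain K where "K > 0" and K: "\<And>n. norm (pre_norm a s b (u n)) \<le> K"
    using BseqE[OF convergent_imp_Bseq[OF X_cauchy_norm_converges[OF assms]]] by blast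
  moreover have "pre_norm a s b (u n) \<le> K" for n
    using K[of n] by (simp add: pre_norm_nonneg)
  ultimately show ?thesis using that by blast
qed

text \<open>Justifies the definite description in \<open>X_norm\<close>: by the reverse triangle
  inequality all representatives of a class share one limit.\<close>

lemma X_norm_tendsto:
  assumes U: "U \<in> X_space a s b" and u: "u \<in> U"
  shows "(\<lambda>n. pre_norm a s b (u n)) \<longlonglongrightarrow> X_norm a s b U"
proof -
  obtain r where r: "(\<lambda>n. pre_norm a s b (u n)) \<longlonglongrightarrow> r"
    using X_cauchy_norm_converges[OF X_space_cauchy[OF U u]] by (auto simp: convergent_def)
  have all: "(\<lambda>n. pre_norm a s b (v n)) \<longlonglongrightarrow> r" if v: "v \<in> U" for v
  proof -
    have sch: "schwartz (u n)" "schwartz (v n)" for n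
      using X_cauchyD X_space_cauchy[OF U] u v by blast+
    have "(\<lambda>n. pre_norm a s b (\<lambda>z. v n z - u n z)) \<longlonglongrightarrow> 0"
      using X_space_related[OF U v u] by (simp add: X_rel_def)
    then have "(\<lambda>n. pre_norm a s b (v n) - pre_norm a s b (u n)) \<longlonglongrightarrow> 0"
      by (rule Lim_null_comparison[rotated]) (simp add: pre_norm_reverse_triangle sch)
    from tendsto_add[OF this r] show ?thesis by simp
  qed
  have "X_norm a s b U = r"
    unfolding X_norm_def
  proof (rule the_equality)
    show "r' = r" if "\<forall>u\<in>U. (\<lambda>n. pre_norm a s b (u n)) \<longlonglongrightarrow> r'" for r'
      using that u r LIMSEQ_unique by blast
  qed (use all in blast)
  then show ?thesis using r by simp
qed

text \<open>Extension of a bounded bilinear map to the completions. The identity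
  \<open>f g - f' g' = (f - f') g + f' (g - g')\<close> yields both the Cauchy property and the
  independence of the representatives.\<close>

lemma dx_product_extension:
  fixes c :: real
  assumes bound: "\<And>f g. schwartz f \<Longrightarrow> schwartz g \<Longrightarrow>
      pre_norm a0 s b' (dx (\<lambda>z. f z * g z)) \<le> c * pre_norm a1 s b f * pre_norm a2 s b g"
    and c: "c \<ge> 0" and U: "U \<in> X_space a1 s b" and V: "V \<in> X_space a2 s b"
  shows "\<exists>W. is_dx_product a0 s b' U V W \<and> X_norm a0 s b' W \<le> c * X_norm a1 s b U * X_norm a2 s b V"
proof -
  let ?p = "\<lambda>f g. dx (\<lambda>z. f z * g z)"
  have diff: "pre_norm a0 s b' (\<lambda>z. ?p f g z - ?p f' g' z)
     \<le> c * pre_norm a1 s b (\<lambda>z. f z - f' z) * pre_norm a2 s b g + c * pre_norm a1 s b f' * pre_norm a2 s b (\<lambda>z. g z - g' z)"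
    if sch: "schwartz f" "schwartz g" "schwartz f'" "schwartz g'" for f g f' g'
  proof -
    have "pre_norm a0 s b' (\<lambda>z. ?p f g z - ?p f' g' z)
      \<le> pre_norm a0 s b' (?p (\<lambda>z. f z - f' z) g) + pre_norm a0 s b' (?p f' (\<lambda>z. g z - g' z))"
    proof (rule pre_norm_le_add)
      fix \<zeta>
      have 1: "fourier (\<lambda>z. (f z - f' z) * g z) \<zeta> = fourier (\<lambda>z. f z * g z) \<zeta> - fourier (\<lambda>z. f' z * g z) \<zeta>"
        using sch by (simp add: left_diff_distrib fourier_schwartz_diff schwartz_mult)
      have 2: "fourier (\<lambda>z. f' z * (g z - g' z)) \<zeta> = fourier (\<lambda>z. f' z * g z) \<zeta> - fourier (\<lambda>z. f' z * g' z) \<zeta>"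
        using sch by (simp add: right_diff_distrib fourier_schwartz_diff schwartz_mult)
      have "fourier (\<lambda>z. ?p f g z - ?p f' g' z) \<zeta> = fourier (?p (\<lambda>z. f z - f' z) g) \<zeta> + fourier (?p f' (\<lambda>z. g z - g' z)) \<zeta>"
        using sch by (simp add: fourier_schwartz_diff schwartz_dx schwartz_mult schwartz_diff fourier_dx 1 2 algebra_simps)
      then show "cmod (fourier (\<lambda>z. ?p f g z - ?p f' g' z) \<zeta>)
        \<le> cmod (fourier (?p (\<lambda>z. f z - f' z) g) \<zeta>) + cmod (fourier (?p f' (\<lambda>z. g z - g' z)) \<zeta>)"
        by (simp add: norm_triangle_ineq)
    qed (intro schwartz_dx schwartz_mult schwartz_diff sch)+
    also have "\<dots> \<le> c * pre_norm a1 s b (\<lambda>z. f z - f' z) * pre_norm a2 s b g + c * pre_norm a1 s b f' * pre_norm a2 s b (\<lambda>z. g z - g' z)"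
      by (intro add_mono bound schwartz_diff sch)
    finally show ?thesis .
  qed
  have cauchy: "(\<lambda>n. ?p (u n) (v n)) \<in> X_cauchy a0 s b'" if u: "u \<in> X_cauchy a1 s b" and v: "v \<in> X_cauchy a2 s b" for u v
  proof -
    have sch: "schwartz (u n)" "schwartz (v n)" for n using u v by (auto simp: X_cauchy_def)
    obtain A where A: "A > 0" "\<And>n. pre_norm a1 s b (u n) \<le> A"
      using X_cauchy_norm_bounded[OF u] by blast
    obtain B where B: "B > 0" "\<And>n. pre_norm a2 s b (v n) \<le> B"
      using X_cauchy_norm_bounded[OF v] by blast
    show ?thesis
      unfolding X_cauchy_def
    proof (intro CollectI conjI allI impI)
      show "schwartz (?p (u n) (v n))" for n by (intro schwartz_dx schwartz_mult sch)
      fix e :: real assume e: "e > 0"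
      \<comment> \<open>\<open>k * d\<close> has to dominate \<open>c * d * B + c * A * d\<close>;
        the summand 1 keeps \<open>k\<close> positive when \<open>c = 0\<close>.\<close>
      define k where "k = (c + 1) * (A + B)"
      define d where "d = e / (2 * k)"
      have k: "k > 0" unfolding k_def using c A B by (intro mult_pos_pos) auto
      then have d: "d > 0" using e by (simp add: d_def)
      obtain N1 where N1: "\<And>m n. m \<ge> N1 \<Longrightarrow> n \<ge> N1 \<Longrightarrow> pre_norm a1 s b (\<lambda>z. u m z - u n z) < d"
        using u d unfolding X_cauchy_def by blast
      obtain N2 where N2: "\<And>m n. m \<ge> N2 \<Longrightarrow> n \<ge> N2 \<Longrightarrow> pre_norm a2 s b (\<lambda>z. v m z - v n z) < d"
        using v d unfolding X_cauchy_def by blast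
      have "pre_norm a0 s b' (\<lambda>z. ?p (u m) (v m) z - ?p (u n) (v n) z) < e" if mn: "m \<ge> max N1 N2" "n \<ge> max N1 N2" for m n
      proof -
        have "pre_norm a0 s b' (\<lambda>z. ?p (u m) (v m) z - ?p (u n) (v n) z)
          \<le> c * pre_norm a1 s b (\<lambda>z. u m z - u n z) * pre_norm a2 s b (v m) + c * pre_norm a1 s b (u n) * pre_norm a2 s b (\<lambda>z. v m z - v n z)"
          by (intro diff sch)
        also have "\<dots> \<le> c * d * B + c * A * d"
          using N1[of m n] N2[of m n] mn A B c d
          by (intro add_mono mult_mono) (auto simp: pre_norm_nonneg less_imp_le)
        also have "\<dots> \<le> k * d" using A B c d by (simp add: k_def algebra_simps)
        also have "\<dots> = e / 2" using k by (simp add: d_def)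
        also have "\<dots> < e" using e by simp
        finally show ?thesis .
      qed
      then show "\<exists>N. \<forall>m\<ge>N. \<forall>n\<ge>N. pre_norm a0 s b' (\<lambda>z. ?p (u m) (v m) z - ?p (u n) (v n) z) < e" by blast
    qed
  qed
  obtain u where u: "u \<in> U" "u \<in> X_cauchy a1 s b" using X_space_rep[OF U] .
  obtain v where v: "v \<in> V" "v \<in> X_cauchy a2 s b" using X_space_rep[OF V] .
  define w where "w = (\<lambda>n. ?p (u n) (v n))"
  \<comment> \<open>The class comes from one pair of representatives; any other pair is shown below
    to give a sequence in the same class.\<close>
  define W where "W = X_rel a0 s b' `` {w}"
  have wc: "w \<in> X_cauchy a0 s b'" unfolding w_def by (rule cauchy[OF u(2) v(2)])
  have W: "W \<in> X_space a0 s b'" unfolding W_def X_space_def by (rule quotientI[OF wc])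
  have wW: "w \<in> W" unfolding W_def by (rule equiv_class_self[OF X_rel_equiv wc])
  have "(\<lambda>n. ?p (u' n) (v' n)) \<in> W" if u': "u' \<in> U" and v': "v' \<in> V" for u' v'
  proof -
    have c': "u' \<in> X_cauchy a1 s b" "v' \<in> X_cauchy a2 s b"
      using X_space_cauchy U V u' v' by blast+
    have lim: "(\<lambda>n. c * pre_norm a1 s b (\<lambda>z. u n z - u' n z) * pre_norm a2 s b (v n) + c * pre_norm a1 s b (u' n) * pre_norm a2 s b (\<lambda>z. v n z - v' n z))
       \<longlonglongrightarrow> c * 0 * X_norm a2 s b V + c * X_norm a1 s b U * 0"
      using X_space_related[OF U u(1) u'] X_space_related[OF V v(1) v']
      by (intro tendsto_intros X_norm_tendsto U V u' v) (auto simp: X_rel_def)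
    have "(\<lambda>n. pre_norm a0 s b' (\<lambda>z. w n z - ?p (u' n) (v' n) z)) \<longlonglongrightarrow> 0"
    proof (rule tendsto_sandwich[OF _ _ tendsto_const])
      show "\<forall>\<^sub>F n in sequentially. pre_norm a0 s b' (\<lambda>z. w n z - ?p (u' n) (v' n) z)
        \<le> c * pre_norm a1 s b (\<lambda>z. u n z - u' n z) * pre_norm a2 s b (v n) + c * pre_norm a1 s b (u' n) * pre_norm a2 s b (\<lambda>z. v n z - v' n z)"
        unfolding w_def
        by (intro always_eventually allI diff X_cauchyD[OF u(2)] X_cauchyD[OF v(2)] X_cauchyD[OF c'(1)] X_cauchyD[OF c'(2)])
    qed (use lim in \<open>auto simp: pre_norm_nonneg\<close>)
    then show ?thesis using wc cauchy[OF c'] by (simp add: W_def X_rel_def)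
  qed
  then have "is_dx_product a0 s b' U V W" using W by (simp add: is_dx_product_def)
  moreover have "X_norm a0 s b' W \<le> c * X_norm a1 s b U * X_norm a2 s b V"
  proof (rule tendsto_le)
    show "(\<lambda>n. pre_norm a0 s b' (w n)) \<longlonglongrightarrow> X_norm a0 s b' W" by (rule X_norm_tendsto[OF W wW])
    show "(\<lambda>n. c * pre_norm a1 s b (u n) * pre_norm a2 s b (v n)) \<longlonglongrightarrow> c * X_norm a1 s b U * X_norm a2 s b V"
      by (intro tendsto_intros X_norm_tendsto U V u v)
    show "\<forall>\<^sub>F n in sequentially. pre_norm a0 s b' (w n) \<le> c * pre_norm a1 s b (u n) * pre_norm a2 s b (v n)"
      unfolding w_def by (intro always_eventually allI bound X_cauchyD[OF u(2)] X_cauchyD[OF v(2)])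
  qed simp
  ultimately show ?thesis by blast
qed

text \<open>\<open>bilinear_even_output\<close> puts the factor with the dispersion of the output
  first, so for output dispersion -1 the product arises with \<open>v\<close> before
  \<open>u\<close>.\<close>

lemma is_dx_product_commute: "is_dx_product a s b U V W \<longleftrightarrow> is_dx_product a s b V U W"
proof -
  have "is_dx_product a s b V U W" if UV: "is_dx_product a s b U V W" for U V
    unfolding is_dx_product_def
  proof (intro conjI ballI)
    fix v u assume "v \<in> V" "u \<in> U"
    then have "(\<lambda>n. dx (\<lambda>z. u n z * v n z)) \<in> W" using UV by (simp add: is_dx_product_def)
    then show "(\<lambda>n. dx (\<lambda>z. v n z * u n z)) \<in> W" by (simp add: mult.commute)
  qed (use UV in \<open>simp add: is_dx_product_def\<close>)
  then show ?thesis by blast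
qed

theorem proposition3p2:
  fixes s :: real
  assumes "s > - 3 / 4"
  shows "\<exists>b' \<in> {- 1 / 2 <..< 0}. \<exists>\<epsilon>\<^sub>s > 0.
    \<forall>b \<in> {1 / 2 <.. b' + 1}. b' + 1 - b \<le> \<epsilon>\<^sub>s \<longrightarrow>
      (\<exists>c > 0. \<forall>u \<in> X_space 1 s b. \<forall>v \<in> X_space (- 1) s b.
        (\<exists>w. is_dx_product 1 s b' v v w \<and>
             X_norm 1 s b' w \<le> c * (X_norm (- 1) s b v)\<^sup>2) \<and>
        (\<exists>w. is_dx_product (- 1) s b' u u w \<and>
             X_norm (- 1) s b' w \<le> c * (X_norm 1 s b u)\<^sup>2) \<and>
        (\<exists>w. is_dx_product 1 s b' u v w \<and>
             X_norm 1 s b' w \<le> c * X_norm 1 s b u * X_norm (- 1) s b v) \<and>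
        (\<exists>w. is_dx_product (- 1) s b' u v w \<and>
             X_norm (- 1) s b' w \<le> c * X_norm 1 s b u * X_norm (- 1) s b v))"
proof -
  \<comment> \<open>\<open>r\<close> is the \<rho> of the locale, and \<beta> =
    \<open>- 2 * b'\<close> will be \<open>1/2 + 2 * r / 3\<close>. The condition
    \<open>2 \<le> \<beta> + 2 * r\<close> then means \<open>9/16 \<le> r\<close>, and
    \<open>2 * r - \<beta> \<le> 1/2\<close> means \<open>r \<le> 3/4\<close>; 5/8 is a convenient
    number in between. The strict bound \<open>r < 3/4\<close> gives
    \<open>b' > -1/2\<close>.\<close>
  define r where "r = max (- s) (5/8)"
  \<comment> \<open>the largest \<open>b'\<close> with \<open>3/2 + 2 * r \<le> 3 * (- 2 * b')\<close>\<close>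
  define b' where "b' = - 1/4 - r / 3"
  have r: "5/8 \<le> r" "r < 3/4" "- r \<le> s" using assms by (auto simp: r_def)
  have b': "b' \<in> {- 1 / 2 <..< 0}" using r by (auto simp: b'_def)
  have main: "\<exists>c > 0. \<forall>u \<in> X_space 1 s b. \<forall>v \<in> X_space (- 1) s b.
        (\<exists>w. is_dx_product 1 s b' v v w \<and>
             X_norm 1 s b' w \<le> c * (X_norm (- 1) s b v)\<^sup>2) \<and>
        (\<exists>w. is_dx_product (- 1) s b' u u w \<and>
             X_norm (- 1) s b' w \<le> c * (X_norm 1 s b u)\<^sup>2) \<and>
        (\<exists>w. is_dx_product 1 s b' u v w \<and>
             X_norm 1 s b' w \<le> c * X_norm 1 s b u * X_norm (- 1) s b v) \<and>
        (\<exists>w. is_dx_product (- 1) s b' u v w \<and>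
             X_norm (- 1) s b' w \<le> c * X_norm 1 s b u * X_norm (- 1) s b v)"
    if b: "b > 1/2" for b
  proof -
    interpret exponents r "- 2 * b'" "2 * b"
      by unfold_locales (use r b in \<open>auto simp: b'_def\<close>)
    \<comment> \<open>Adding 1 turns the nonnegative constant into a strictly positive one.\<close>
    define c where "c = bilinear_const + 1"
    have c: "c > 0" using bilinear_const_nonneg by (simp add: c_def)
    have mono: "bilinear_const * x * y \<le> c * x * y" if "x \<ge> 0" "y \<ge> 0" for x y
      using that by (intro mult_right_mono) (auto simp: c_def)
    have odd: "pre_norm e s b' (dx (\<lambda>z. f z * g z)) \<le> c * pre_norm (- e) s b f * pre_norm (- e) s b g"
      if "e = 1 \<or> e = - 1" "schwartz f" "schwartz g" for e f g
      using order_trans[OF bilinear_odd_output[OF that(1) r(3) that(2,3)] mono[OF pre_norm_nonneg pre_norm_nonneg]]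
      by simp
    have even: "pre_norm e s b' (dx (\<lambda>z. f z * g z)) \<le> c * pre_norm e s b f * pre_norm (- e) s b g"
      if "e = 1 \<or> e = - 1" "schwartz f" "schwartz g" for e f g
      using order_trans[OF bilinear_even_output[OF that(1) r(3) that(2,3)] mono[OF pre_norm_nonneg pre_norm_nonneg]]
      by simp
    have 1: "\<exists>w. is_dx_product 1 s b' v v w \<and> X_norm 1 s b' w \<le> c * (X_norm (- 1) s b v)\<^sup>2"
      if "v \<in> X_space (- 1) s b" for v
    proof -
      have "\<exists>w. is_dx_product 1 s b' v v w \<and> X_norm 1 s b' w \<le> c * X_norm (- 1) s b v * X_norm (- 1) s b v"
        by (rule dx_product_extension[OF odd[of 1] _ that that]) (use c in simp_all)
      then show ?thesis by (simp add: power2_eq_square mult.assoc)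
    qed
    have 2: "\<exists>w. is_dx_product (- 1) s b' u u w \<and> X_norm (- 1) s b' w \<le> c * (X_norm 1 s b u)\<^sup>2"
      if "u \<in> X_space 1 s b" for u
    proof -
      have "\<exists>w. is_dx_product (- 1) s b' u u w \<and> X_norm (- 1) s b' w \<le> c * X_norm 1 s b u * X_norm 1 s b u"
        by (rule dx_product_extension[OF odd[of "- 1", simplified] _ that that]) (use c in simp_all)
      then show ?thesis by (simp add: power2_eq_square mult.assoc)
    qed
    have 3: "\<exists>w. is_dx_product 1 s b' u v w \<and> X_norm 1 s b' w \<le> c * X_norm 1 s b u * X_norm (- 1) s b v"
      if "u \<in> X_space 1 s b" "v \<in> X_space (- 1) s b" for u v
      by (rule dx_product_extension[OF even[of 1] _ that]) (use c in simp_all)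
    have 4: "\<exists>w. is_dx_product (- 1) s b' u v w \<and> X_norm (- 1) s b' w \<le> c * X_norm 1 s b u * X_norm (- 1) s b v"
      if "u \<in> X_space 1 s b" "v \<in> X_space (- 1) s b" for u v
    proof -
      have "\<exists>w. is_dx_product (- 1) s b' v u w \<and> X_norm (- 1) s b' w \<le> c * X_norm (- 1) s b v * X_norm 1 s b u"
        by (rule dx_product_extension[OF even[of "- 1", simplified] _ that(2,1)]) (use c in simp_all)
      moreover have "c * X_norm (- 1) s b v * X_norm 1 s b u = c * X_norm 1 s b u * X_norm (- 1) s b v"
        by simp
      ultimately show ?thesis by (simp only: is_dx_product_commute[of _ _ _ v u])
    qed
    show ?thesis
      by (rule exI[of _ c], rule conjI[OF c], intro ballI conjI) (assumption | rule 1 2 3 4)+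
  qed
  show ?thesis
    by (rule bexI[OF _ b'], rule exI[of _ 1], rule conjI, simp, intro ballI impI, rule main, simp)
qed

end
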